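(* For $-\infty<\beta<\alpha<\infty$ and an infinitely divisible probability measure $\nu$ on a real separable Banach space $E$ such that the following integrals are well defined, we have $$I^{t,\ \int_t^{\infty} u^{-\beta-1}e^{-u}\,du}_{(0,\infty)}\Big(I^{s,\ (\Gamma(\alpha-\beta))^{-1}\int_s^1 (1-u)^{\alpha-\beta-1}u^{-\alpha-1}\,du}_{(0,1)}(\nu)\Big)=I^{t,\ \int_t^{\infty}u^{-\alpha-1}e^{-u}\,du}_{(0,\infty)}(\nu).$$
   Context: Let $E$ be a real separable Banach space and let $ID$ denote the set of infinitely divisible probability measures on $E$. For $\nu\in ID$, let $Y_\nu(t)$, $t\ge 0$, be a Lévy process in $E$ such that $\nu$ is the law of $Y_\nu(1)$. For an interval $(a,b]$ in the positive half-line and two deterministic functions $h$ (the space change) and $r$ (the inner clock time change), the random integral mapping is $$\nu\longmapsto I^{h,r}_{(a,b]}(\nu):=\mathcal L\Big(\int_{(a,b]}h(t)\,dY_\nu(r(t))\Big),$$ where $\mathcal L$ denotes the probability distribution of the random integral. The random integral is defined by the formal integration by parts formula $$\int_{(a,b]}h(t)\,dY_\nu(r(t)):=h(b)Y_\nu(r(b))-h(a)Y_\nu(r(a))-\int_{(a,b]}Y_\nu(r(t)-)\,dh(t)\in E.$$ Mappings over intervals with an open or infinite endpoint are improper and are defined as limits: $I^{h,r}_{(a,\infty)}$ is the limit of $I^{h,r}_{(a,b]}$ as $b\to\infty$, and the improper integrals over $(0,\infty)$ and $(0,1)$ are likewise defined as limits at the endpoints of these intervals. In a superscript of the form $I^{t,\,r(t)}$,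 the first entry is the space change function (here $h(t)=t$) and the second entry is the inner clock $r(t)$; the same applies with $s$ in place of $t$. Thus the clocks in the claim are $t\mapsto\int_t^\infty u^{-\beta-1}e^{-u}\,du$ and $t\mapsto\int_t^\infty u^{-\alpha-1}e^{-u}\,du$ for $0<t<\infty$, and $s\mapsto(\Gamma(\alpha-\beta))^{-1}\int_s^1(1-u)^{\alpha-\beta-1}u^{-\alpha-1}\,du$ for $0<s<1$. $\Gamma$ is the Euler gamma function.
   Formalization: For the decreasing clocks the random integral is taken with the opposite sign to the stated integration by parts formula (dr replaced by |dr|); with the literal sign the identity fails, e.g. for ν=δ_x, x≠0, α<1, where the two sides are point masses at opposite points. *)

theory Defs
  imports "HOL-Probability.Probability"
begin

text \<open>The \<open>n\<close>-fold convolution power is written as the law of a sum of \<open>n\<close> independent copies,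
  because \<^const>\<open>convolution\<close> is only available on ordered Euclidean spaces.\<close>

definition infinitely_divisible ::
    "'e::{banach, second_countable_topology} measure set" where
  "infinitely_divisible =
     {\<nu>. prob_space \<nu> \<and> sets \<nu> = sets borel \<and>
         (\<forall>n::nat. n \<ge> 1 \<longrightarrow> (\<exists>\<mu>. prob_space \<mu> \<and> sets \<mu> = sets borel \<and>
            distr (PiM {..<n} (\<lambda>_. \<mu>)) borel (\<lambda>x. \<Sum>i<n. x i) = \<nu>))}"

definition cadlag :: "(real \<Rightarrow> 'e::topological_space) \<Rightarrow> bool" where
  "cadlag x \<longleftrightarrow>
     (\<forall>t\<ge>0. (x \<longlongrightarrow> x t) (at_right t)) \<and>
     (\<forall>t>0. \<exists>l. (x \<longlongrightarrow> l) (at_left t))"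

text \<open>The time set is \<open>[0,\<infinity>)\<close>; values of \<open>Y\<close> at negative times are irrelevant.
  Every path, not merely almost every path, is required to be cadlag; this keeps pathwise
  integrals measurable without completing \<open>M\<close>.\<close>

definition levy_process ::
    "'w measure \<Rightarrow> (real \<Rightarrow> 'w \<Rightarrow> 'e::{banach, second_countable_topology}) \<Rightarrow> bool" where
  "levy_process M Y \<longleftrightarrow>
     prob_space M \<and>
     (\<forall>t\<ge>0. Y t \<in> borel_measurable M) \<and>
     (AE \<omega> in M. Y 0 \<omega> = 0) \<and>
     (\<forall>n (\<tau> :: nat \<Rightarrow> real). 0 \<le> \<tau> 0 \<and> mono \<tau> \<longrightarrow>
        prob_space.indep_vars M (\<lambda>_. borel) (\<lambda>i \<omega>. Y (\<tau> (Suc i)) \<omega> - Y (\<tau> i) \<omega>) {..<n}) \<and>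
     (\<forall>s\<ge>0. \<forall>t\<ge>0. distr M borel (\<lambda>\<omega>. Y (s + t) \<omega> - Y s \<omega>) = distr M borel (Y t)) \<and>
     (\<forall>t\<ge>0. \<forall>\<epsilon>>0.
        ((\<lambda>s. measure M {\<omega> \<in> space M. dist (Y s \<omega>) (Y t \<omega>) > \<epsilon>}) \<longlongrightarrow> 0) (at t within {0..})) \<and>
     (\<forall>\<omega>\<in>space M. cadlag (\<lambda>t. Y t \<omega>))"

text \<open>The formal integration by parts
  \<open>h(b) x(b) - h(a) x(a) - \<integral>\<^bsub>(a,b]\<^esub> x(t-) dh(t)\<close> for a path \<open>x\<close>. The measure \<open>dh\<close> is the
  Stieltjes measure, so \<open>h\<close> is meant to be nondecreasing and right-continuous;
  for \<open>h(t) = t\<close> it is \<^const>\<open>lborel\<close> (fact \<open>lborel_eq_real\<close>).\<close>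

definition integral_by_parts ::
    "(real \<Rightarrow> real) \<Rightarrow> (real \<Rightarrow> 'e::{banach, second_countable_topology}) \<Rightarrow> real \<Rightarrow> real \<Rightarrow> 'e" where
  "integral_by_parts h x a b =
     h b *\<^sub>R x b - h a *\<^sub>R x a - (LINT t:{a<..b}|interval_measure h. Lim (at_left t) x)"

text \<open>The random integral \<open>\<integral>\<^bsub>(a,b]\<^esub> h(t) dY(r(t))\<close> for a monotone clock \<open>r\<close>. If \<open>r\<close> is
  nondecreasing this is exactly the formula above for the time-changed path \<open>Y \<circ> r\<close>. If \<open>r\<close> is
  nonincreasing, \<open>t \<mapsto> Y(r(t))\<close> runs through \<open>Y\<close> backwards, and the increment of \<open>Y\<close> over
  \<open>(r(t), r(s)]\<close> for \<open>s < t\<close> is \<open>Y(r(s)) - Y(r(t))\<close>. The integral is oriented along the increments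
  of \<open>Y\<close>, so \<open>dr\<close> is replaced by its absolute value; without this, every nonincreasing clock would
  contribute a reflection \<open>x \<mapsto> -x\<close>, and a composition of two such mappings could not agree with a
  single one.\<close>

definition random_integral ::
    "(real \<Rightarrow> real) \<Rightarrow> (real \<Rightarrow> real) \<Rightarrow> real \<Rightarrow> real \<Rightarrow>
     (real \<Rightarrow> 'w \<Rightarrow> 'e::{banach, second_countable_topology}) \<Rightarrow> 'w \<Rightarrow> 'e" where
  "random_integral h r a b Y \<omega> =
     (if antimono_on {a..b} r then - 1 else 1 :: real) *\<^sub>R
       integral_by_parts h (\<lambda>t. Y (r t) \<omega>) a b"

text \<open>The mapping over \<open>(a,b]\<close>, relative to a choice \<open>\<nu> \<mapsto> (\<Omega> \<nu>, Y \<nu>)\<close> of a probability space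
  and a process on it for every infinitely divisible \<open>\<nu>\<close>.\<close>

definition random_integral_map ::
    "('e measure \<Rightarrow> 'w measure) \<Rightarrow>
     ('e measure \<Rightarrow> real \<Rightarrow> 'w \<Rightarrow> 'e::{banach, second_countable_topology}) \<Rightarrow>
     (real \<Rightarrow> real) \<Rightarrow> (real \<Rightarrow> real) \<Rightarrow> real \<Rightarrow> real \<Rightarrow> 'e measure \<Rightarrow> 'e measure" where
  "random_integral_map \<Omega> Y h r a b \<nu> =
     distr (\<Omega> \<nu>) borel (random_integral h r a b (Y \<nu>))"

definition weak_limit ::
    "('i \<Rightarrow> 'e::topological_space measure) \<Rightarrow> 'e measure \<Rightarrow> 'i filter \<Rightarrow> bool" where
  "weak_limit N \<mu> F \<longleftrightarrow>
     prob_space \<mu> \<and> sets \<mu> = sets borel \<and>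
     (\<forall>f :: 'e \<Rightarrow> real. continuous_on UNIV f \<and> bounded (range f) \<longrightarrow>
        ((\<lambda>i. integral\<^sup>L (N i) f) \<longlongrightarrow> integral\<^sup>L \<mu> f) F)"

text \<open>In the improper mappings the filter \<open>F\<close> governs the pair \<open>(a, b)\<close> of endpoints, so that
  both endpoints move simultaneously and independently.\<close>

definition improper_map_dom ::
    "('e measure \<Rightarrow> 'w measure) \<Rightarrow>
     ('e measure \<Rightarrow> real \<Rightarrow> 'w \<Rightarrow> 'e::{banach, second_countable_topology}) \<Rightarrow>
     (real \<Rightarrow> real) \<Rightarrow> (real \<Rightarrow> real) \<Rightarrow> (real \<times> real) filter \<Rightarrow> 'e measure set" where
  "improper_map_dom \<Omega> Y h r F =
     {\<nu> \<in> infinitely_divisible.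
        \<exists>\<mu>. weak_limit (\<lambda>(a, b). random_integral_map \<Omega> Y h r a b \<nu>) \<mu> F}"

definition improper_map ::
    "('e measure \<Rightarrow> 'w measure) \<Rightarrow>
     ('e measure \<Rightarrow> real \<Rightarrow> 'w \<Rightarrow> 'e::{banach, second_countable_topology}) \<Rightarrow>
     (real \<Rightarrow> real) \<Rightarrow> (real \<Rightarrow> real) \<Rightarrow> (real \<times> real) filter \<Rightarrow> 'e measure \<Rightarrow> 'e measure" where
  "improper_map \<Omega> Y h r F \<nu> =
     (THE \<mu>. weak_limit (\<lambda>(a, b). random_integral_map \<Omega> Y h r a b \<nu>) \<mu> F)"

abbreviation ends_0_infinity :: "(real \<times> real) filter" where
  "ends_0_infinity \<equiv> at_right 0 \<times>\<^sub>F at_top"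

abbreviation ends_0_1 :: "(real \<times> real) filter" where
  "ends_0_1 \<equiv> at_right 0 \<times>\<^sub>F at_left 1"

definition gamma_clock :: "real \<Rightarrow> real \<Rightarrow> real" where
  "gamma_clock \<alpha> t = (LBINT u:{t<..}. u powr (- \<alpha> - 1) * exp (- u))"

definition beta_clock :: "real \<Rightarrow> real \<Rightarrow> real \<Rightarrow> real" where
  "beta_clock \<alpha> \<beta> s =
     inverse (Gamma (\<alpha> - \<beta>)) *
       (LBINT u:{s<..<1}. (1 - u) powr (\<alpha> - \<beta> - 1) * u powr (- \<alpha> - 1))"

end

theory Submission
  imports Defs
begin

text \<open>Characteristic functionals determine measures on \<open>E\<close>. Along the ray through a
  functional \<open>l\<close> the process of \<open>\<nu>\<close> has a continuous exponent \<open>g\<close>, the expectation of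
  \<open>exp (i u l(Y(t)))\<close> being \<open>exp (t g(u))\<close>, and the characteristic functional of the random integral
  over \<open>(a,b]\<close> is the exponential of the integral of \<open>g\<close> against the density of the clock. Let
  \<open>f(u) = u powr (- \<alpha> - 1) * exp (- u) * g(u)\<close>, and let \<open>h\<close> be the same expression with \<open>\<beta>\<close> and
  the exponent of the inner mapping. The substitution \<open>u = t s\<close> turns the beta clock into a
  convolution: \<open>h = p * f\<close> for the gamma density \<open>p\<close> with parameter \<open>\<alpha> - \<beta>\<close>. As \<open>p\<close> has integral
  \<open>1\<close>, the improper integrals of \<open>h\<close> and \<open>f\<close> over \<open>(0,\<infinity>)\<close> agree.

  At \<open>0\<close> these integrals may converge only conditionally, so Fubini is not available for \<open>p * f\<close>. It is
  applied to \<open>f\<close> cut off below \<open>\<epsilon>\<close>; for \<open>\<epsilon> \<rightarrow> 0\<close> the integral of \<open>h\<close> over \<open>(a,b]\<close> becomes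
  \<open>(p * F)(a) - (p * F)(b)\<close> with the bounded continuous tail \<open>F(x)\<close>, the integral of \<open>f\<close> over
  \<open>(x,\<infinity>)\<close>. The cut-off can be removed because weak convergence makes the exponents converge
  locally uniformly along the ray.\<close>

section \<open>Separating functionals\<close>

text \<open>Two obstacles are the choice of logarithms and the behaviour at 0. Weak convergence
  controls only exponentials of exponents, and a logarithm is determined up to multiples of
  \<open>2 * pi * i\<close>. All exponents are therefore taken continuous along the ray and zero at
  its origin, which leaves no freedom of branch.

  At infinity the integrals converge absolutely, because an exponent grows at most quadratically. No
  Levy-Khintchine representation enters: the doubling inequality for characteristic functionals,
  applied at small times, passes to the exponent.

  At 0 the existence of the tail limit is itself derived: the kernel \<open>p (1 - u)\<close> is
  smooth and nonzero near \<open>u = 0\<close>, so integration by parts divides it out of a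
  convergent integral.

  The clocks decrease, so the processes are traversed backwards. Left limits of the time-changed
  path then become values of the right-continuous process, and the pathwise integral is a limit of
  weighted sums of independent increments.\<close>

definition sublinear :: "('a::real_vector \<Rightarrow> real) \<Rightarrow> bool" where
  "sublinear p \<longleftrightarrow> (\<forall>x y. p (x + y) \<le> p x + p y) \<and> (\<forall>c\<ge>0. \<forall>x. p (c *\<^sub>R x) \<le> c * p x)"

lemma sublinear_add: "sublinear p \<Longrightarrow> p (x + y) \<le> p x + p y"
  by (auto simp: sublinear_def)

lemma sublinear_0:
  assumes "sublinear p" shows "p 0 = 0"
proof -
  have "p (0 *\<^sub>R 0) \<le> 0 * p 0" using assms unfolding sublinear_def by blast
  moreover have "p (0 + 0) \<le> p 0 + p 0" using assms unfolding sublinear_def by blast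
  ultimately show ?thesis by simp
qed

text \<open>The definition asks only for an inequality, which is easier to check for infima; the
  converse is the same inequality for the factor \<open>inverse c\<close>.\<close>

lemma sublinear_scaleR:
  assumes "sublinear p" "c \<ge> 0" shows "p (c *\<^sub>R x) = c * p x"
proof (cases "c = 0")
  case True
  then show ?thesis using sublinear_0[OF assms(1)] by simp
next
  case False
  with assms have c: "c > 0" by simp
  have "p (inverse c *\<^sub>R (c *\<^sub>R x)) \<le> inverse c * p (c *\<^sub>R x)"
    using assms c unfolding sublinear_def by (metis inverse_nonnegative_iff_nonnegative)
  then have "c * p x \<le> p (c *\<^sub>R x)" using c by (simp add: field_simps)
  moreover have "p (c *\<^sub>R x) \<le> c * p x" using assms unfolding sublinear_def by blast
  ultimately show ?thesis by simp
qed

lemma sublinear_minus: "sublinear p \<Longrightarrow> - p (- x) \<le> p x"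
  using sublinear_add[of p x "- x"] sublinear_0[of p] by simp

text \<open>Provides the bounds of chains for Zorn's lemma. The infimum is finite because every
  member stays above \<open>- p (- x)\<close>.\<close>

lemma sublinear_Inf_chain:
  fixes p :: "'a::real_vector \<Rightarrow> real"
  assumes C: "C \<noteq> {}" "\<And>q. q \<in> C \<Longrightarrow> sublinear q" "\<And>q x. q \<in> C \<Longrightarrow> q x \<le> p x"
    and chain: "\<And>q r. q \<in> C \<Longrightarrow> r \<in> C \<Longrightarrow> (\<forall>x. q x \<le> r x) \<or> (\<forall>x. r x \<le> q x)"
  shows "sublinear (\<lambda>x. INF q\<in>C. q x)" and "\<And>q x. q \<in> C \<Longrightarrow> (INF q\<in>C. q x) \<le> q x"
proof -
  have bdd: "bdd_below ((\<lambda>q. q x) ` C)" for x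
  proof (rule bdd_belowI2)
    fix q assume "q \<in> C"
    then show "- p (- x) \<le> q x" using sublinear_minus[OF C(2), of q x] C(3)[of q "- x"] by linarith
  qed
  let ?u = "\<lambda>x. INF q\<in>C. q x"
  show le: "?u x \<le> q x" if "q \<in> C" for q x
    using cINF_lower[OF bdd that] .
  show "sublinear ?u"
    unfolding sublinear_def
  proof safe
    fix x y
    show "?u (x + y) \<le> ?u x + ?u y"
    proof (rule field_le_epsilon)
      fix e :: real assume e: "e > 0"
      obtain q where q: "q \<in> C" "q x < ?u x + e/2"
        using cINF_less_iff[OF C(1) bdd, of x "?u x + e/2"] e by auto
      obtain r where r: "r \<in> C" "r y < ?u y + e/2"
        using cINF_less_iff[OF C(1) bdd, of y "?u y + e/2"] e by auto
      \<comment> \<open>The smaller of \<open>q\<close> and \<open>r\<close> is nearly optimal at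
        both points; this is where the chain property enters.\<close>
      obtain s where s: "s \<in> C" "s x \<le> q x" "s y \<le> r y"
        using chain[OF q(1) r(1)] q r by (metis order_refl)
      have "?u (x + y) \<le> s x + s y" using le[OF s(1)] sublinear_add[OF C(2)[OF s(1)]] order_trans by blast
      then show "?u (x + y) \<le> ?u x + ?u y + e" using s q r by linarith
    qed
  next
    fix c :: real and x assume c: "c \<ge> 0"
    have *: "?u (c *\<^sub>R x) \<le> c * q x" if "q \<in> C" for q
      using le[OF that, of "c *\<^sub>R x"] sublinear_scaleR[OF C(2)[OF that] c] by simp
    show "?u (c *\<^sub>R x) \<le> c * ?u x"
    proof (cases "c = 0")
      case True then show ?thesis using * C(1) by auto
    next
      case False
      with c have "c > 0" by simp
      then have "?u (c *\<^sub>R x) / c \<le> q x" if "q \<in> C" for q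
        using *[OF that] by (simp add: field_simps)
      then have "?u (c *\<^sub>R x) / c \<le> ?u x" by (intro cINF_greatest[OF C(1)]) auto
      then show ?thesis using \<open>c > 0\<close> by (simp add: field_simps)
    qed
  qed
qed

text \<open>Lowering a sublinear functional so that it becomes linear along the ray through \<open>y\<close>.\<close>

lemma sublinear_lower:
  fixes p :: "'a::real_vector \<Rightarrow> real"
  assumes p: "sublinear p"
  obtains q where "sublinear q" "\<And>x. q x \<le> p x" "\<And>x. q x \<le> p (x + y) - p y"
proof -
  \<comment> \<open>The values \<open>t = 0\<close> and \<open>t = 1\<close> give the two required
    bounds; subadditivity keeps the infimum above \<open>- p (- x)\<close>.\<close>
  define q where "q = (\<lambda>x. INF t\<in>{0..}. p (x + t *\<^sub>R y) - t * p y)"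
  have bdd: "bdd_below ((\<lambda>t. p (x + t *\<^sub>R y) - t * p y) ` {0..})" for x
  proof (rule bdd_belowI2)
    fix t :: real assume "t \<in> {0..}"
    then show "- p (- x) \<le> p (x + t *\<^sub>R y) - t * p y"
      using sublinear_add[OF p, of "- x" "x + t *\<^sub>R y"] sublinear_scaleR[OF p, of t y] by simp
  qed
  have le: "q x \<le> p (x + t *\<^sub>R y) - t * p y" if "t \<ge> 0" for x t
    unfolding q_def using cINF_lower[OF bdd, of t x] that by simp
  have ex: "\<exists>t\<ge>0. p (x + t *\<^sub>R y) - t * p y < q x + e" if "e > 0" for e x
    using cINF_less_iff[OF _ bdd, of x "q x + e"] that unfolding q_def by auto
  have "sublinear q"
    unfolding sublinear_def
  proof safe
    fix x1 x2
    show "q (x1 + x2) \<le> q x1 + q x2"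
    proof (rule field_le_epsilon)
      fix e :: real assume e: "e > 0"
      obtain t1 where t1: "t1 \<ge> 0" "p (x1 + t1 *\<^sub>R y) - t1 * p y < q x1 + e/2" using ex[of "e/2"] e by auto
      obtain t2 where t2: "t2 \<ge> 0" "p (x2 + t2 *\<^sub>R y) - t2 * p y < q x2 + e/2" using ex[of "e/2"] e by auto
      have "q (x1 + x2) \<le> p ((x1 + x2) + (t1 + t2) *\<^sub>R y) - (t1 + t2) * p y"
        using le t1 t2 by simp
      also have "p ((x1 + x2) + (t1 + t2) *\<^sub>R y) \<le> p (x1 + t1 *\<^sub>R y) + p (x2 + t2 *\<^sub>R y)"
        using sublinear_add[OF p, of "x1 + t1 *\<^sub>R y" "x2 + t2 *\<^sub>R y"] by (simp add: algebra_simps)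
      finally show "q (x1 + x2) \<le> q x1 + q x2 + e" using t1 t2 by (simp add: algebra_simps)
    qed
  next
    fix c :: real and x assume c: "c \<ge> 0"
    show "q (c *\<^sub>R x) \<le> c * q x"
    proof (cases "c = 0")
      case True
      then show ?thesis using le[of 0 0] sublinear_0[OF p] by simp
    next
      case False
      with c have c': "c > 0" by simp
      have "q (c *\<^sub>R x) / c \<le> p (x + t *\<^sub>R y) - t * p y" if "t \<ge> 0" for t
      proof -
        have "q (c *\<^sub>R x) \<le> p (c *\<^sub>R (x + t *\<^sub>R y)) - c * t * p y"
          using le[of "c * t" "c *\<^sub>R x"] that c by (simp add: algebra_simps)
        then show ?thesis using c' sublinear_scaleR[OF p c, of "x + t *\<^sub>R y"]
          by (simp only: pos_divide_le_eq) (simp add: algebra_simps)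
      qed
      then have "q (c *\<^sub>R x) / c \<le> q x" unfolding q_def by (intro cINF_greatest) auto
      then show ?thesis using c' by (simp add: field_simps)
    qed
  qed
  moreover have "q x \<le> p x" for x using le[of 0 x] by simp
  moreover have "q x \<le> p (x + y) - p y" for x using le[of 1 x] by simp
  ultimately show ?thesis using that by blast
qed

text \<open>Zorn's lemma replaces the extension argument of Hahn-Banach: minimal sublinear
  functionals turn out to be linear.\<close>

lemma minimal_sublinear:
  fixes p :: "'a::real_vector \<Rightarrow> real"
  assumes p: "sublinear p"
  obtains q where "sublinear q" "\<And>x. q x \<le> p x"
    "\<And>r. sublinear r \<Longrightarrow> (\<And>x. r x \<le> q x) \<Longrightarrow> r = q"
proof -
  define A where "A = {q. sublinear q \<and> (\<forall>x. q x \<le> p x)}"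
  \<comment> \<open>The order is reversed, so that a maximal element for \<open>P\<close> is a
    minimal functional.\<close>
  define P where "P = (\<lambda>q r :: 'a \<Rightarrow> real. \<forall>x. r x \<le> q x)"
  have "\<exists>m\<in>A. \<forall>a\<in>A. P m a \<longrightarrow> a = m"
  proof (rule predicate_Zorn)
    show "partial_order_on A (relation_of P A)"
    proof (rule partial_order_on_relation_ofI)
      show "P a a" for a by (simp add: P_def)
      show "P a c" if "P a b" "P b c" for a b c
        using that unfolding P_def by (meson order_trans)
      show "a = b" if "P a b" "P b a" for a b
        using that unfolding P_def by (intro ext order_antisym) auto
    qed
  next
    fix C assume C: "C \<in> Chains (relation_of P A)"
    show "\<exists>u\<in>A. \<forall>a\<in>C. P a u"
    proof (cases "C = {}")
      case True
      then show ?thesis using p by (auto simp: A_def)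
    next
      case False
      have CA: "C \<subseteq> A" using C by (auto simp: Chains_def relation_of_def)
      have 1: "sublinear q" "q x \<le> p x" if "q \<in> C" for q x using that CA by (auto simp: A_def)
      have 2: "(\<forall>x. q x \<le> r x) \<or> (\<forall>x. r x \<le> q x)" if "q \<in> C" "r \<in> C" for q r
        using that C by (auto simp: Chains_def relation_of_def P_def)
      have u: "sublinear (\<lambda>x. INF q\<in>C. q x)" "\<And>q x. q \<in> C \<Longrightarrow> (INF q\<in>C. q x) \<le> q x"
        using sublinear_Inf_chain[of C p] False 1 2 by auto
      from False obtain q where "q \<in> C" by auto
      then have "(INF q\<in>C. q x) \<le> p x" for x using u(2) 1 order_trans by blast
      then show ?thesis using u by (intro bexI[of _ "\<lambda>x. INF q\<in>C. q x"]) (auto simp: A_def P_def)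
    qed
  qed
  then obtain m where "m \<in> A" "\<And>a. a \<in> A \<Longrightarrow> P m a \<Longrightarrow> a = m" by auto
  then have m: "sublinear m" "\<And>x. m x \<le> p x" "\<And>a. a \<in> A \<Longrightarrow> P m a \<Longrightarrow> a = m"
    by (auto simp: A_def)
  have "r = m" if r: "sublinear r" "\<And>x. r x \<le> m x" for r
  proof (rule m(3))
    show "r \<in> A" using r m(2) unfolding A_def by (auto intro: order_trans)
    show "P m r" using r by (simp add: P_def)
  qed
  then show ?thesis using m(1,2) that by blast
qed

text \<open>Lowering \<open>q\<close> along \<open>y\<close> cannot change it, by minimality. The
  bound gained by lowering then reads \<open>q x \<le> q (x + y) - q y\<close>, which is
  superadditivity.\<close>

lemma minimal_sublinear_linear:
  fixes q :: "'a::real_vector \<Rightarrow> real"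
  assumes q: "sublinear q" and min: "\<And>r. sublinear r \<Longrightarrow> (\<And>x. r x \<le> q x) \<Longrightarrow> r = q"
  shows "linear q"
proof -
  have add: "q (x + y) = q x + q y" for x y
  proof -
    obtain r where r: "sublinear r" "\<And>x. r x \<le> q x" "\<And>x. r x \<le> q (x + y) - q y"
      using sublinear_lower[OF q] by blast
    have "r = q" using min r by blast
    then show ?thesis using r(3)[of x] sublinear_add[OF q, of x y] by simp
  qed
  have neg: "q (- x) = - q x" for x using add[of x "- x"] sublinear_0[OF q] by simp
  have "q (c *\<^sub>R x) = c * q x" for c x
  proof (cases "c \<ge> 0")
    case False
    then have "q ((- c) *\<^sub>R x) = (- c) * q x" using sublinear_scaleR[OF q, of "- c" x] by simp
    then show ?thesis using neg[of "c *\<^sub>R x"] by simp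
  qed (simp add: sublinear_scaleR[OF q])
  then show ?thesis by (intro linearI) (auto simp: add)
qed

text \<open>Lowering the norm along \<open>x\<close> yields \<open>p (- x) \<le> - norm x\<close>.
  Every linear functional below \<open>p\<close> is then at least \<open>norm x\<close> at
  \<open>x\<close>.\<close>

lemma separating_functional:
  fixes x :: "'a::real_normed_vector"
  assumes "x \<noteq> 0"
  obtains l :: "'a \<Rightarrow> real" where "bounded_linear l" "l x \<noteq> 0"
proof -
  have "sublinear (norm :: 'a \<Rightarrow> real)" by (auto simp: sublinear_def norm_triangle_ineq)
  then obtain p where p: "sublinear p" "\<And>y. p y \<le> norm y" "\<And>y. p y \<le> norm (y + x) - norm x"
    using sublinear_lower by blast
  obtain q where q: "sublinear q" "\<And>x. q x \<le> p x" 
    "\<And>r. sublinear r \<Longrightarrow> (\<And>x. r x \<le> q x) \<Longrightarrow> r = q"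
    using minimal_sublinear[OF p(1)] by blast
  have lin: "linear q" using minimal_sublinear_linear[OF q(1,3)] .
  have le: "q y \<le> norm y" for y using q(2) p(2) order_trans by blast
  have "\<bar>q y\<bar> \<le> norm y" for y
    using le[of y] le[of "- y"] linear_neg[OF lin, of y] by simp
  then have "bounded_linear q"
    using lin by (intro bounded_linear_intro[where K = 1]) (auto simp: linear_add linear_scale)
  moreover have "q x \<noteq> 0"
    using order_trans[OF q(2) p(3), of "- x"] linear_neg[OF lin, of x] assms by auto
  ultimately show ?thesis using that by blast
qed

section \<open>Characteristic functionals\<close>

text \<open>Products need no constructor: \<open>cis a * cis b = cis (a + b)\<close> keeps the
  family closed under multiplication, as the Stone-Weierstrass theorem requires.\<close>

inductive trig_polynomial :: "('a::real_normed_vector \<Rightarrow> complex) \<Rightarrow> bool" where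
  base: "bounded_linear l \<Longrightarrow> trig_polynomial (\<lambda>x. c * cis (l x))"
| add: "trig_polynomial f \<Longrightarrow> trig_polynomial g \<Longrightarrow> trig_polynomial (\<lambda>x. f x + g x)"

lemma trig_polynomial_const: "trig_polynomial (\<lambda>x. c)"
  using trig_polynomial.base[OF bounded_linear_zero, of c] by simp

lemma trig_polynomial_cnj: "trig_polynomial f \<Longrightarrow> trig_polynomial (\<lambda>x. cnj (f x))"
proof (induction rule: trig_polynomial.induct)
  case (base l c)
  then show ?case
    using trig_polynomial.base[OF bounded_linear_minus[OF base], of "cnj c"] by (simp add: cis_cnj)
next
  case (add f g)
  then show ?case using trig_polynomial.add by simp
qed

lemma trig_polynomial_mult_base:
  assumes l: "bounded_linear l"
  shows "trig_polynomial f \<Longrightarrow> trig_polynomial (\<lambda>x. c * cis (l x) * f x)"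
proof (induction rule: trig_polynomial.induct)
  case (base k d)
  have "trig_polynomial (\<lambda>x. (c * d) * cis (l x + k x))"
    by (intro trig_polynomial.base bounded_linear_add l base)
  then show ?case by (simp add: cis_mult[symmetric] algebra_simps)
next
  case (add f g)
  then show ?case using trig_polynomial.add by (simp add: distrib_left)
qed

lemma trig_polynomial_mult:
  "trig_polynomial f \<Longrightarrow> trig_polynomial g \<Longrightarrow> trig_polynomial (\<lambda>x. f x * g x)"
proof (induction rule: trig_polynomial.induct)
  case (base l c)
  then show ?case by (intro trig_polynomial_mult_base)
next
  case (add f g)
  then show ?case using trig_polynomial.add by (simp add: distrib_right)
qed

lemma trig_polynomial_continuous: "trig_polynomial f \<Longrightarrow> continuous_on UNIV f"
proof (induction rule: trig_polynomial.induct)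
  case (base l c)
  have "continuous_on UNIV (\<lambda>x. c * exp (\<i> * of_real (l x)))"
    by (intro continuous_intros bounded_linear.continuous_on[OF base])
  then show ?case by (simp add: cis_conv_exp)
qed (intro continuous_intros)

lemma trig_polynomial_bounded: "trig_polynomial f \<Longrightarrow> \<exists>B. \<forall>x. norm (f x) \<le> B"
proof (induction rule: trig_polynomial.induct)
  case (base l c)
  then show ?case by (intro exI[of _ "norm c"]) (simp add: norm_mult)
next
  case (add f g)
  then obtain B C where "norm (f x) \<le> B" "norm (g x) \<le> C" for x by auto
  then show ?case by (intro exI[of _ "B + C"]) (auto intro: order_trans[OF norm_triangle_ineq] add_mono)
qed

definition cf :: "'a::real_normed_vector measure \<Rightarrow> ('a \<Rightarrow> real) \<Rightarrow> complex" where
  "cf M l = (CLINT x|M. cis (l x))"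

lemma borel_measurable_functional:
  "bounded_linear (l :: 'a::real_normed_vector \<Rightarrow> real) \<Longrightarrow> l \<in> borel_measurable borel"
  by (intro borel_measurable_continuous_onI linear_continuous_on)

lemma integrable_bounded_continuous:
  fixes f :: "'a::topological_space \<Rightarrow> 'b::{banach, second_countable_topology}"
  assumes "prob_space M" "sets M = sets borel" "continuous_on UNIV f" "\<And>x. norm (f x) \<le> B"
  shows "integrable M f"
proof -
  interpret prob_space M by fact
  have "f \<in> borel_measurable M"
    using borel_measurable_continuous_onI[OF assms(3)] measurable_cong_sets[OF assms(2) refl] by blast
  then show ?thesis using assms(4) by (intro integrable_const_bound[where B = B]) auto
qed

lemma integral_trig_polynomial_eq:
  fixes M N :: "'a::real_normed_vector measure"
  assumes M: "prob_space M" "sets M = sets borel" and N: "prob_space N" "sets N = sets borel"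
    and eq: "\<And>l. bounded_linear l \<Longrightarrow> cf M l = cf N l"
  shows "trig_polynomial f \<Longrightarrow> (CLINT x|M. f x) = (CLINT x|N. f x)"
proof (induction rule: trig_polynomial.induct)
  case (base l c)
  then show ?case using eq[OF base] by (simp add: cf_def)
next
  case (add f g)
  have "integrable M f" "integrable N f" if "trig_polynomial f" for f :: "'a \<Rightarrow> complex"
    using trig_polynomial_continuous[OF that] trig_polynomial_bounded[OF that]
      integrable_bounded_continuous M N by blast+
  then show ?case using add by simp
qed

definition real_trig :: "('a::real_normed_vector \<Rightarrow> real) set" where
  "real_trig = {\<lambda>x. Re (f x) | f. trig_polynomial f}"

lemma real_trigI: "trig_polynomial f \<Longrightarrow> (\<And>x. g x = Re (f x)) \<Longrightarrow> g \<in> real_trig"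
  unfolding real_trig_def by auto

lemma real_trig_add: "f \<in> real_trig \<Longrightarrow> g \<in> real_trig \<Longrightarrow> (\<lambda>x. f x + g x) \<in> real_trig"
  unfolding real_trig_def by safe (rule exI[of _ "\<lambda>x. _ x + _ x"], auto intro: trig_polynomial.add)

lemma real_trig_const: "(\<lambda>x. c) \<in> real_trig"
  by (rule real_trigI[OF trig_polynomial_const[of "of_real c"]]) simp

lemma real_trig_mult:
  assumes "f \<in> real_trig" "g \<in> real_trig" shows "(\<lambda>x. f x * g x) \<in> real_trig"
proof -
  obtain F G where FG: "trig_polynomial F" "trig_polynomial G" "f = (\<lambda>x. Re (F x))" "g = (\<lambda>x. Re (G x))"
    using assms unfolding real_trig_def by auto
  \<comment> \<open>\<open>Re F * Re G = Re (F * Re G)\<close>, and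
    \<open>Re G = (G + cnj G) / 2\<close> is again a trigonometric polynomial.\<close>
  have "trig_polynomial (\<lambda>x. (1/2) * (F x * (G x + cnj (G x))))"
    by (intro trig_polynomial_mult trig_polynomial_const trig_polynomial.add trig_polynomial_cnj FG)
  then show ?thesis by (rule real_trigI) (simp add: FG)
qed

text \<open>Allows a polynomial approximation of a truncation to act on a trigonometric polynomial
  without leaving the ring.\<close>

lemma real_trig_polynomial:
  fixes q :: "real \<Rightarrow> real"
  assumes "real_polynomial_function q" "p \<in> real_trig"
  shows "(\<lambda>x. q (p x)) \<in> real_trig"
  using assms(1)
proof (induction rule: real_polynomial_function.induct)
  case (linear f)
  then obtain c where "f = (\<lambda>x. x * c)" using real_bounded_linear by auto
  then show ?case using real_trig_mult[OF assms(2) real_trig_const[of c]] by simp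
qed (auto intro: real_trig_const real_trig_add real_trig_mult)

lemma function_ring_real_trig:
  fixes K :: "'a::{banach, second_countable_topology} set"
  assumes "compact K" shows "function_ring_on real_trig K"
proof
  show "compact K" by fact
  show "continuous_on K f" if f: "f \<in> real_trig" for f :: "'a \<Rightarrow> real"
  proof -
    obtain F where F: "trig_polynomial F" "f = (\<lambda>x. Re (F x))" using f by (auto simp: real_trig_def)
    show ?thesis unfolding F(2)
      by (intro continuous_on_Re continuous_on_subset[OF trig_polynomial_continuous[OF F(1)]] subset_UNIV)
  qed
  show "\<exists>f\<in>real_trig. f x \<noteq> f y" if xy: "x \<in> K" "y \<in> K" "x \<noteq> y" for x y :: 'a
  proof -
    obtain l :: "'a \<Rightarrow> real" where l: "bounded_linear l" "l (x - y) \<noteq> 0"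
      using separating_functional[of "x - y"] xy by auto
    \<comment> \<open>The scaling makes the phases at \<open>x\<close> and \<open>y\<close> differ
      by \<open>pi\<close>, so that \<open>cis (- k y) * cis (k z)\<close> takes the values
      \<open>-1\<close> and \<open>1\<close> there.\<close>
    define k where "k = (\<lambda>z. l z * (pi / l (x - y)))"
    have k: "bounded_linear k" unfolding k_def
      by (intro bounded_linear_mult_const l)
    have kxy: "k x - k y = pi"
    proof -
      have "k x - k y = l (x - y) * (pi / l (x - y))"
        unfolding k_def linear_diff[OF bounded_linear.linear[OF l(1)]] by (rule left_diff_distrib[symmetric])
      then show ?thesis using l(2) by simp
    qed
    have ring: "(\<lambda>z. Re (cis (- k y) * cis (k z))) \<in> real_trig"
      by (rule real_trigI[OF trig_polynomial.base[OF k, of "cis (- k y)"] refl])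
    have "Re (cis (- k y) * cis (k x)) \<noteq> Re (cis (- k y) * cis (k y))"
    proof -
      have "cis (- k y) * cis (k x) = cis pi" "cis (- k y) * cis (k y) = 1"
        using kxy by (simp_all add: cis_mult)
      then show ?thesis by simp
    qed
    then show ?thesis by (rule bexI[OF _ ring])
  qed
qed (auto intro: real_trig_const real_trig_add real_trig_mult)

section \<open>Uniqueness of measures with given characteristic functional\<close>

lemma compact_almost_full:
  fixes M :: "'a::{banach, second_countable_topology} measure"
  assumes M: "prob_space M" "sets M = sets borel" and e: "e > 0"
  obtains K where "compact K" "measure M (- K) < e"
proof -
  interpret prob_space M by fact
  have sp: "space M = UNIV" using M(2) by (metis sets_eq_imp_space_eq space_borel)
  \<comment> \<open>Tightness of a single measure is inner regularity applied to the whole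
    space.\<close>
  have "1 = (SUP K \<in> {K. K \<subseteq> UNIV \<and> compact K}. emeasure M K)"
    using inner_regular[OF M(2), of UNIV] emeasure_space_1 by (simp add: sp)
  then have "ennreal (1 - e) < (SUP K \<in> {K. K \<subseteq> UNIV \<and> compact K}. emeasure M K)"
    using e ennreal_less_one_iff[of "1 - e"] by simp
  then obtain K where K: "compact K" "ennreal (1 - e) < emeasure M K"
    by (auto simp: less_SUP_iff)
  have "1 - e < measure M K"
    using K(2) emeasure_eq_measure[of K] by (cases "1 - e \<ge> 0") (auto simp: ennreal_less_iff intro: order_less_le_trans[OF _ measure_nonneg])
  moreover have "K \<in> sets M" using K(1) M(2) by (simp add: borel_compact)
  then have "measure M (- K) = 1 - measure M K" using prob_compl[of K] by (simp add: sp Compl_eq_Diff_UNIV)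
  ultimately show ?thesis using that[OF K(1)] by simp
qed

lemma integral_diff_le_off_small:
  fixes f g :: "'a::topological_space \<Rightarrow> real"
  assumes M: "prob_space M" "sets M = sets borel"
    and f: "continuous_on UNIV f" "\<And>x. \<bar>f x\<bar> \<le> B" and g: "continuous_on UNIV g" "\<And>x. \<bar>g x\<bar> \<le> C"
    and K: "- K \<in> sets borel" "measure M (- K) \<le> d" "\<And>x. x \<in> K \<Longrightarrow> \<bar>f x - g x\<bar> \<le> e"
    and "e \<ge> 0" "d \<ge> 0"
  shows "\<bar>integral\<^sup>L M f - integral\<^sup>L M g\<bar> \<le> e + (B + C) * d"
proof -
  interpret prob_space M by fact
  have int: "integrable M f" "integrable M g"
    using integrable_bounded_continuous[OF M f(1), of B] integrable_bounded_continuous[OF M g(1), of C] f g by auto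
  have KM: "- K \<in> sets M" using K M by simp
  have BC: "0 \<le> B" "0 \<le> C" using f(2) g(2) abs_ge_zero order_trans by blast+
  have intK: "integrable M (\<lambda>x. e + (B + C) * indicator (- K) x)"
    using KM by (intro Bochner_Integration.integrable_add integrable_mult_right) (auto simp: less_top[symmetric])
  have "\<bar>integral\<^sup>L M f - integral\<^sup>L M g\<bar> = \<bar>integral\<^sup>L M (\<lambda>x. f x - g x)\<bar>" using int by simp
  also have "\<dots> \<le> integral\<^sup>L M (\<lambda>x. \<bar>f x - g x\<bar>)" by (rule integral_abs_bound)
  also have "\<dots> \<le> integral\<^sup>L M (\<lambda>x. e + (B + C) * indicator (- K) x)"
  proof (rule integral_mono)
    fix x
    have "\<bar>f x - g x\<bar> \<le> B + C" using f(2)[of x] g(2)[of x] by linarith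
    then show "\<bar>f x - g x\<bar> \<le> e + (B + C) * indicator (- K) x"
      using K(3)[of x] \<open>e \<ge> 0\<close> by (auto simp: indicator_def)
  qed (use int intK in auto)
  also have "\<dots> = e + (B + C) * measure M (- K)"
    using KM by (subst Bochner_Integration.integral_add) (auto simp: less_top[symmetric] prob_space)
  also have "\<dots> \<le> e + (B + C) * d" using K BC by (intro add_left_mono mult_left_mono) auto
  finally show ?thesis .
qed

text \<open>Stone-Weierstrass gives an approximant \<open>p\<close> on a compact set only, and the
  bound of \<open>p\<close> off that set depends on the accuracy, so small mass does not make its
  contribution small. Composing \<open>p\<close> with a polynomial close to the truncation to
  \<open>[-B, B]\<close> gives an approximant bounded by \<open>B + e\<close> everywhere.\<close>

lemma integral_bounded_continuous_eq:
  fixes M N :: "'a::{banach, second_countable_topology} measure" and f :: "'a \<Rightarrow> real"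
  assumes M: "prob_space M" "sets M = sets borel" and N: "prob_space N" "sets N = sets borel"
    and eq: "\<And>l. bounded_linear l \<Longrightarrow> cf M l = cf N l"
    and f: "continuous_on UNIV f" "\<And>x. \<bar>f x\<bar> \<le> B"
  shows "integral\<^sup>L M f = integral\<^sup>L N f"
proof -
  have B: "B \<ge> 0" using f(2) abs_ge_zero order_trans by blast
  \<comment> \<open>\<open>2 * e\<close> is the error on the compact set, \<open>B + (B + e)\<close>
    the crude bound off it, where the mass is at most \<open>e\<close>; the outer factor counts the
    two measures.\<close>
  have bound: "\<bar>integral\<^sup>L M f - integral\<^sup>L N f\<bar> \<le> 2 * (2 * e + (B + (B + e)) * e)" if e: "e > 0" for e
  proof -
    obtain K1 K2 where K12: "compact K1" "measure M (- K1) < e" "compact K2" "measure N (- K2) < e"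
      using compact_almost_full[OF M e] compact_almost_full[OF N e] by metis
    define K where "K = K1 \<union> K2"
    have K: "compact K" using K12 by (auto simp: K_def)
    have sK: "- K \<in> sets borel" "- K1 \<in> sets borel" "- K2 \<in> sets borel"
      using borel_compact[OF K] borel_compact[OF K12(1)] borel_compact[OF K12(3)] by (simp_all add: borel_comp)
    have mK: "measure M (- K) \<le> e" "measure N (- K) \<le> e"
    proof -
      interpret M: prob_space M by fact
      interpret N: prob_space N by fact
      have "measure M (- K) \<le> measure M (- K1)" "measure N (- K) \<le> measure N (- K2)"
        using sK M N by (auto intro!: M.finite_measure_mono N.finite_measure_mono simp: K_def)
      then show "measure M (- K) \<le> e" "measure N (- K) \<le> e" using K12 by auto
    qed
    interpret R: function_ring_on real_trig K by (rule function_ring_real_trig[OF K])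
    obtain p where p: "p \<in> real_trig" "\<And>x. x \<in> K \<Longrightarrow> \<bar>f x - p x\<bar> < e"
      using R.Stone_Weierstrass_basic[OF continuous_on_subset[OF f(1)] e] by auto
    obtain R where R: "\<bar>p x\<bar> \<le> R" for x
    proof -
      obtain F where F: "trig_polynomial F" "p = (\<lambda>x. Re (F x))" using p by (auto simp: real_trig_def)
      obtain R where "norm (F x) \<le> R" for x using trig_polynomial_bounded[OF F(1)] by auto
      then have "\<bar>p x\<bar> \<le> R" for x unfolding F(2) using abs_Re_le_cmod order_trans by blast
      then show ?thesis using that by blast
    qed
    define \<kappa> where "\<kappa> = (\<lambda>y::real. max (- B) (min B y))"
    have "continuous_on {- R..R} \<kappa>" unfolding \<kappa>_def by (intro continuous_intros)
    then obtain q where q: "real_polynomial_function q" "\<And>y. y \<in> {- R..R} \<Longrightarrow> \<bar>\<kappa> y - q y\<bar> < e"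
      using Stone_Weierstrass_real_polynomial_function[of "{- R..R}" \<kappa> e] e by auto
    define h where "h = (\<lambda>x. q (p x))"
    have h: "h \<in> real_trig" unfolding h_def by (rule real_trig_polynomial[OF q(1) p(1)])
    have qp: "\<bar>\<kappa> (p x) - h x\<bar> < e" for x 
    proof -
      have "- R \<le> p x" "p x \<le> R" using R[of x] by linarith+
      then show ?thesis unfolding h_def by (intro q(2)) simp
    qed
    have hB: "\<bar>h x\<bar> \<le> B + e" for x
    proof -
      have "\<bar>\<kappa> (p x)\<bar> \<le> B" using B unfolding \<kappa>_def by linarith
      then show ?thesis using qp[of x] by linarith
    qed
    have hK: "\<bar>f x - h x\<bar> \<le> 2 * e" if "x \<in> K" for x
    proof -
      \<comment> \<open>Truncation to \<open>[-B, B]\<close> does not increase the distance to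
        \<open>f\<close>, whose values lie in that interval.\<close>
      have "\<bar>f x - \<kappa> (p x)\<bar> \<le> \<bar>f x - p x\<bar>" using f(2)[of x] unfolding \<kappa>_def by linarith
      then show ?thesis using p(2)[OF that] qp[of x] by linarith
    qed
    obtain H where H: "trig_polynomial H" "h = (\<lambda>x. Re (H x))" using h by (auto simp: real_trig_def)
    have hc: "continuous_on UNIV h" unfolding H(2) by (intro continuous_intros trig_polynomial_continuous[OF H(1)])
    have Hint: "integrable M H" "integrable N H"
      using trig_polynomial_continuous[OF H(1)] trig_polynomial_bounded[OF H(1)]
        integrable_bounded_continuous M N by blast+
    have "integral\<^sup>L M h = integral\<^sup>L N h"
      unfolding H(2) using integral_trig_polynomial_eq[OF M N eq H(1)] Hint by (simp add: integral_Re)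
    moreover have "\<bar>integral\<^sup>L M f - integral\<^sup>L M h\<bar> \<le> 2 * e + (B + (B + e)) * e"
      by (rule integral_diff_le_off_small[OF M f hc hB sK(1) mK(1) hK]) (use e in auto)
    moreover have "\<bar>integral\<^sup>L N f - integral\<^sup>L N h\<bar> \<le> 2 * e + (B + (B + e)) * e"
      by (rule integral_diff_le_off_small[OF N f hc hB sK(1) mK(2) hK]) (use e in auto)
    ultimately have "\<bar>integral\<^sup>L M f - integral\<^sup>L N f\<bar> \<le> (2 * e + (B + (B + e)) * e) + (2 * e + (B + (B + e)) * e)"
      by (smt (verit))
    then show ?thesis by (simp only: mult_2)
  qed
  have lim: "((\<lambda>e. 2 * (2 * e + (B + (B + e)) * e)) \<longlongrightarrow> 2 * (2 * 0 + (B + (B + 0)) * 0)) (at_right 0)"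
    by (intro tendsto_intros)
  have ev: "\<forall>\<^sub>F e in at_right 0. \<bar>integral\<^sup>L M f - integral\<^sup>L N f\<bar> \<le> 2 * (2 * e + (B + (B + e)) * e)"
    by (rule eventually_mono[OF eventually_at_right_less]) (rule bound)
  have "\<bar>integral\<^sup>L M f - integral\<^sup>L N f\<bar> \<le> 2 * (2 * 0 + (B + (B + 0)) * 0)"
    by (rule tendsto_lowerbound[OF lim ev]) simp
  then show ?thesis by simp
qed

text \<open>The indicator of a closed set is a pointwise limit of bounded continuous functions of
  the distance to it, and the closed sets form an intersection-stable generator.\<close>

lemma measure_eqI_bounded_continuous:
  fixes M N :: "'a::metric_space measure"
  assumes M: "prob_space M" "sets M = sets borel" and N: "prob_space N" "sets N = sets borel"
    and eq: "\<And>f :: 'a \<Rightarrow> real. continuous_on UNIV f \<Longrightarrow> bounded (range f) \<Longrightarrow> integral\<^sup>L M f = integral\<^sup>L N f"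
  shows "M = N"
proof -
  interpret M: prob_space M by fact
  interpret N: prob_space N by fact
  have spM: "space M = UNIV" using M(2) by (metis sets_eq_imp_space_eq space_borel)
  have spN: "space N = UNIV" using N(2) by (metis sets_eq_imp_space_eq space_borel)
  have cl: "measure M C = measure N C" if C: "closed C" for C
  \<comment> \<open>The empty set is separate because \<open>infdist x {}\<close> has the default
    value 0, which would make the functions \<open>f n\<close> constantly 1.\<close>
  proof (cases "C = {}")
    case False
    define f where "f = (\<lambda>n::nat. \<lambda>x. max 0 (1 - real n * infdist x C))"
    have cont: "continuous_on UNIV (f n)" for n unfolding f_def by (intro continuous_intros)
    have bd: "norm (f n x) \<le> 1" for n x unfolding f_def by (auto simp: infdist_nonneg)
    have lim: "(\<lambda>n. f n x) \<longlonglongrightarrow> indicator C x" for x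
    proof (cases "x \<in> C")
      case True
      then show ?thesis by (simp add: f_def)
    next
      case nC: False
      have pos: "infdist x C > 0"
        using nC C False in_closed_iff_infdist_zero[of C x] infdist_nonneg[of x C] by auto
      obtain n0 :: nat where "1 < real n0 * infdist x C"
        using reals_Archimedean3[OF pos] by auto
      then have "f n x = 0" if "n \<ge> n0" for n
      proof -
        have "real n0 * infdist x C \<le> real n * infdist x C" using that pos by (intro mult_right_mono) auto
        then have "1 - real n * infdist x C \<le> 0" using \<open>1 < real n0 * infdist x C\<close> by linarith
        then show ?thesis unfolding f_def by (rule max_absorb1)
      qed
      then have "\<forall>\<^sub>F n in sequentially. f n x = 0" by (auto simp: eventually_sequentially)
      then show ?thesis using nC by (simp add: tendsto_eventually)
    qed
    have conv: "(\<lambda>n. integral\<^sup>L P (f n)) \<longlonglongrightarrow> measure P C" if P: "prob_space P" "sets P = sets borel" for P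
    proof -
      interpret prob_space P by fact
      have "(\<lambda>n. integral\<^sup>L P (f n)) \<longlonglongrightarrow> integral\<^sup>L P (indicator C :: 'a \<Rightarrow> real)"
      proof (rule integral_dominated_convergence[where w = "\<lambda>_. 1"])
        show "f n \<in> borel_measurable P" for n
          using borel_measurable_continuous_onI[OF cont] measurable_cong_sets[OF P(2) refl] by blast
        show "(indicator C :: 'a \<Rightarrow> real) \<in> borel_measurable P" using C P by (intro borel_measurable_indicator) auto
      qed (use lim bd in auto)
      then show ?thesis using C P by simp
    qed
    have "integral\<^sup>L M (f n) = integral\<^sup>L N (f n)" for n
      using cont bd by (intro eq) (auto simp: bounded_iff)
    then show ?thesis using conv[OF M] conv[OF N] LIMSEQ_unique by auto
  qed simp
  show ?thesis
  proof (rule measure_eqI_generator_eq[where E = "Collect closed" and \<Omega> = UNIV and A = "\<lambda>_. UNIV"])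
    show "Int_stable (Collect closed :: 'a set set)" by (auto simp: Int_stable_def)
    show "emeasure M X = emeasure N X" if "X \<in> Collect closed" for X
      using cl[of X] that by (simp add: M.emeasure_eq_measure N.emeasure_eq_measure)
    show "sets M = sigma_sets UNIV (Collect closed)" "sets N = sigma_sets UNIV (Collect closed)"
      using M N by (simp_all add: borel_eq_closed)
  qed auto
qed

theorem cf_unique:
  fixes M N :: "'a::{banach, second_countable_topology} measure"
  assumes M: "prob_space M" "sets M = sets borel" and N: "prob_space N" "sets N = sets borel"
    and eq: "\<And>l. bounded_linear l \<Longrightarrow> cf M l = cf N l"
  shows "M = N"
proof (rule measure_eqI_bounded_continuous[OF M N])
  fix f :: "'a \<Rightarrow> real" assume f: "continuous_on UNIV f" "bounded (range f)"
  then obtain B where "\<bar>f x\<bar> \<le> B" for x by (auto simp: bounded_iff)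
  then show "integral\<^sup>L M f = integral\<^sup>L N f"
    using integral_bounded_continuous_eq[OF M N eq f(1)] by blast
qed

section \<open>Exponents of Levy processes\<close>

lemma cf_0: "prob_space M \<Longrightarrow> cf M (\<lambda>x. 0) = 1"
  by (simp add: cf_def prob_space.prob_space)

lemma norm_cis_diff_le: "norm (cis a - cis b) \<le> min 2 \<bar>a - b\<bar>"
proof -
  have "norm (cis a - cis b) = norm (cis b * (cis (a - b) - 1))"
    by (simp add: cis_mult right_diff_distrib)
  also have "\<dots> = norm (cis (a - b) - 1)" by (simp add: norm_mult)
  also have "\<dots> \<le> \<bar>a - b\<bar>" using iexp_approx1[of "a - b" 0] by (simp add: cis_conv_exp)
  finally have "norm (cis a - cis b) \<le> \<bar>a - b\<bar>" .
  moreover have "norm (cis a - cis b) \<le> 2" using norm_triangle_ineq4[of "cis a" "cis b"] by simp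
  ultimately show ?thesis by simp
qed

lemma continuous_cis_functional:
  assumes "bounded_linear (l :: 'a::real_normed_vector \<Rightarrow> real)"
  shows "continuous_on UNIV (\<lambda>x. cis (l x))"
  using trig_polynomial_continuous[OF trig_polynomial.base[OF assms, of 1]] by simp

lemma measurable_cis_functional:
  assumes "bounded_linear (l :: 'a::real_normed_vector \<Rightarrow> real)"
  shows "(\<lambda>x. cis (l x)) \<in> borel_measurable borel"
  by (intro borel_measurable_continuous_onI continuous_cis_functional assms)

lemma integrable_cis_functional:
  assumes "prob_space M" "sets M = sets borel" "bounded_linear (l :: 'a::real_normed_vector \<Rightarrow> real)"
  shows "integrable M (\<lambda>x. cis (l x))"
  by (rule integrable_bounded_continuous[where B = 1]) (use assms continuous_cis_functional in auto)

lemma cf_distr: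
  fixes X :: "'w \<Rightarrow> 'a::real_normed_vector"
  assumes "X \<in> borel_measurable M" "bounded_linear l"
  shows "cf (distr M borel X) l = (CLINT \<omega>|M. cis (l (X \<omega>)))"
  unfolding cf_def by (rule integral_distr[OF assms(1) measurable_cis_functional[OF assms(2)]])

lemma cf_ray_continuous:
  fixes M :: "'a::real_normed_vector measure"
  assumes M: "prob_space M" "sets M = sets borel" and l: "bounded_linear l"
  shows "continuous_on UNIV (\<lambda>u. cf M (\<lambda>x. u * l x))"
proof -
  interpret prob_space M by fact
  have "(\<lambda>n. cf M (\<lambda>x. v n * l x)) \<longlonglongrightarrow> cf M (\<lambda>x. u * l x)" if v: "v \<longlonglongrightarrow> u" for u and v :: "nat \<Rightarrow> real"
    unfolding cf_def
  proof (rule integral_dominated_convergence[where w = "\<lambda>_. 1"])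
    show "(\<lambda>x. cis (u * l x)) \<in> borel_measurable M" for u
      using measurable_cis_functional[OF bounded_linear_const_mult[OF l]] measurable_cong_sets[OF M(2) refl] by blast
    then show "(\<lambda>x. cis (v i * l x)) \<in> borel_measurable M" for i .
    show "AE x in M. (\<lambda>i. cis (v i * l x)) \<longlonglongrightarrow> cis (u * l x)"
      unfolding cis_conv_exp by (intro AE_I2 tendsto_intros v)
  qed auto
  then show ?thesis by (auto simp: continuous_on_sequentially comp_def)
qed

text \<open>Comes from \<open>1 - z\<^sup>2 = 2 (1 - z) - (1 - z)\<^sup>2\<close> and \<open>\<bar>1 - z\<bar>\<^sup>2 = 2 (1 - Re z)\<close> for \<open>\<bar>z\<bar> = 1\<close>.\<close>

lemma cf_doubling:
  fixes M :: "'a::real_normed_vector measure"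
  assumes M: "prob_space M" "sets M = sets borel" and l: "bounded_linear l"
  shows "norm (1 - cf M (\<lambda>x. 2 * l x)) \<le> 4 * norm (1 - cf M l)"
proof -
  interpret prob_space M by fact
  let ?z = "\<lambda>x. cis (l x)"
  have int: "integrable M ?z" "integrable M (\<lambda>x. cis (2 * l x))"
    using integrable_cis_functional[OF M l] integrable_cis_functional[OF M bounded_linear_const_mult[OF l]] by auto
  have sq: "(1 - ?z x)\<^sup>2 = 2 * (1 - ?z x) - (1 - cis (2 * l x))" for x
    by (simp add: power2_eq_square algebra_simps cis_mult)
  have nsq: "norm ((1 - ?z x)\<^sup>2) = 2 * (1 - Re (?z x))" for x
  proof -
    have "norm ((1 - ?z x)\<^sup>2) = (1 - cos (l x))\<^sup>2 + (sin (l x))\<^sup>2"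
      unfolding norm_power cmod_power2 by simp
    also have "\<dots> = ((sin (l x))\<^sup>2 + (cos (l x))\<^sup>2) + 1 - 2 * cos (l x)"
      by (simp only: power2_diff) simp
    finally show ?thesis by simp
  qed
  have int2: "integrable M (\<lambda>x. (1 - ?z x)\<^sup>2)"
    unfolding sq by (intro Bochner_Integration.integrable_diff integrable_mult_right int integrable_const)
  have eq: "1 - cf M (\<lambda>x. 2 * l x) = 2 * (1 - cf M l) - (CLINT x|M. (1 - ?z x)\<^sup>2)"
    unfolding sq cf_def using int by (simp add: prob_space)
  have "norm (CLINT x|M. (1 - ?z x)\<^sup>2) \<le> (LINT x|M. norm ((1 - ?z x)\<^sup>2))"
    by (rule integral_norm_bound)
  also have "\<dots> = 2 * (1 - Re (cf M l))"
    unfolding nsq using int integrable_Re[OF int(1)] integral_Re[OF int(1)]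
    by (simp add: prob_space cf_def del: cis.sel)
  also have "\<dots> \<le> 2 * norm (1 - cf M l)"
    using complex_Re_le_cmod[of "1 - cf M l"] by simp
  finally have "norm (CLINT x|M. (1 - ?z x)\<^sup>2) \<le> 2 * norm (1 - cf M l)" .
  moreover have "norm (1 - cf M (\<lambda>x. 2 * l x)) \<le> 2 * norm (1 - cf M l) + norm (CLINT x|M. (1 - ?z x)\<^sup>2)"
    unfolding eq by (rule order_trans[OF norm_triangle_ineq4]) (simp only: norm_mult norm_numeral order_refl)
  ultimately show ?thesis by linarith
qed

lemma cadlag_right_sequence:
  assumes "cadlag x" "t \<ge> 0" "\<And>n. u n \<ge> t" "u \<longlonglongrightarrow> t"
  shows "(\<lambda>n. x (u n)) \<longlonglongrightarrow> x t"
proof -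
  have "(x \<longlongrightarrow> x t) (at t within {t..})"
    using assms(1,2) by (simp add: cadlag_def at_within_Ici_at_right)
  then have "continuous (at t within {t..}) x" by (simp add: continuous_within)
  then show ?thesis
    by (rule continuous_within_tendsto_compose[OF _ _ assms(4)]) (use assms(3) in auto)
qed

section \<open>Characteristic functionals of Levy processes\<close>

lemma levy_processD:
  assumes "levy_process M Y"
  shows "prob_space M" "t \<ge> 0 \<Longrightarrow> Y t \<in> borel_measurable M" "AE \<omega> in M. Y 0 \<omega> = 0"
    "\<omega> \<in> space M \<Longrightarrow> cadlag (\<lambda>t. Y t \<omega>)"
    "0 \<le> \<tau> 0 \<Longrightarrow> mono \<tau> \<Longrightarrow>
      prob_space.indep_vars M (\<lambda>_. borel) (\<lambda>i \<omega>. Y (\<tau> (Suc i)) \<omega> - Y (\<tau> i) \<omega>) {..<n}"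
    "s \<ge> 0 \<Longrightarrow> t \<ge> 0 \<Longrightarrow> distr M borel (\<lambda>\<omega>. Y (s + t) \<omega> - Y s \<omega>) = distr M borel (Y t)"
  using assms unfolding levy_process_def by blast+

lemma levy_prob_distr:
  assumes "levy_process M Y" "t \<ge> 0"
  shows "prob_space (distr M borel (Y t))"
  using levy_processD(1,2)[OF assms(1)] assms(2) by (intro prob_space.prob_space_distr) auto

lemma levy_cf_increment:
  assumes Y: "levy_process M Y" and st: "s \<ge> 0" "t \<ge> 0" and l: "bounded_linear l"
  shows "(CLINT \<omega>|M. cis (l (Y (s + t) \<omega> - Y s \<omega>))) = cf (distr M borel (Y t)) l"
proof -
  have "(\<lambda>\<omega>. Y (s + t) \<omega> - Y s \<omega>) \<in> borel_measurable M"
    using levy_processD(2)[OF Y] st by (intro borel_measurable_diff) auto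
  from cf_distr[OF this l] show ?thesis using levy_processD(6)[OF Y st] by simp
qed

text \<open>The functional may vary with the increment, since a Riemann sum of a random integral
  weights its increments differently.\<close>

lemma levy_integral_prod_increments:
  assumes Y: "levy_process M Y" and \<tau>: "0 \<le> \<tau> 0" "mono \<tau>" and l: "\<And>i. bounded_linear (l i)"
  shows "(CLINT \<omega>|M. (\<Prod>i<n. cis (l i (Y (\<tau> (Suc i)) \<omega> - Y (\<tau> i) \<omega>)))) =
    (\<Prod>i<n. cf (distr M borel (Y (\<tau> (Suc i) - \<tau> i))) (l i))"
proof -
  interpret prob_space M by (rule levy_processD[OF Y])
  have pos: "\<tau> i \<ge> 0" for i using \<tau> monoD[OF \<tau>(2), of 0 i] by simp
  have ind: "indep_vars (\<lambda>_. borel) (\<lambda>i \<omega>. cis (l i (Y (\<tau> (Suc i)) \<omega> - Y (\<tau> i) \<omega>))) {..<n}"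
    by (rule indep_vars_compose2[OF levy_processD(5)[OF Y \<tau>]]) (rule measurable_cis_functional[OF l])
  have "(CLINT \<omega>|M. (\<Prod>i<n. cis (l i (Y (\<tau> (Suc i)) \<omega> - Y (\<tau> i) \<omega>)))) =
    (\<Prod>i<n. CLINT \<omega>|M. cis (l i (Y (\<tau> (Suc i)) \<omega> - Y (\<tau> i) \<omega>)))"
  proof (rule indep_vars_lebesgue_integral[OF _ ind])
    fix i assume "i \<in> {..<n}"
    then have "(\<lambda>\<omega>. cis (l i (Y (\<tau> (Suc i)) \<omega> - Y (\<tau> i) \<omega>))) \<in> borel_measurable M"
      using ind unfolding indep_vars_def by auto
    then show "integrable M (\<lambda>\<omega>. cis (l i (Y (\<tau> (Suc i)) \<omega> - Y (\<tau> i) \<omega>)))"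
      by (intro integrable_const_bound[where B = 1]) auto
  qed simp
  also have "\<dots> = (\<Prod>i<n. cf (distr M borel (Y (\<tau> (Suc i) - \<tau> i))) (l i))"
  proof (rule prod.cong[OF refl])
    fix i
    have "\<tau> (Suc i) - \<tau> i \<ge> 0" using monoD[OF \<tau>(2), of i "Suc i"] by simp
    from levy_cf_increment[OF Y pos this l, of i i]
    show "(CLINT \<omega>|M. cis (l i (Y (\<tau> (Suc i)) \<omega> - Y (\<tau> i) \<omega>))) =
      cf (distr M borel (Y (\<tau> (Suc i) - \<tau> i))) (l i)" by simp
  qed
  finally show ?thesis .
qed

lemma levy_cf_add:
  assumes Y: "levy_process M Y" and st: "s \<ge> 0" "t \<ge> 0" and l: "bounded_linear l"
  shows "cf (distr M borel (Y (s + t))) l = cf (distr M borel (Y s)) l * cf (distr M borel (Y t)) l"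
proof -
  \<comment> \<open>The times 0, \<open>s\<close>, \<open>s + t\<close>; the sequence is constant
    afterwards to remain monotone.\<close>
  define \<tau> where "\<tau> = (\<lambda>i::nat. if i = 0 then 0 else if i = 1 then s else s + t)"
  have \<tau>: "0 \<le> \<tau> 0" "mono \<tau>" using st by (auto simp: \<tau>_def mono_def)
  have lin: "l (a - b) = l a - l b" for a b using bounded_linear.linear[OF l] linear_diff by blast
  have "(CLINT \<omega>|M. (\<Prod>i<2. cis (l (Y (\<tau> (Suc i)) \<omega> - Y (\<tau> i) \<omega>)))) =
      cf (distr M borel (Y s)) l * cf (distr M borel (Y t)) l"
    using levy_integral_prod_increments[OF Y \<tau> l, of 2] by (simp add: numeral_2_eq_2 \<tau>_def)
  moreover have "(CLINT \<omega>|M. (\<Prod>i<2. cis (l (Y (\<tau> (Suc i)) \<omega> - Y (\<tau> i) \<omega>)))) =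
      (CLINT \<omega>|M. cis (l (Y (s + t) \<omega>)))"
  proof (rule integral_cong_AE)
    have "Y s \<in> borel_measurable M" "Y (s + t) \<in> borel_measurable M" "Y 0 \<in> borel_measurable M"
      using levy_processD(2)[OF Y] st by auto
    note [measurable] = this measurable_cis_functional[OF l]
    show "(\<lambda>\<omega>. cis (l (Y (s + t) \<omega>))) \<in> borel_measurable M" by measurable
    show "(\<lambda>\<omega>. \<Prod>i<2. cis (l (Y (\<tau> (Suc i)) \<omega> - Y (\<tau> i) \<omega>))) \<in> borel_measurable M"
      by (simp add: numeral_2_eq_2 \<tau>_def)
    \<comment> \<open>The product telescopes to \<open>Y (s + t) - Y 0\<close>, and
      \<open>Y 0\<close> vanishes almost everywhere.\<close>
    show "AE \<omega> in M. (\<Prod>i<2. cis (l (Y (\<tau> (Suc i)) \<omega> - Y (\<tau> i) \<omega>))) = cis (l (Y (s + t) \<omega>))"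
      using levy_processD(3)[OF Y]
      by eventually_elim (simp add: numeral_2_eq_2 \<tau>_def cis_mult lin linear_0[OF bounded_linear.linear[OF l]])
  qed
  ultimately show ?thesis using cf_distr[OF levy_processD(2)[OF Y] l, of "s + t"] st by simp
qed

lemma levy_cf_0:
  assumes Y: "levy_process M Y" and l: "bounded_linear l"
  shows "cf (distr M borel (Y 0)) l = 1"
proof -
  interpret prob_space M by (rule levy_processD[OF Y])
  have [measurable]: "Y 0 \<in> borel_measurable M" using levy_processD(2)[OF Y] by simp
  note [measurable] = measurable_cis_functional[OF l]
  have "(CLINT \<omega>|M. cis (l (Y 0 \<omega>))) = (CLINT \<omega>|M. 1)"
  proof (rule integral_cong_AE)
    show "AE \<omega> in M. cis (l (Y 0 \<omega>)) = 1"
      using levy_processD(3)[OF Y] by eventually_elim (simp add: linear_0[OF bounded_linear.linear[OF l]])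
  qed auto
  then show ?thesis using cf_distr[OF _ l, of "Y 0" M] by (simp add: prob_space)
qed

lemma levy_cf_nat_mult:
  assumes Y: "levy_process M Y" and t: "t \<ge> 0" and l: "bounded_linear l"
  shows "cf (distr M borel (Y (real n * t))) l = cf (distr M borel (Y t)) l ^ n"
proof (induction n)
  case 0
  show ?case using levy_cf_0[OF Y l] by simp
next
  case (Suc n)
  show ?case using levy_cf_add[OF Y _ t l, of "real n * t"] t Suc by (simp add: algebra_simps)
qed

lemma levy_cf_right_continuous:
  assumes Y: "levy_process M Y" and l: "bounded_linear l"
    and u: "t \<ge> 0" "\<And>n. u n \<ge> t" "u \<longlonglongrightarrow> t"
  shows "(\<lambda>n. cf (distr M borel (Y (u n))) l) \<longlonglongrightarrow> cf (distr M borel (Y t)) l"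
proof -
  interpret prob_space M by (rule levy_processD[OF Y])
  have u0: "u n \<ge> 0" for n using u order_trans by blast
  have [measurable]: "Y t \<in> borel_measurable M" "Y (u n) \<in> borel_measurable M" for n
    using levy_processD(2)[OF Y] u0 u by auto
  note [measurable] = measurable_cis_functional[OF l]
  have "(\<lambda>n. CLINT \<omega>|M. cis (l (Y (u n) \<omega>))) \<longlonglongrightarrow> (CLINT \<omega>|M. cis (l (Y t \<omega>)))"
  proof (rule integral_dominated_convergence[where w = "\<lambda>_. 1"])
    show "AE \<omega> in M. (\<lambda>n. cis (l (Y (u n) \<omega>))) \<longlonglongrightarrow> cis (l (Y t \<omega>))"
    proof (rule AE_I2)
      fix \<omega> assume "\<omega> \<in> space M"
      from cadlag_right_sequence[OF levy_processD(4)[OF Y this] u]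
      have "(\<lambda>n. l (Y (u n) \<omega>)) \<longlonglongrightarrow> l (Y t \<omega>)" by (rule bounded_linear.tendsto[OF l])
      then show "(\<lambda>n. cis (l (Y (u n) \<omega>))) \<longlonglongrightarrow> cis (l (Y t \<omega>))"
        unfolding cis_conv_exp by (intro tendsto_intros)
    qed
  qed auto
  then show ?thesis using u0 u by (simp add: cf_distr[OF _ l])
qed

text \<open>The value at time \<open>t\<close> is a power of the value at time
  \<open>t / real (Suc n)\<close>, which tends to 1.\<close>

lemma levy_cf_nonzero:
  assumes Y: "levy_process M Y" and t: "t \<ge> 0" and l: "bounded_linear l"
  shows "cf (distr M borel (Y t)) l \<noteq> 0"
proof -
  have "(\<lambda>n. t / real (Suc n)) \<longlonglongrightarrow> 0" by real_asymp
  from levy_cf_right_continuous[OF Y l _ _ this] t levy_cf_0[OF Y l]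
  have "(\<lambda>n. cf (distr M borel (Y (t / real (Suc n)))) l) \<longlonglongrightarrow> 1" by simp
  then have "\<forall>\<^sub>F n in sequentially. cf (distr M borel (Y (t / real (Suc n)))) l \<noteq> 0"
    by (rule tendsto_imp_eventually_ne) simp
  then obtain n where n: "cf (distr M borel (Y (t / real (Suc n)))) l \<noteq> 0"
    by (auto simp: eventually_sequentially)
  have "cf (distr M borel (Y (real (Suc n) * (t / real (Suc n))))) l \<noteq> 0"
    unfolding levy_cf_nat_mult[OF Y divide_nonneg_nonneg[OF t of_nat_0_le_iff] l] using n by simp
  then show ?thesis by simp
qed

text \<open>The exponent is the continuous logarithm along the ray through \<open>l\<close> at time \<open>1\<close>. At time
  \<open>1/n\<close> the quotient by the expected value is a continuous \<open>n\<close>-th root of unity, hence constant.\<close>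

lemma levy_exponent:
  fixes Y :: "real \<Rightarrow> 'w \<Rightarrow> 'e::{banach, second_countable_topology}"
  assumes Y: "levy_process M Y" and l: "bounded_linear l"
  obtains g where "continuous_on {0..} g" "g 0 = 0"
    "\<And>u t. u \<ge> 0 \<Longrightarrow> t \<ge> 0 \<Longrightarrow> cf (distr M borel (Y t)) (\<lambda>x. u * l x) = exp (complex_of_real t * g u)"
proof -
  let ?c = "\<lambda>t u. cf (distr M borel (Y t)) (\<lambda>x. u * l x)"
  have ul: "bounded_linear (\<lambda>x. u * l x)" for u by (rule bounded_linear_const_mult[OF l])
  have cont: "continuous_on A (?c t)" if "t \<ge> 0" for t A
    using continuous_on_subset[OF cf_ray_continuous[OF levy_prob_distr[OF Y that] _ l]] by simp
  have c0: "?c t 0 = 1" if "t \<ge> 0" for t using cf_0[OF levy_prob_distr[OF Y that]] by simp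
  have nz: "?c 1 u \<noteq> 0" for u by (rule levy_cf_nonzero[OF Y _ ul]) simp
  \<comment> \<open>A nowhere vanishing continuous function on a contractible set has a continuous
    logarithm.\<close>
  have "contractible {0 :: real..}" by (intro convex_imp_contractible convex_real_interval)
  then obtain g0 where g0: "continuous_on {0..} g0" "\<And>u. u \<in> {0..} \<Longrightarrow> ?c 1 u = exp (g0 u)"
    using continuous_logarithm_on_contractible[OF cont[of 1 "{0..}"] _ nz] by (metis zero_le_one)
  define g where "g = (\<lambda>u. g0 u - g0 0)"
  have "exp (g0 0) = 1" using g0(2)[of 0] c0 by simp
  then have g1: "?c 1 u = exp (g u)" if "u \<ge> 0" for u
    using g0(2)[of u] that by (simp add: g_def exp_diff)
  have gc: "continuous_on {0..} g" unfolding g_def by (intro continuous_intros g0)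
  have root: "?c (1 / real n) u = exp (g u / of_nat n)" if n: "n > 0" and u: "u \<ge> 0" for n u
  proof -
    define h where "h = (\<lambda>u. ?c (1 / real n) u / exp (g u / of_nat n))"
    have hc: "continuous_on {0..} h" unfolding h_def
      by (intro continuous_intros cont gc) (use n in auto)
    have hn: "h u ^ n = 1" if "u \<ge> 0" for u
    proof -
      have "?c (1 / real n) u ^ n = ?c 1 u"
        using levy_cf_nat_mult[OF Y _ ul, of "1 / real n" n u] n by simp
      moreover have "exp (g u / of_nat n) ^ n = exp (g u)" using n by (simp flip: exp_of_nat_mult)
      ultimately show ?thesis using g1[OF that] by (simp add: h_def power_divide)
    qed
    have "h ` {0..} \<subseteq> {z. z ^ n = 1}" using hn by auto
    moreover have "finite {z :: complex. z ^ n = 1}" using n by (intro finite_roots_unity) simp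
    ultimately have fin: "finite (h ` {0..})" by (rule finite_subset)
    have "h constant_on {0..}"
      by (rule continuous_finite_range_constant[OF connected_Ici hc fin])
    then obtain c where c: "\<And>x. x \<in> {0..} \<Longrightarrow> h x = c" unfolding constant_on_def by blast
    then have "h u = h 0" using c[of u] c[of 0] u by simp
    also have "\<dots> = 1" using c0 by (simp add: h_def g_def)
    finally show ?thesis by (simp add: h_def)
  qed
  have main: "?c t u = exp (of_real t * g u)" if u: "u \<ge> 0" and t: "t \<ge> 0" for u t
  proof -
    \<comment> \<open>The smallest multiple of \<open>1 / real (Suc n)\<close> that is not below
      \<open>t\<close>. Approaching from the right allows right continuity in time to be
      used.\<close>
    define v where "v = (\<lambda>n. real (nat \<lceil>t * real (Suc n)\<rceil>) * (1 / real (Suc n)))"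
    have vlo: "v n \<ge> t" and vhi: "v n \<le> t + 1 / real (Suc n)" for n
    proof -
      define N where "N = real (Suc n)"
      have N: "N > 0" by (simp add: N_def)
      have "real (nat \<lceil>t * N\<rceil>) = of_int \<lceil>t * N\<rceil>" using t N by (simp add: of_nat_nat)
      moreover have "t * N \<le> of_int \<lceil>t * N\<rceil>" "of_int \<lceil>t * N\<rceil> \<le> t * N + 1" by linarith+
      ultimately have "t * N \<le> real (nat \<lceil>t * N\<rceil>)" "real (nat \<lceil>t * N\<rceil>) \<le> (t + 1 / N) * N"
        using N by (simp_all add: distrib_right)
      moreover have "v n = real (nat \<lceil>t * N\<rceil>) / N" by (simp add: v_def N_def)
      ultimately show "v n \<ge> t" "v n \<le> t + 1 / real (Suc n)"
        using N unfolding N_def[symmetric] by (simp_all only: pos_le_divide_eq pos_divide_le_eq)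
    qed
    have vlim: "v \<longlonglongrightarrow> t"
    proof (rule tendsto_sandwich[OF _ _ tendsto_const])
      show "\<forall>\<^sub>F n in sequentially. t \<le> v n" using vlo by simp
      show "\<forall>\<^sub>F n in sequentially. v n \<le> t + 1 / real (Suc n)" using vhi by simp
      show "(\<lambda>n. t + 1 / real (Suc n)) \<longlonglongrightarrow> t" by real_asymp
    qed
    have "?c (v n) u = exp (of_real (v n) * g u)" for n
    proof -
      have "?c (v n) u = ?c (1 / real (Suc n)) u ^ nat \<lceil>t * real (Suc n)\<rceil>"
        unfolding v_def by (rule levy_cf_nat_mult[OF Y _ ul]) simp
      also have "\<dots> = exp (g u / of_nat (Suc n)) ^ nat \<lceil>t * real (Suc n)\<rceil>" using root[of "Suc n"] u by simp
      also have "\<dots> = exp (of_nat (nat \<lceil>t * real (Suc n)\<rceil>) * (g u / of_nat (Suc n)))" by (rule exp_of_nat_mult[symmetric])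
      also have "of_nat (nat \<lceil>t * real (Suc n)\<rceil>) * (g u / of_nat (Suc n)) = of_real (v n) * g u"
        unfolding v_def by (simp del: of_nat_Suc)
      finally show ?thesis .
    qed
    moreover have "(\<lambda>n. ?c (v n) u) \<longlonglongrightarrow> ?c t u"
      by (rule levy_cf_right_continuous[OF Y ul t vlo vlim])
    moreover have "(\<lambda>n. exp (of_real (v n) * g u)) \<longlonglongrightarrow> exp (of_real t * g u)"
      by (intro tendsto_intros vlim)
    ultimately show ?thesis using LIMSEQ_unique by auto
  qed
  show ?thesis using that[of g] gc main by (simp add: g_def)
qed

text \<open>The inequality of \<open>cf_doubling\<close> at time \<open>1 / real (Suc n)\<close>,
  multiplied by \<open>real (Suc n)\<close>, becomes one for exponents in the limit, because
  \<open>exp (h * z)\<close> has derivative \<open>z\<close> at \<open>h = 0\<close>.\<close>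

lemma levy_exponent_doubling:
  fixes Y :: "real \<Rightarrow> 'w \<Rightarrow> 'e::{banach, second_countable_topology}"
  assumes Y: "levy_process M Y" and l: "bounded_linear l"
    and g: "\<And>u t. u \<ge> 0 \<Longrightarrow> t \<ge> 0 \<Longrightarrow> cf (distr M borel (Y t)) (\<lambda>x. u * l x) = exp (complex_of_real t * g u)"
    and u: "u \<ge> 0"
  shows "norm (g (2 * u)) \<le> 4 * norm (g u)"
proof -
  have lim: "(\<lambda>n. norm (1 - exp (of_real (1 / real (Suc n)) * z)) * real (Suc n)) \<longlonglongrightarrow> norm z" for z :: complex
  proof -
    have "((\<lambda>h. exp (h * z)) has_field_derivative z) (at 0)"
      by (auto intro!: derivative_eq_intros)
    then have *: "((\<lambda>h. (exp (h * z) - 1) / h) \<longlongrightarrow> z) (at 0)"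
      by (simp add: DERIV_def)
    have F: "filterlim (\<lambda>n. complex_of_real (1 / real (Suc n))) (at 0) sequentially"
      unfolding filterlim_at
    proof
      have "(\<lambda>n. 1 / real (Suc n)) \<longlonglongrightarrow> 0" by real_asymp
      then have "(\<lambda>n. complex_of_real (1 / real (Suc n))) \<longlonglongrightarrow> of_real 0" by (intro tendsto_intros)
      then show "(\<lambda>n. complex_of_real (1 / real (Suc n))) \<longlonglongrightarrow> 0" by simp
    qed (simp del: of_nat_Suc)
    have "norm ((exp (complex_of_real (1 / real (Suc n)) * z) - 1) / complex_of_real (1 / real (Suc n))) =
        norm (1 - exp (complex_of_real (1 / real (Suc n)) * z)) * real (Suc n)" for n
      unfolding norm_divide norm_of_real by (simp add: norm_minus_commute[of _ 1] del: of_nat_Suc)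
    then show ?thesis
      using tendsto_norm[OF filterlim_compose[OF * F]] by (simp only:)
  qed
  show ?thesis
  proof (rule LIMSEQ_le[OF lim tendsto_mult_left[OF lim]], intro exI allI impI)
    fix n
    let ?P = "distr M borel (Y (1 / real (Suc n)))"
    have "norm (1 - cf ?P (\<lambda>x. 2 * (u * l x))) \<le> 4 * norm (1 - cf ?P (\<lambda>x. u * l x))"
      by (rule cf_doubling[OF levy_prob_distr[OF Y] _ bounded_linear_const_mult[OF l]]) auto
    then have "norm (1 - exp (of_real (1 / real (Suc n)) * g (2 * u))) \<le> 4 * norm (1 - exp (of_real (1 / real (Suc n)) * g u))"
      using g[of "2 * u" "1 / real (Suc n)"] g[of u "1 / real (Suc n)"] u by (simp add: mult.assoc)
    from mult_right_mono[OF this, of "real (Suc n)"]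
    show "norm (1 - exp (of_real (1 / real (Suc n)) * g (2 * u))) * real (Suc n) \<le>
      4 * (norm (1 - exp (of_real (1 / real (Suc n)) * g u)) * real (Suc n))" by simp
  qed
qed

text \<open>Each halving of \<open>u\<close> costs a factor 4, which is also the factor by which
  \<open>u^2\<close> shrinks. Halving is repeated until the compact interval \<open>[0,1]\<close> is
  reached.\<close>

lemma quadratic_growth_if_doubling:
  fixes g :: "real \<Rightarrow> complex"
  assumes cont: "continuous_on {0..} g" and dbl: "\<And>u. u \<ge> 0 \<Longrightarrow> norm (g (2 * u)) \<le> 4 * norm (g u)"
  obtains C where "\<And>u. u \<ge> 0 \<Longrightarrow> norm (g u) \<le> C * (1 + u\<^sup>2)"
proof -
  have "bounded (g ` {0..1})"
    by (intro compact_imp_bounded compact_continuous_image continuous_on_subset[OF cont]) auto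
  then obtain M where M: "\<And>u. u \<in> {0..1} \<Longrightarrow> norm (g u) \<le> M" unfolding bounded_iff by blast
  have M0: "M \<ge> 0" using order_trans[OF norm_ge_zero M[of 0]] by simp
  \<comment> \<open>The factor 4 makes \<open>max 1 (4 * (u / 2)^2)\<close> equal to
    \<open>u^2\<close> for \<open>u > 1\<close>, so the induction over \<open>k\<close>
    closes.\<close>
  have *: "0 \<le> u \<Longrightarrow> u \<le> 2 ^ k \<Longrightarrow> norm (g u) \<le> M * max 1 (4 * u\<^sup>2)" for k u
  proof (induction k arbitrary: u)
    case 0
    then have "norm (g u) \<le> M * 1" using M[of u] by simp
    also have "\<dots> \<le> M * max 1 (4 * u\<^sup>2)" using M0 by (intro mult_left_mono) auto
    finally show ?case .
  next
    case (Suc k)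
    show ?case
    proof (cases "u \<le> 1")
      case True
      then have "norm (g u) \<le> M * 1" using M[of u] Suc by simp
      also have "\<dots> \<le> M * max 1 (4 * u\<^sup>2)" using M0 by (intro mult_left_mono) auto
      finally show ?thesis .
    next
      case False
      have u2: "u\<^sup>2 \<ge> 1" using False one_le_power[of u 2] by simp
      have "norm (g u) \<le> 4 * norm (g (u / 2))" using dbl[of "u/2"] Suc by simp
      also have "\<dots> \<le> 4 * (M * max 1 (4 * (u/2)\<^sup>2))" using Suc.IH[of "u/2"] Suc.prems by simp
      also have "max 1 (4 * (u/2)\<^sup>2) = u\<^sup>2" using u2 by (simp add: power2_eq_square)
      also have "4 * (M * u\<^sup>2) = M * max 1 (4 * u\<^sup>2)" using u2 by simp
      finally show ?thesis .
    qed
  qed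
  have "norm (g u) \<le> (4 * M) * (1 + u\<^sup>2)" if "u \<ge> 0" for u
  proof -
    obtain k where "u < 2 ^ k" using real_arch_pow[of 2 u] by auto
    then have "norm (g u) \<le> M * max 1 (4 * u\<^sup>2)" using *[of u k] that by simp
    also have "\<dots> \<le> M * (4 * (1 + u\<^sup>2))" using M0 by (intro mult_left_mono) auto
    finally show ?thesis by (simp add: mult_ac)
  qed
  then show ?thesis using that by blast
qed

section \<open>Random integrals\<close>

text \<open>One-sided limits bound the path near every point, and finitely many such neighbourhoods
  cover the interval.\<close>

lemma cadlag_bounded:
  fixes x :: "real \<Rightarrow> 'a::real_normed_vector"
  assumes x: "cadlag x" and c: "c \<ge> 0"
  shows "\<exists>B. \<forall>t\<in>{c..d}. norm (x t) \<le> B"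
proof -
  have "\<exists>U B. open U \<and> t \<in> U \<and> (\<forall>s\<in>U. s \<ge> 0 \<longrightarrow> norm (x s) \<le> B)" if t: "t \<ge> 0" for t
  proof -
    have bd: "\<forall>\<^sub>F s in H. norm (x s) \<le> norm y + 1" if "(x \<longlongrightarrow> y) H" for y H
      using order_tendstoD(2)[OF tendsto_norm[OF that], of "norm y + 1"] by (rule eventually_mono) auto
    have right: "\<forall>\<^sub>F s in at_right t. norm (x s) \<le> norm (x t) + 1"
      using x t by (intro bd) (auto simp: cadlag_def)
    obtain C where left: "\<forall>\<^sub>F s in at_left t. s \<ge> 0 \<longrightarrow> norm (x s) \<le> C"
    proof (cases "t = 0")
      case True
      \<comment> \<open>No left limit is given at 0; the claim is vacuous there, because points to
        the left are negative.\<close>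
      have "\<forall>\<^sub>F s in at_left t. s \<ge> 0 \<longrightarrow> norm (x s) \<le> 0"
        unfolding True by (rule eventually_at_leftI[of "-1"]) auto
      then show ?thesis using that by blast
    next
      case False
      then obtain y where "(x \<longlongrightarrow> y) (at_left t)" using x t unfolding cadlag_def by force
      from bd[OF this] have "\<forall>\<^sub>F s in at_left t. s \<ge> 0 \<longrightarrow> norm (x s) \<le> norm y + 1"
        by (rule eventually_mono) auto
      then show ?thesis using that by blast
    qed
    define B where "B = max (norm (x t) + 1) C"
    have "\<forall>\<^sub>F s in at t. s \<ge> 0 \<longrightarrow> norm (x s) \<le> B"
      unfolding eventually_at_split
    proof
      show "\<forall>\<^sub>F s in at_left t. s \<ge> 0 \<longrightarrow> norm (x s) \<le> B"
        using left by (rule eventually_mono) (auto simp: B_def)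
      show "\<forall>\<^sub>F s in at_right t. s \<ge> 0 \<longrightarrow> norm (x s) \<le> B"
        using right by (rule eventually_mono) (auto simp: B_def)
    qed
    then have "\<forall>\<^sub>F s in nhds t. s \<ge> 0 \<longrightarrow> norm (x s) \<le> B"
      unfolding eventually_at_filter by (rule eventually_mono) (auto simp: B_def)
    then show ?thesis unfolding eventually_nhds by blast
  qed
  then obtain U B where U: "\<And>t. t \<ge> 0 \<Longrightarrow> open (U t) \<and> t \<in> U t \<and> (\<forall>s\<in>U t. s \<ge> 0 \<longrightarrow> norm (x s) \<le> B t)"
    by metis
  obtain T where T: "T \<subseteq> {c..d}" "finite T" "{c..d} \<subseteq> (\<Union>t\<in>T. U t)"
    by (rule compactE_image[of "{c..d}" "{c..d}" U]) (use U c in auto)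
  show ?thesis
  proof (intro exI ballI)
    fix s assume s: "s \<in> {c..d}"
    then obtain t where t: "t \<in> T" "s \<in> U t" using T by auto
    then have "norm (x s) \<le> B t" using U[of t] T s c by auto
    also have "B t \<le> \<bar>B t\<bar>" by simp
    also have "\<dots> \<le> (\<Sum>t\<in>T. \<bar>B t\<bar>)" using t T by (intro member_le_sum) auto
    finally show "norm (x s) \<le> (\<Sum>t\<in>T. \<bar>B t\<bar>)" .
  qed
qed

section \<open>Sums over uniform partitions\<close>

definition node :: "real \<Rightarrow> real \<Rightarrow> nat \<Rightarrow> nat \<Rightarrow> real" where
  "node a b n k = a + real k * (b - a) / real n"

lemma node_0 [simp]: "node a b n 0 = a"
  by (simp add: node_def)

lemma node_n [simp]: "n > 0 \<Longrightarrow> node a b n n = b"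
  by (simp add: node_def)

lemma node_mono: "a \<le> b \<Longrightarrow> j \<le> k \<Longrightarrow> node a b n j \<le> node a b n k"
  unfolding node_def by (intro add_left_mono divide_right_mono mult_right_mono) auto

lemma node_Suc: "node a b n (Suc k) = node a b n k + (b - a) / real n"
  by (simp add: node_def distrib_right add_divide_distrib)

lemma node_in: "a \<le> b \<Longrightarrow> k \<le> n \<Longrightarrow> 0 < n \<Longrightarrow> node a b n k \<in> {a..b}"
  using node_mono[of a b 0 k n] node_mono[of a b k n n] by simp

lemma node_cell:
  assumes "a < b" "n > 0" "t \<in> {a<..b}"
  shows "\<exists>k<n. node a b n k < t \<and> t \<le> node a b n (Suc k)"
proof -
  define k where "k = (LEAST k. t \<le> node a b n k)"
  have ex: "t \<le> node a b n n" using assms by simp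
  have k: "t \<le> node a b n k" unfolding k_def using ex by (rule LeastI)
  have kn: "k \<le> n" unfolding k_def using ex by (rule Least_le)
  have "k \<noteq> 0" using k assms by (cases k) auto
  then obtain j where j: "k = Suc j" using not0_implies_Suc by blast
  have "\<not> t \<le> node a b n j" using not_less_Least[of j "\<lambda>k. t \<le> node a b n k"] j unfolding k_def by simp
  then show ?thesis using j k kn by (intro exI[of _ j]) auto
qed

lemma node_cell_tendsto:
  assumes "\<And>n. n > 0 \<Longrightarrow> node a b n (K n) < t \<and> t \<le> node a b n (Suc (K n))"
  shows "(\<lambda>n. node a b n (K n)) \<longlonglongrightarrow> t" "(\<lambda>n. node a b n (Suc (K n))) \<longlonglongrightarrow> t"
proof -
  have lim: "(\<lambda>n. (b - a) / real n) \<longlonglongrightarrow> 0" by real_asymp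
  show "(\<lambda>n. node a b n (K n)) \<longlonglongrightarrow> t"
  proof (rule tendsto_sandwich)
    show "(\<lambda>n. t - (b - a) / real n) \<longlonglongrightarrow> t" using tendsto_diff[OF tendsto_const lim] by simp
    show "\<forall>\<^sub>F n in sequentially. t - (b - a) / real n \<le> node a b n (K n)"
      using eventually_gt_at_top[of 0] by eventually_elim (use assms node_Suc in \<open>simp add: algebra_simps\<close>)
    show "\<forall>\<^sub>F n in sequentially. node a b n (K n) \<le> t"
      using eventually_gt_at_top[of 0] by eventually_elim (use assms in \<open>simp add: less_imp_le\<close>)
  qed simp
  from tendsto_add[OF this lim] show "(\<lambda>n. node a b n (Suc (K n))) \<longlonglongrightarrow> t" by (simp add: node_Suc)
qed

text \<open>Dominated convergence for step functions. The sampled values \<open>v n k\<close> are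
  left abstract because paths are sampled at left nodes and exponents at right nodes;
  \<open>K n\<close> is the index of the cell that contains \<open>t\<close>.\<close>

lemma step_sum_tendsto_integral:
  fixes v :: "nat \<Rightarrow> nat \<Rightarrow> 'b::{banach, second_countable_topology}" and \<rho> :: "real \<Rightarrow> real"
  assumes ab: "a < b" and \<rho>: "set_integrable lborel {a<..b} \<rho>"
    and B: "\<And>n k. k < n \<Longrightarrow> norm (v n k) \<le> B"
    and conv: "\<And>t K. t \<in> {a<..b} \<Longrightarrow>
      (\<And>n. n > 0 \<Longrightarrow> K n < n \<and> node a b n (K n) < t \<and> t \<le> node a b n (Suc (K n))) \<Longrightarrow>
      (\<lambda>n. v n (K n)) \<longlonglongrightarrow> V t"
  shows "(\<lambda>n. \<Sum>k<n. (LBINT t:{node a b n k<..node a b n (Suc k)}. \<rho> t) *\<^sub>R v n k)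
    \<longlonglongrightarrow> (LBINT t:{a<..b}. \<rho> t *\<^sub>R V t)"
proof -
  define I where "I = (\<lambda>n k. {node a b n k<..node a b n (Suc k)})"
  have sub: "I n k \<subseteq> {a<..b}" if "k < n" for n k
    using node_in[of a b k n] node_in[of a b "Suc k" n] that ab unfolding I_def by auto
  define \<phi> where "\<phi> = (\<lambda>n t. \<Sum>k<n. (indicator (I n k) t * \<rho> t) *\<^sub>R v n k)"
  have int: "integrable lborel (\<lambda>t. indicator (I n k) t * \<rho> t)" if "k < n" for n k
    using set_integrable_subset[OF \<rho> _ sub[OF that]] by (simp add: I_def set_integrable_def)
  have meas: "\<phi> n \<in> borel_measurable lborel" for n
    unfolding \<phi>_def by (intro borel_measurable_sum borel_measurable_scaleR borel_measurable_integrable[OF int]) auto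
  have integral: "integral\<^sup>L lborel (\<phi> n) = (\<Sum>k<n. (LBINT t:I n k. \<rho> t) *\<^sub>R v n k)" for n
  proof -
    have "integral\<^sup>L lborel (\<phi> n) = (\<Sum>k<n. LBINT t. (indicator (I n k) t * \<rho> t) *\<^sub>R v n k)"
      unfolding \<phi>_def by (rule Bochner_Integration.integral_sum) (auto intro: int)
    also have "\<dots> = (\<Sum>k<n. (LBINT t. indicator (I n k) t * \<rho> t) *\<^sub>R v n k)"
      by (intro sum.cong refl integral_scaleR_left) (auto intro: int)
    finally show ?thesis by (simp add: set_lebesgue_integral_def)
  qed
  have pt: "\<phi> n t = \<rho> t *\<^sub>R v n k" if k: "k < n" "t \<in> I n k" for n k t
  proof -
    have ind: "indicator (I n j) t = (if j = k then 1 else 0 :: real)" for j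
    proof -
      have "t \<notin> I n j" if jk: "j \<noteq> k"
      proof -
        consider "Suc j \<le> k" | "Suc k \<le> j" using jk by linarith
        then show ?thesis
        proof cases
          case 1
          from node_mono[OF less_imp_le[OF ab] this, of n] show ?thesis using k by (auto simp: I_def)
        next
          case 2
          from node_mono[OF less_imp_le[OF ab] this, of n] show ?thesis using k by (auto simp: I_def)
        qed
      qed
      then show ?thesis using k by auto
    qed
    have "\<phi> n t = (\<Sum>j<n. if j = k then \<rho> t *\<^sub>R v n k else 0)"
      unfolding \<phi>_def by (intro sum.cong refl) (simp add: ind)
    then show ?thesis using k by simp
  qed
  have zero: "\<phi> n t = 0" if "t \<notin> {a<..b}" for n t
  proof -
    have "indicator (I n k) t = (0 :: real)" if "k < n" for k
    proof -
      have "t \<notin> I n k" using subsetD[OF sub[OF that]] \<open>t \<notin> {a<..b}\<close> by blast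
      then show ?thesis by simp
    qed
    then show ?thesis unfolding \<phi>_def by simp
  qed
  have lim: "(\<lambda>n. \<phi> n t) \<longlonglongrightarrow> indicator {a<..b} t *\<^sub>R (\<rho> t *\<^sub>R V t)" for t
  proof (cases "t \<in> {a<..b}")
    case False
    then show ?thesis using zero by simp
  next
    case True
    have "\<forall>n. \<exists>k. n > 0 \<longrightarrow> k < n \<and> node a b n k < t \<and> t \<le> node a b n (Suc k)"
      using node_cell[OF ab _ True] by blast
    then obtain K where K: "\<And>n. n > 0 \<Longrightarrow> K n < n \<and> node a b n (K n) < t \<and> t \<le> node a b n (Suc (K n))"
      by metis
    have 1: "(\<lambda>n. \<rho> t *\<^sub>R v n (K n)) \<longlonglongrightarrow> \<rho> t *\<^sub>R V t"
      by (intro tendsto_scaleR tendsto_const conv[OF True K])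
    have 2: "\<forall>\<^sub>F n in sequentially. \<rho> t *\<^sub>R v n (K n) = \<phi> n t"
      using eventually_gt_at_top[of 0]
    proof eventually_elim
      case (elim n)
      then show ?case using pt[of "K n" n t] K[of n] by (simp add: I_def)
    qed
    from Lim_transform_eventually[OF 1 2] show ?thesis using True by simp
  qed
  have "(\<lambda>n. integral\<^sup>L lborel (\<phi> n)) \<longlonglongrightarrow> (LBINT t. indicator {a<..b} t *\<^sub>R (\<rho> t *\<^sub>R V t))"
  proof (rule integral_dominated_convergence[where w = "\<lambda>t. norm (indicator {a<..b} t *\<^sub>R \<rho> t) * B"])
    show "(\<lambda>t. indicator {a<..b} t *\<^sub>R (\<rho> t *\<^sub>R V t)) \<in> borel_measurable lborel"
      by (rule borel_measurable_LIMSEQ_metric[OF meas lim])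
    show "integrable lborel (\<lambda>t. norm (indicator {a<..b} t *\<^sub>R \<rho> t) * B)"
      using \<rho> unfolding set_integrable_def by (intro integrable_mult_left integrable_norm)
    show "AE t in lborel. norm (\<phi> n t) \<le> norm (indicator {a<..b} t *\<^sub>R \<rho> t) * B" for n
    proof (rule AE_I2)
      fix t
      show "norm (\<phi> n t) \<le> norm (indicator {a<..b} t *\<^sub>R \<rho> t) * B"
      proof (cases "t \<in> {a<..b} \<and> n > 0")
        case True
        then obtain k where k: "k < n" "t \<in> I n k" using node_cell[OF ab, of n t] by (auto simp: I_def)
        show ?thesis using pt[OF k] True B[OF k(1)] by (auto intro: mult_left_mono)
      next
        case False
        then have "\<phi> n t = 0" using zero by (auto simp: \<phi>_def)
        moreover have "norm (indicator {a<..b} t *\<^sub>R \<rho> t) * B \<ge> 0"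
          using order_trans[OF norm_ge_zero B[of 0 1]] by simp
        ultimately show ?thesis by simp
      qed
    qed
  qed (use meas lim in auto)
  then show ?thesis unfolding integral unfolding I_def set_lebesgue_integral_def .
qed

text \<open>As \<open>s\<close> increases to \<open>t\<close>, the time \<open>r s\<close>
  approaches \<open>r t\<close> from above, where the path is right-continuous. The left limit in
  the integration by parts formula is thus simply \<open>x (r t)\<close>.\<close>

lemma time_changed_left_limit:
  assumes x: "cadlag x" and r: "continuous_on {a..b} r" "antimono_on {a..b} r" "r b \<ge> 0" and t: "t \<in> {a<..b}"
  shows "((\<lambda>s. x (r s)) \<longlongrightarrow> x (r t)) (at_left t)"
proof -
  have "r t \<ge> r b" using r(2) t unfolding monotone_on_def by auto
  then have "(x \<longlongrightarrow> x (r t)) (at (r t) within {r t..})"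
    using x r(3) by (simp add: cadlag_def at_within_Ici_at_right)
  then have "continuous (at (r t) within {r t..}) x" by (simp add: continuous_within)
  then show ?thesis
  proof (rule continuous_within_tendsto_compose)
    show "\<forall>\<^sub>F s in at_left t. r s \<in> {r t..}"
    proof (rule eventually_at_leftI[of a])
      show "r s \<in> {r t..}" if "s \<in> {a<..<t}" for s
      proof -
        have "s \<in> {a..b}" "t \<in> {a..b}" "s \<le> t" using t that by auto
        from monotone_onD[OF r(2) this] show ?thesis by simp
      qed
    qed (use t in simp)
    have "(r \<longlongrightarrow> r t) (at t within {a..b})" using r(1) t by (auto simp: continuous_on)
    then have "(r \<longlongrightarrow> r t) (at t within {a..t})" by (rule tendsto_within_subset) (use t in auto)
    then show "(r \<longlongrightarrow> r t) (at_left t)" using t by (simp add: at_within_Icc_at_left)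
  qed
qed

lemma summation_by_parts:
  fixes y :: "nat \<Rightarrow> 'a::real_vector"
  shows "(\<Sum>k<n. c (Suc k) *\<^sub>R (y k - y (Suc k))) = c 0 *\<^sub>R y 0 - c n *\<^sub>R y n + (\<Sum>k<n. (c (Suc k) - c k) *\<^sub>R y k)"
  by (induction n) (simp_all add: algebra_simps)

text \<open>A Riemann-Stieltjes sum whose increments run forward in the time of \<open>Y\<close>,
  hence backward in \<open>t\<close>; this is the orientation fixed in
  \<open>random_integral\<close>. The weights at right nodes leave the path sampled at left nodes
  after summation by parts.\<close>

definition clock_sum ::
  "(real \<Rightarrow> real) \<Rightarrow> real \<Rightarrow> real \<Rightarrow> (real \<Rightarrow> 'w \<Rightarrow> 'e::real_vector) \<Rightarrow> nat \<Rightarrow> 'w \<Rightarrow> 'e" where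
  "clock_sum r a b Y n \<omega> =
     (\<Sum>k<n. node a b n (Suc k) *\<^sub>R (Y (r (node a b n k)) \<omega> - Y (r (node a b n (Suc k))) \<omega>))"

lemma clock_sum_tendsto:
  fixes Y :: "real \<Rightarrow> 'w \<Rightarrow> 'e::{banach, second_countable_topology}"
  assumes x: "cadlag (\<lambda>t. Y t \<omega>)" and ab: "a < b"
    and r: "continuous_on {a..b} r" "antimono_on {a..b} r" "r b \<ge> 0"
  shows "(\<lambda>n. clock_sum r a b Y n \<omega>) \<longlonglongrightarrow> random_integral (\<lambda>t. t) r a b Y \<omega>"
proof -
  let ?x = "\<lambda>t. Y t \<omega>"
  have rr: "r t \<in> {r b..r a}" if "t \<in> {a..b}" for t using r(2) that ab unfolding monotone_on_def by auto
  obtain B where B: "\<And>t. t \<in> {r b..r a} \<Longrightarrow> norm (?x t) \<le> B" using cadlag_bounded[OF x r(3)] by blast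
  have B0: "B \<ge> 0" using order_trans[OF norm_ge_zero B[of "r a"]] rr[of b] rr[of a] ab by auto
  have one: "set_integrable lborel {a<..b} (\<lambda>_. 1 :: real)"
    using ab by (simp add: set_integrable_def integrable_real_indicator)
  have "(\<lambda>n. \<Sum>k<n. (LBINT t:{node a b n k<..node a b n (Suc k)}. 1) *\<^sub>R ?x (r (node a b n k)))
      \<longlonglongrightarrow> (LBINT t:{a<..b}. 1 *\<^sub>R ?x (r t))"
  proof (rule step_sum_tendsto_integral[OF ab one])
    show "norm (?x (r (node a b n k))) \<le> B" if "k < n" for n k
      using node_in[of a b k n] ab that by (intro B rr) auto
  next
    fix t K assume t: "t \<in> {a<..b}"
      and K: "\<And>n. n > 0 \<Longrightarrow> K n < n \<and> node a b n (K n) < t \<and> t \<le> node a b n (Suc (K n))"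
    have "filterlim (\<lambda>n. node a b n (K n)) (at_left t) sequentially"
      unfolding filterlim_at
    proof
      show "\<forall>\<^sub>F n in sequentially. node a b n (K n) \<in> {..<t} \<and> node a b n (K n) \<noteq> t"
        using eventually_gt_at_top[of 0]
      proof eventually_elim
        case (elim n)
        then show ?case using K[of n] by simp
      qed
      show "(\<lambda>n. node a b n (K n)) \<longlonglongrightarrow> t" by (rule node_cell_tendsto) (use K in auto)
    qed
    from filterlim_compose[OF time_changed_left_limit[OF x r t] this]
    show "(\<lambda>n. ?x (r (node a b n (K n)))) \<longlonglongrightarrow> ?x (r t)" .
  qed
  moreover have "(LBINT t:{node a b n k<..node a b n (Suc k)}. 1) = node a b n (Suc k) - node a b n k" for n k
    using node_mono[OF less_imp_le[OF ab], of k "Suc k" n] by (simp add: set_lebesgue_integral_def)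
  ultimately have lim: "(\<lambda>n. \<Sum>k<n. (node a b n (Suc k) - node a b n k) *\<^sub>R ?x (r (node a b n k)))
      \<longlonglongrightarrow> (LBINT t:{a<..b}. ?x (r t))" by simp
  have "(LINT t:{a<..b}|interval_measure (\<lambda>t. t). Lim (at_left t) (\<lambda>t. ?x (r t))) = (LBINT t:{a<..b}. ?x (r t))"
    unfolding lborel_eq_real[symmetric]
  proof (rule set_lebesgue_integral_cong)
    show "\<forall>t. t \<in> {a<..b} \<longrightarrow> Lim (at_left t) (\<lambda>t. ?x (r t)) = ?x (r t)"
      using time_changed_left_limit[OF x r] by (auto intro!: tendsto_Lim)
  qed simp
  \<comment> \<open>The clock is nonincreasing, so \<open>random_integral\<close> contributes the
    factor \<open>-1\<close> to the boundary terms and the integral.\<close>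
  then have ri: "random_integral (\<lambda>t. t) r a b Y \<omega> = a *\<^sub>R ?x (r a) - b *\<^sub>R ?x (r b) + (LBINT t:{a<..b}. ?x (r t))"
    using r(2) by (simp add: random_integral_def integral_by_parts_def)
  have "\<forall>\<^sub>F n in sequentially. a *\<^sub>R ?x (r a) - b *\<^sub>R ?x (r b) +
      (\<Sum>k<n. (node a b n (Suc k) - node a b n k) *\<^sub>R ?x (r (node a b n k))) = clock_sum r a b Y n \<omega>"
    using eventually_gt_at_top[of 0] 
    by eventually_elim (simp add: clock_sum_def summation_by_parts[of "node a b _" "\<lambda>k. ?x (r (node a b _ k))"])
  then show ?thesis unfolding ri by (rule Lim_transform_eventually[rotated]) (intro tendsto_intros lim)
qed

lemma cf_clock_sum:
  fixes Y :: "real \<Rightarrow> 'w \<Rightarrow> 'e::{banach, second_countable_topology}"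
  assumes Y: "levy_process M Y" and l: "bounded_linear l" and a: "0 \<le> a" "a < b"
    and g: "\<And>u t. u \<ge> 0 \<Longrightarrow> t \<ge> 0 \<Longrightarrow> cf (distr M borel (Y t)) (\<lambda>x. u * l x) = exp (complex_of_real t * g u)"
    and r: "antimono_on {a..b} r" "r b \<ge> 0" and n: "n > 0"
  shows "(CLINT \<omega>|M. cis (l (clock_sum r a b Y n \<omega>))) =
    exp (\<Sum>k<n. (r (node a b n k) - r (node a b n (Suc k))) *\<^sub>R g (node a b n (Suc k)))"
proof -
  let ?t = "node a b n"
  \<comment> \<open>The nodes are enumerated backwards, since \<open>r\<close> decreases and the
    increments of a Levy process need increasing times. For \<open>i > n\<close> truncated
    subtraction keeps the sequence constant.\<close>
  define \<tau> where "\<tau> = (\<lambda>i. r (?t (n - i)))"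
  have tin: "?t k \<in> {a..b}" if "k \<le> n" for k using node_in[OF _ that] a n by simp
  have rle: "r (?t k) \<le> r (?t j)" if "j \<le> k" "k \<le> n" for j k
    using r(1) tin[of j] tin[of k] that node_mono[of a b j k n] a unfolding monotone_on_def by auto
  have \<tau>: "0 \<le> \<tau> 0" "mono \<tau>"
    using r(2) n by (auto simp: \<tau>_def mono_def intro!: rle)
  have ul: "bounded_linear (\<lambda>x. u * l x)" for u by (rule bounded_linear_const_mult[OF l])
  have lin: "linear l" using l by (rule bounded_linear.linear)
  have "cis (l (clock_sum r a b Y n \<omega>)) =
      (\<Prod>i<n. cis (?t (n - i) * l (Y (\<tau> (Suc i)) \<omega> - Y (\<tau> i) \<omega>)))" for \<omega>
  proof -
    have "l (clock_sum r a b Y n \<omega>) = (\<Sum>k<n. ?t (Suc k) * l (Y (r (?t k)) \<omega> - Y (r (?t (Suc k))) \<omega>))"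
      unfolding clock_sum_def by (simp add: linear_sum[OF lin] linear_scale[OF lin])
    also have "\<dots> = (\<Sum>i<n. ?t (Suc (n - Suc i)) * l (Y (r (?t (n - Suc i))) \<omega> - Y (r (?t (Suc (n - Suc i)))) \<omega>))"
      by (rule sum.nat_diff_reindex[symmetric])
    also have "\<dots> = (\<Sum>i<n. ?t (n - i) * l (Y (\<tau> (Suc i)) \<omega> - Y (\<tau> i) \<omega>))"
      by (intro sum.cong refl) (simp add: \<tau>_def Suc_diff_Suc)
    finally show ?thesis by (simp add: cis_conv_exp exp_sum sum_distrib_left)
  qed
  then have "(CLINT \<omega>|M. cis (l (clock_sum r a b Y n \<omega>))) =
      (\<Prod>i<n. cf (distr M borel (Y (\<tau> (Suc i) - \<tau> i))) (\<lambda>x. ?t (n - i) * l x))"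
    using levy_integral_prod_increments[OF Y \<tau> ul] by simp
  also have "\<dots> = (\<Prod>i<n. exp ((r (?t (n - Suc i)) - r (?t (Suc (n - Suc i)))) *\<^sub>R g (?t (Suc (n - Suc i)))))"
  proof (rule prod.cong[OF refl])
    fix i assume "i \<in> {..<n}"
    then have i: "Suc (n - Suc i) = n - i" by auto
    have "?t (n - i) \<ge> 0" using tin[of "n - i"] a by simp
    moreover have "\<tau> (Suc i) - \<tau> i \<ge> 0" using monoD[OF \<tau>(2), of i "Suc i"] by simp
    ultimately show "cf (distr M borel (Y (\<tau> (Suc i) - \<tau> i))) (\<lambda>x. ?t (n - i) * l x) =
        exp ((r (?t (n - Suc i)) - r (?t (Suc (n - Suc i)))) *\<^sub>R g (?t (Suc (n - Suc i))))"
      unfolding i by (simp add: g \<tau>_def scaleR_conv_of_real)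
  qed
  also have "\<dots> = (\<Prod>k<n. exp ((r (?t k) - r (?t (Suc k))) *\<^sub>R g (?t (Suc k))))"
    by (rule prod.nat_diff_reindex)
  finally show ?thesis by (simp add: exp_sum)
qed

lemma measurable_clock_sum:
  fixes Y :: "real \<Rightarrow> 'w \<Rightarrow> 'e::{banach, second_countable_topology}"
  assumes Y: "levy_process M Y" and ab: "a < b" and r: "antimono_on {a..b} r" "r b \<ge> 0"
  shows "clock_sum r a b Y n \<in> borel_measurable M"
proof -
  have "r t \<ge> 0" if "t \<in> {a..b}" for t
    using r that ab unfolding monotone_on_def by (auto intro: order_trans)
  then have "Y (r (node a b n k)) \<in> borel_measurable M" if "k \<le> n" "n > 0" for k
    using levy_processD(2)[OF Y] node_in[OF _ that] ab by simp
  then show ?thesis unfolding clock_sum_def[abs_def]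
    by (intro borel_measurable_sum borel_measurable_scaleR borel_measurable_diff) auto
qed

text \<open>Independence turns the characteristic functional of a clock sum into the exponential of
  a Riemann sum of \<open>g\<close> against the clock. Measurability holds because the clock sums
  converge on every path.\<close>

theorem cf_random_integral:
  fixes Y :: "real \<Rightarrow> 'w \<Rightarrow> 'e::{banach, second_countable_topology}"
  assumes Y: "levy_process M Y" and l: "bounded_linear l" and a: "0 \<le> a" "a < b"
    and gc: "continuous_on {0..} g"
    and g: "\<And>u t. u \<ge> 0 \<Longrightarrow> t \<ge> 0 \<Longrightarrow> cf (distr M borel (Y t)) (\<lambda>x. u * l x) = exp (complex_of_real t * g u)"
    and r: "continuous_on {a..b} r" "antimono_on {a..b} r" "r b \<ge> 0"
    and \<rho>: "set_integrable lborel {a<..b} \<rho>"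
      "\<And>x y. a \<le> x \<Longrightarrow> x \<le> y \<Longrightarrow> y \<le> b \<Longrightarrow> r x - r y = (LBINT t:{x<..y}. \<rho> t)"
  shows "random_integral (\<lambda>t. t) r a b Y \<in> borel_measurable M"
    and "cf (distr M borel (random_integral (\<lambda>t. t) r a b Y)) l = exp (LBINT t:{a<..b}. \<rho> t *\<^sub>R g t)"
proof -
  interpret prob_space M by (rule levy_processD[OF Y])
  note meas = measurable_clock_sum[OF Y a(2) r(2,3)]
  have lim: "(\<lambda>n. clock_sum r a b Y n \<omega>) \<longlonglongrightarrow> random_integral (\<lambda>t. t) r a b Y \<omega>" if "\<omega> \<in> space M" for \<omega>
    by (rule clock_sum_tendsto[where Y = Y and \<omega> = \<omega>, OF levy_processD(4)[OF Y that] a(2) r])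
  show rm: "random_integral (\<lambda>t. t) r a b Y \<in> borel_measurable M"
    by (rule borel_measurable_LIMSEQ_metric[OF meas lim])
  note [measurable] = meas rm measurable_cis_functional[OF l]
  have "(\<lambda>n. CLINT \<omega>|M. cis (l (clock_sum r a b Y n \<omega>))) \<longlonglongrightarrow> (CLINT \<omega>|M. cis (l (random_integral (\<lambda>t. t) r a b Y \<omega>)))"
  proof (rule integral_dominated_convergence[where w = "\<lambda>_. 1"])
    show "AE \<omega> in M. (\<lambda>n. cis (l (clock_sum r a b Y n \<omega>))) \<longlonglongrightarrow> cis (l (random_integral (\<lambda>t. t) r a b Y \<omega>))"
      unfolding cis_conv_exp by (intro AE_I2 tendsto_intros bounded_linear.tendsto[OF l] lim)
  qed auto
  moreover have "(\<lambda>n. CLINT \<omega>|M. cis (l (clock_sum r a b Y n \<omega>))) \<longlonglongrightarrow> exp (LBINT t:{a<..b}. \<rho> t *\<^sub>R g t)"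
  proof (rule Lim_transform_eventually)
    have "bounded (g ` {a..b})"
      by (intro compact_imp_bounded compact_continuous_image continuous_on_subset[OF gc]) (use a in auto)
    then obtain B where B: "\<And>u. u \<in> {a..b} \<Longrightarrow> norm (g u) \<le> B" unfolding bounded_iff by blast
    have "(\<lambda>n. \<Sum>k<n. (LBINT t:{node a b n k<..node a b n (Suc k)}. \<rho> t) *\<^sub>R g (node a b n (Suc k)))
      \<longlonglongrightarrow> (LBINT t:{a<..b}. \<rho> t *\<^sub>R g t)"
    proof (rule step_sum_tendsto_integral[OF a(2) \<rho>(1)])
      show "norm (g (node a b n (Suc k))) \<le> B" if "k < n" for n k
        using node_in[of a b "Suc k" n] a that by (intro B) auto
    next
      fix t K assume t: "t \<in> {a<..b}"
        and K: "\<And>n. n > 0 \<Longrightarrow> K n < n \<and> node a b n (K n) < t \<and> t \<le> node a b n (Suc (K n))"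
      have "isCont g t" using gc t a by (intro continuous_on_interior[OF gc]) auto
      then show "(\<lambda>n. g (node a b n (Suc (K n)))) \<longlonglongrightarrow> g t"
        by (rule isCont_tendsto_compose) (rule node_cell_tendsto, use K in auto)
    qed
    from tendsto_exp[OF this]
    show "(\<lambda>n. exp (\<Sum>k<n. (LBINT t:{node a b n k<..node a b n (Suc k)}. \<rho> t) *\<^sub>R g (node a b n (Suc k))))
      \<longlonglongrightarrow> exp (LBINT t:{a<..b}. \<rho> t *\<^sub>R g t)" .
    show "\<forall>\<^sub>F n in sequentially.
        exp (\<Sum>k<n. (LBINT t:{node a b n k<..node a b n (Suc k)}. \<rho> t) *\<^sub>R g (node a b n (Suc k))) =
        (CLINT \<omega>|M. cis (l (clock_sum r a b Y n \<omega>)))"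
      using eventually_gt_at_top[of 0]
    proof eventually_elim
      case (elim n)
      have "(LBINT t:{node a b n k<..node a b n (Suc k)}. \<rho> t) = r (node a b n k) - r (node a b n (Suc k))" if "k < n" for k
        using \<rho>(2)[of "node a b n k" "node a b n (Suc k)"] node_in[of a b k n] node_in[of a b "Suc k" n]
          node_mono[of a b k "Suc k" n] a that by simp
      then have "(\<Sum>k<n. (LBINT t:{node a b n k<..node a b n (Suc k)}. \<rho> t) *\<^sub>R g (node a b n (Suc k))) =
          (\<Sum>k<n. (r (node a b n k) - r (node a b n (Suc k))) *\<^sub>R g (node a b n (Suc k)))"
        by (intro sum.cong refl) simp
      then show ?case using cf_clock_sum[OF Y l a g r(2,3) elim] by simp
    qed
  qed
  ultimately have "(CLINT \<omega>|M. cis (l (random_integral (\<lambda>t. t) r a b Y \<omega>))) = exp (LBINT t:{a<..b}. \<rho> t *\<^sub>R g t)"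
    by (rule LIMSEQ_unique)
  then show "cf (distr M borel (random_integral (\<lambda>t. t) r a b Y)) l = exp (LBINT t:{a<..b}. \<rho> t *\<^sub>R g t)"
    by (simp add: cf_distr[OF rm l])
qed

section \<open>Weak limits\<close>

lemma weak_limit_prob:
  assumes "weak_limit N \<mu> F"
  shows "prob_space \<mu>" "sets \<mu> = sets borel"
  using assms by (auto simp: weak_limit_def)

lemma weak_limit_integral:
  fixes f :: "'a::topological_space \<Rightarrow> real"
  assumes "weak_limit N \<mu> F" "continuous_on UNIV f" "\<And>x. \<bar>f x\<bar> \<le> B"
  shows "((\<lambda>i. integral\<^sup>L (N i) f) \<longlongrightarrow> integral\<^sup>L \<mu> f) F"
proof -
  have "bounded (range f)" using assms(3) by (auto simp: bounded_iff)
  then show ?thesis using assms(1,2) unfolding weak_limit_def by simp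
qed

text \<open>Test functions of \<open>weak_limit\<close> are real, so real and imaginary parts are
  treated separately, as integrals of \<open>cos\<close> and \<open>sin\<close>.\<close>

lemma weak_limit_cf:
  fixes N :: "'i \<Rightarrow> 'e::real_normed_vector measure"
  assumes wl: "weak_limit N \<mu> F" and l: "bounded_linear l"
    and N: "\<forall>\<^sub>F i in F. prob_space (N i) \<and> sets (N i) = sets borel"
  shows "((\<lambda>i. cf (N i) l) \<longlongrightarrow> cf \<mu> l) F"
proof -
  have c: "continuous_on UNIV l" by (rule linear_continuous_on[OF l])
  have re: "Re (cf P l) = (LINT x|P. cos (l x))" "Im (cf P l) = (LINT x|P. sin (l x))"
    if "prob_space P" "sets P = sets borel" for P
    using integral_Re[OF integrable_cis_functional[OF that l]] integral_Im[OF integrable_cis_functional[OF that l]]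
    by (simp_all add: cf_def)
  have lims: "((\<lambda>i. LINT x|N i. cos (l x)) \<longlongrightarrow> (LINT x|\<mu>. cos (l x))) F"
    "((\<lambda>i. LINT x|N i. sin (l x)) \<longlongrightarrow> (LINT x|\<mu>. sin (l x))) F"
    by (rule weak_limit_integral[OF wl continuous_on_cos[OF c] abs_cos_le_one])
      (rule weak_limit_integral[OF wl continuous_on_sin[OF c] abs_sin_le_one])
  have "\<forall>\<^sub>F i in F. (LINT x|N i. cos (l x)) = Re (cf (N i) l)" "\<forall>\<^sub>F i in F. (LINT x|N i. sin (l x)) = Im (cf (N i) l)"
    using N by (auto elim!: eventually_mono simp: re)
  then show ?thesis
    unfolding tendsto_complex_iff re[OF weak_limit_prob[OF wl]]
    using Lim_transform_eventually[OF lims(1)] Lim_transform_eventually[OF lims(2)] by simp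
qed

lemma min_functional:
  assumes l: "bounded_linear (l :: 'a::real_normed_vector \<Rightarrow> real)" and d: "d \<ge> 0"
  shows "continuous_on UNIV (\<lambda>x. min 2 (d * \<bar>l x\<bar>))" "\<bar>min 2 (d * \<bar>l x\<bar>)\<bar> \<le> 2"
proof -
  show "continuous_on UNIV (\<lambda>x. min 2 (d * \<bar>l x\<bar>))"
    by (intro continuous_on_min continuous_on_const continuous_on_mult continuous_on_rabs linear_continuous_on[OF l])
  have "0 \<le> d * \<bar>l x\<bar>" using d by simp
  then show "\<bar>min 2 (d * \<bar>l x\<bar>)\<bar> \<le> 2" by linarith
qed

text \<open>The functional \<open>l\<close> itself need not be integrable. The cap 2 turns the
  modulus of continuity into the integral of a bounded continuous function, which weak convergence
  controls.\<close>

lemma cf_diff_le: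
  fixes M :: "'a::real_normed_vector measure"
  assumes M: "prob_space M" "sets M = sets borel" and l: "bounded_linear l" and d: "\<bar>u - v\<bar> \<le> d"
  shows "norm (cf M (\<lambda>x. u * l x) - cf M (\<lambda>x. v * l x)) \<le> (LINT x|M. min 2 (d * \<bar>l x\<bar>))"
proof -
  interpret prob_space M by fact
  have int: "integrable M (\<lambda>x. cis (u * l x))" for u
    by (rule integrable_cis_functional[OF M bounded_linear_const_mult[OF l]])
  have d0: "d \<ge> 0" using d by linarith
  have intm: "integrable M (\<lambda>x. min 2 (d * \<bar>l x\<bar>))"
    using min_functional[OF l d0] by (intro integrable_bounded_continuous[OF M, where B = 2]) simp_all
  have "norm (cf M (\<lambda>x. u * l x) - cf M (\<lambda>x. v * l x)) = norm (CLINT x|M. cis (u * l x) - cis (v * l x))"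
    unfolding cf_def using int by simp
  also have "\<dots> \<le> (LINT x|M. norm (cis (u * l x) - cis (v * l x)))" by (rule integral_norm_bound)
  also have "\<dots> \<le> (LINT x|M. min 2 (d * \<bar>l x\<bar>))"
  proof (rule integral_mono)
    fix x
    have "\<bar>u * l x - v * l x\<bar> = \<bar>u - v\<bar> * \<bar>l x\<bar>" by (simp only: abs_mult[symmetric] left_diff_distrib)
    also have "\<dots> \<le> d * \<bar>l x\<bar>" using d by (intro mult_right_mono) auto
    finally show "norm (cis (u * l x) - cis (v * l x)) \<le> min 2 (d * \<bar>l x\<bar>)"
      using norm_cis_diff_le[of "u * l x" "v * l x"] by linarith
  qed (use int intm in auto)
  finally show ?thesis .
qed

lemma integral_min_tendsto_0:
  fixes M :: "'a::real_normed_vector measure" and l :: "'a \<Rightarrow> real"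
  assumes M: "prob_space M" "sets M = sets borel" and l: "bounded_linear l" and e: "e > 0"
  obtains d where "d > 0" "(LINT x|M. min 2 (d * \<bar>l x\<bar>)) < e"
proof -
  interpret prob_space M by fact
  have [measurable]: "l \<in> borel_measurable M"
    using borel_measurable_functional[OF l] by (simp add: measurable_cong_sets[OF M(2) refl])
  have "(\<lambda>n. LINT x|M. min 2 (1 / real (Suc n) * \<bar>l x\<bar>)) \<longlonglongrightarrow> (LINT x|M. 0)"
  proof (rule integral_dominated_convergence[where w = "\<lambda>_. 2"])
    show "AE x in M. (\<lambda>n. min 2 (1 / real (Suc n) * \<bar>l x\<bar>)) \<longlonglongrightarrow> 0"
    proof (rule AE_I2)
      fix x
      have "(\<lambda>n. 1 / real (Suc n)) \<longlonglongrightarrow> 0" by real_asymp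
      from tendsto_min[OF tendsto_const[of 2] tendsto_mult_right[OF this, of "\<bar>l x\<bar>"]]
      show "(\<lambda>n. min 2 (1 / real (Suc n) * \<bar>l x\<bar>)) \<longlonglongrightarrow> 0" by simp
    qed
  qed auto
  then have "\<forall>\<^sub>F n in sequentially. (LINT x|M. min 2 (1 / real (Suc n) * \<bar>l x\<bar>)) < e"
    using e by (intro order_tendstoD(2)) auto
  then obtain n where "(LINT x|M. min 2 (1 / real (Suc n) * \<bar>l x\<bar>)) < e"
    by (auto simp: eventually_sequentially)
  then show ?thesis using that[of "1 / real (Suc n)"] by simp
qed

text \<open>The test function \<open>min 2 (d \<bar>l\<bar>)\<close> makes the characteristic functionals eventually
  equicontinuous along the ray, which upgrades pointwise to uniform convergence.\<close>

lemma weak_limit_cf_uniform: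
  fixes N :: "'i \<Rightarrow> 'e::real_normed_vector measure"
  assumes wl: "weak_limit N \<mu> F" and l: "bounded_linear l"
    and N: "\<forall>\<^sub>F i in F. prob_space (N i) \<and> sets (N i) = sets borel"
  shows "uniform_limit {0..T} (\<lambda>i u. cf (N i) (\<lambda>x. u * l x)) (\<lambda>u. cf \<mu> (\<lambda>x. u * l x)) F"
proof (rule uniform_limitI)
  fix e :: real assume e: "e > 0"
  obtain d where d: "d > 0" "(LINT x|\<mu>. min 2 (d * \<bar>l x\<bar>)) < e / 4"
    using integral_min_tendsto_0[OF weak_limit_prob[OF wl] l, of "e/4"] e by auto
  have "((\<lambda>i. LINT x|N i. min 2 (d * \<bar>l x\<bar>)) \<longlongrightarrow> (LINT x|\<mu>. min 2 (d * \<bar>l x\<bar>))) F"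
    using d by (intro weak_limit_integral[OF wl min_functional[OF l]]) simp_all
  from order_tendstoD(2)[OF this d(2)]
  have ev1: "\<forall>\<^sub>F i in F. (LINT x|N i. min 2 (d * \<bar>l x\<bar>)) < e / 4" .
  \<comment> \<open>A grid of mesh \<open>d\<close> covers \<open>[0,T]\<close>. Pointwise
    convergence is used at its finitely many points; the modulus bridges the remaining distance of
    at most \<open>d\<close>.\<close>
  define K where "K = nat \<lceil>T / d\<rceil>"
  have "\<forall>\<^sub>F i in F. dist (cf (N i) (\<lambda>x. (real k * d) * l x)) (cf \<mu> (\<lambda>x. (real k * d) * l x)) < e / 4" for k
    using weak_limit_cf[OF wl bounded_linear_const_mult[OF l] N] e by (intro tendstoD) auto
  then have ev2: "\<forall>\<^sub>F i in F. \<forall>k\<in>{..K}. dist (cf (N i) (\<lambda>x. (real k * d) * l x)) (cf \<mu> (\<lambda>x. (real k * d) * l x)) < e / 4"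
    by (intro eventually_ball_finite) auto
  show "\<forall>\<^sub>F i in F. \<forall>u\<in>{0..T}. dist (cf (N i) (\<lambda>x. u * l x)) (cf \<mu> (\<lambda>x. u * l x)) < e"
    using ev1 ev2 N
  proof eventually_elim
    case (elim i)
    show ?case
    proof
      fix u assume u: "u \<in> {0..T}"
      define k where "k = nat \<lfloor>u / d\<rfloor>"
      have "u / d \<le> T / d" using u d by (simp add: divide_right_mono)
      then have "\<lfloor>u / d\<rfloor> \<le> \<lceil>T / d\<rceil>" by linarith
      then have "k \<le> K" unfolding k_def K_def by (rule nat_mono)
      have "u / d \<ge> 0" using u d by simp
      then have "real k = of_int \<lfloor>u / d\<rfloor>" unfolding k_def by simp
      then have "real k \<le> u / d" "u / d < real k + 1" by linarith+
      then have "real k * d \<le> u" "u < (real k + 1) * d"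
        unfolding pos_le_divide_eq[OF d(1)] pos_divide_less_eq[OF d(1)] by blast+
      then have du: "\<bar>u - real k * d\<bar> \<le> d" by (simp add: algebra_simps)
      have 1: "dist (cf (N i) (\<lambda>x. u * l x)) (cf (N i) (\<lambda>x. (real k * d) * l x)) < e / 4"
        unfolding dist_norm using order_le_less_trans[OF cf_diff_le[OF _ _ l du, of "N i"] elim(1)] elim(3) by simp
      have 2: "dist (cf \<mu> (\<lambda>x. (real k * d) * l x)) (cf \<mu> (\<lambda>x. u * l x)) < e / 4"
        unfolding dist_norm 
        using order_le_less_trans[OF cf_diff_le[OF weak_limit_prob[OF wl] l du] d(2)] by (simp add: norm_minus_commute)
      have 3: "dist (cf (N i) (\<lambda>x. (real k * d) * l x)) (cf \<mu> (\<lambda>x. (real k * d) * l x)) < e / 4"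
        using elim(2) \<open>k \<le> K\<close> by auto
      let ?a = "cf (N i) (\<lambda>x. u * l x)" and ?b = "cf (N i) (\<lambda>x. (real k * d) * l x)"
        and ?c = "cf \<mu> (\<lambda>x. (real k * d) * l x)" and ?d = "cf \<mu> (\<lambda>x. u * l x)"
      have "dist ?a ?d \<le> dist ?a ?b + (dist ?b ?c + dist ?c ?d)"
        using dist_triangle[of ?a ?d ?b] dist_triangle[of ?b ?d ?c] by linarith
      then show "dist ?a ?d < e" using 1 2 3 e by linarith
    qed
  qed
qed

section \<open>Continuous logarithms under weak convergence\<close>

lemma norm_ge_1_if_exp_eq_1:
  assumes "exp w = 1" "w \<noteq> (0 :: complex)" shows "norm w \<ge> 1"
proof -
  obtain n :: int where n: "Re w = 0" "Im w = of_int (2 * n) * pi" using assms(1) by (auto simp: exp_eq_1)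
  then have "n \<noteq> 0" using assms(2) by (auto simp: complex_eq_iff)
  then have "1 \<le> \<bar>real_of_int n\<bar>" by linarith
  then have "1 * 1 \<le> \<bar>real_of_int n\<bar> * (2 * pi)" using pi_ge_two by (intro mult_mono) auto
  also have "\<dots> = \<bar>Im w\<bar>" using n by (simp add: abs_mult)
  also have "\<dots> \<le> norm w" by (rule abs_Im_le_cmod)
  finally show ?thesis by simp
qed

text \<open>\<open>D\<close> and \<open>Ln\<close> of its exponential are continuous logarithms of
  the same function. Their difference takes values in a discrete set and vanishes at 0, so it
  vanishes on the whole interval.\<close>

lemma continuous_log_near_1:
  fixes D :: "real \<Rightarrow> complex"
  assumes D: "continuous_on {0..T} D" "D 0 = 0" and near: "\<And>u. u \<in> {0..T} \<Longrightarrow> norm (exp (D u) - 1) < 1"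
    and u: "u \<in> {0..T}"
  shows "D u = Ln (exp (D u))"
proof -
  have pos: "Re (exp (D u)) > 0" if "u \<in> {0..T}" for u
  proof -
    have "\<bar>Re (exp (D u) - 1)\<bar> < 1" using near[OF that] abs_Re_le_cmod order_le_less_trans by blast
    then show ?thesis by simp
  qed
  define k where "k = (\<lambda>u. D u - Ln (exp (D u)))"
  have "exp (D u) \<notin> \<real>\<^sub>\<le>\<^sub>0" if "u \<in> {0..T}" for u
    using pos[OF that] by (auto simp: complex_nonpos_Reals_iff)
  then have kc: "continuous_on {0..T} k" unfolding k_def by (intro continuous_intros D) auto
  have k1: "exp (k u) = 1" for u by (simp add: k_def exp_diff)
  have "k constant_on {0..T}"
  proof (rule continuous_discrete_range_constant[OF connected_Icc kc])
    fix x
    have "1 \<le> norm (k y - k x)" if "k y \<noteq> k x" for y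
      using that by (intro norm_ge_1_if_exp_eq_1) (auto simp: exp_diff k1)
    then show "\<exists>e>0. \<forall>y. y \<in> {0..T} \<and> k y \<noteq> k x \<longrightarrow> e \<le> norm (k y - k x)" by (intro exI[of _ 1]) auto
  qed
  then obtain c where c: "\<And>x. x \<in> {0..T} \<Longrightarrow> k x = c" unfolding constant_on_def by blast
  have "k 0 = 0" by (simp add: k_def D(2))
  then have "k u = 0" using c[OF u] c[of 0] u by simp
  then show ?thesis by (simp add: k_def)
qed

text \<open>Applied to \<open>D = J i - G\<close>: the exponential of \<open>D\<close> is a quotient
  of characteristic functionals, uniformly close to 1, and the common value 0 at the origin excludes
  a shift by a multiple of \<open>2 * pi * i\<close>.\<close>

theorem weak_limit_log_uniform:
  fixes N :: "'i \<Rightarrow> 'e::real_normed_vector measure"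
  assumes wl: "weak_limit N \<mu> F" and l: "bounded_linear l"
    and N: "\<forall>\<^sub>F i in F. prob_space (N i) \<and> sets (N i) = sets borel"
    and J: "\<forall>\<^sub>F i in F. continuous_on {0..T} (J i) \<and> J i 0 = 0 \<and>
      (\<forall>u\<in>{0..T}. cf (N i) (\<lambda>x. u * l x) = exp (J i u))"
    and G: "continuous_on {0..T} G" "G 0 = 0" "\<And>u. u \<in> {0..T} \<Longrightarrow> cf \<mu> (\<lambda>x. u * l x) = exp (G u)"
  shows "uniform_limit {0..T} J G F"
proof (rule uniform_limitI)
  fix e :: real assume e: "e > 0"
  have "isCont Ln 1" by (intro continuous_intros) (auto simp: complex_nonpos_Reals_iff)
  then obtain d0 where d0: "d0 > 0" "\<And>z. norm (z - 1) < d0 \<Longrightarrow> norm (Ln z) < e"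
    using e unfolding continuous_at_eps_delta dist_norm Ln_1 diff_0_right by blast
  \<comment> \<open>The bound \<open>d0\<close> makes \<open>Ln\<close> small; the bound 1 keeps the
    exponential in the right half-plane, where \<open>Ln\<close> is continuous.\<close>
  define d where "d = min d0 1"
  have d: "d > 0" "d \<le> 1" "d \<le> d0" using d0 by (auto simp: d_def)
  have "compact ((\<lambda>u. exp (- G u)) ` {0..T})"
    by (intro compact_continuous_image continuous_intros G) auto
  then have "bounded ((\<lambda>u. exp (- G u)) ` {0..T})" by (rule compact_imp_bounded)
  then obtain B0 where B0: "\<And>u. u \<in> {0..T} \<Longrightarrow> norm (exp (- G u)) \<le> B0" unfolding bounded_iff by blast
  \<comment> \<open>A bound for the reciprocal of the limiting characteristic functional on
    \<open>[0,T]\<close>; the maximum with 1 makes it positive.\<close>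
  define B where "B = max B0 1"
  have B: "B > 0" "\<And>u. u \<in> {0..T} \<Longrightarrow> norm (exp (- G u)) \<le> B"
    using B0 by (auto simp: B_def intro: order_trans[OF _ max.cobounded1])
  have "\<forall>\<^sub>F i in F. \<forall>u\<in>{0..T}. dist (cf (N i) (\<lambda>x. u * l x)) (cf \<mu> (\<lambda>x. u * l x)) < d / B"
    using B d by (intro uniform_limitD[OF weak_limit_cf_uniform[OF wl l N]]) auto
  then show "\<forall>\<^sub>F i in F. \<forall>u\<in>{0..T}. dist (J i u) (G u) < e"
    using J
  proof eventually_elim
    case (elim i)
    define D where "D = (\<lambda>u. J i u - G u)"
    have near: "norm (exp (D u) - 1) < d" if u: "u \<in> {0..T}" for u
    proof -
      have "exp (D u) - 1 = (exp (J i u) - exp (G u)) * exp (- G u)"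
        by (simp add: D_def exp_diff exp_minus field_simps)
      then have "norm (exp (D u) - 1) = norm (exp (J i u) - exp (G u)) * norm (exp (- G u))"
        by (simp add: norm_mult)
      also have "\<dots> \<le> norm (exp (J i u) - exp (G u)) * B" using B(2)[OF u] by (intro mult_left_mono) auto
      also have "\<dots> < d"
        unfolding pos_less_divide_eq[OF B(1), symmetric]
      proof -
        have "dist (cf (N i) (\<lambda>x. u * l x)) (cf \<mu> (\<lambda>x. u * l x)) < d / B" using bspec[OF elim(1) u] .
        moreover have "cf (N i) (\<lambda>x. u * l x) = exp (J i u)" using elim(2) u by blast
        ultimately show "norm (exp (J i u) - exp (G u)) < d / B" using G(3)[OF u] by (simp only: dist_norm)
      qed
      finally show ?thesis .
    qed
    show ?case
    proof
      fix u assume u: "u \<in> {0..T}"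
      have Dc: "continuous_on {0..T} D" "D 0 = 0"
        using elim(2) G by (simp_all add: D_def continuous_on_diff)
      have n1: "norm (exp (D u) - 1) < 1" if "u \<in> {0..T}" for u
        using near[OF that] d by linarith
      have "D u = Ln (exp (D u))" by (rule continuous_log_near_1[OF Dc n1 u])
      moreover have "norm (Ln (exp (D u))) < e" using near[OF u] d by (intro d0) linarith
      ultimately show "dist (J i u) (G u) < e" by (simp add: D_def dist_norm)
    qed
  qed
qed

lemma weak_limit_unique:
  fixes N :: "'i \<Rightarrow> 'e::{banach, second_countable_topology} measure"
  assumes "weak_limit N \<mu> F" "weak_limit N \<mu>' F" "F \<noteq> bot"
  shows "\<mu> = \<mu>'"
proof (rule measure_eqI_bounded_continuous[OF weak_limit_prob[OF assms(1)] weak_limit_prob[OF assms(2)]])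
  fix f :: "'e \<Rightarrow> real" assume "continuous_on UNIV f" "bounded (range f)"
  then have "((\<lambda>i. integral\<^sup>L (N i) f) \<longlongrightarrow> integral\<^sup>L \<mu> f) F" "((\<lambda>i. integral\<^sup>L (N i) f) \<longlongrightarrow> integral\<^sup>L \<mu>' f) F"
    using assms(1,2) unfolding weak_limit_def by blast+
  then show "integral\<^sup>L \<mu> f = integral\<^sup>L \<mu>' f" by (rule tendsto_unique[OF assms(3)])
qed

lemma improper_map_weak_limit:
  fixes Y :: "'e::{banach, second_countable_topology} measure \<Rightarrow> real \<Rightarrow> 'w \<Rightarrow> 'e"
  assumes "\<nu> \<in> improper_map_dom \<Omega> Y h r F" "F \<noteq> bot"
  shows "weak_limit (\<lambda>(a, b). random_integral_map \<Omega> Y h r a b \<nu>) (improper_map \<Omega> Y h r F \<nu>) F"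
proof -
  obtain \<mu> where \<mu>: "weak_limit (\<lambda>(a, b). random_integral_map \<Omega> Y h r a b \<nu>) \<mu> F"
    using assms(1) by (auto simp: improper_map_dom_def)
  show ?thesis unfolding improper_map_def
    by (rule theI[where P = "\<lambda>\<mu>. weak_limit _ \<mu> F", OF \<mu>]) (rule weak_limit_unique[OF _ \<mu> assms(2)])
qed

lemma dominated_convergence_within:
  fixes s :: "real \<Rightarrow> 'a \<Rightarrow> 'b::{banach, second_countable_topology}"
  assumes f: "f \<in> borel_measurable M" and s: "\<And>t. t \<in> S \<Longrightarrow> s t \<in> borel_measurable M" and w: "integrable M w"
    and lim: "AE x in M. ((\<lambda>t. s t x) \<longlongrightarrow> f x) (at t0 within S)"
    and bound: "\<And>t. t \<in> S \<Longrightarrow> AE x in M. norm (s t x) \<le> w x"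
  shows "((\<lambda>t. integral\<^sup>L M (s t)) \<longlongrightarrow> integral\<^sup>L M f) (at t0 within S)"
  unfolding tendsto_at_iff_sequentially comp_def
proof (intro allI impI)
  fix X assume X: "\<forall>i::nat. X i \<in> S - {t0}" "X \<longlonglongrightarrow> t0"
  show "(\<lambda>n. integral\<^sup>L M (s (X n))) \<longlonglongrightarrow> integral\<^sup>L M f"
  proof (rule integral_dominated_convergence[OF f _ w])
    show "AE x in M. (\<lambda>i. s (X i) x) \<longlonglongrightarrow> f x"
      using lim
    proof eventually_elim
      case (elim x)
      then show ?case using X unfolding tendsto_at_iff_sequentially comp_def by blast
    qed
  qed (use X s bound in auto)
qed

section \<open>Tail integrals\<close>

text \<open>Vector-valued because it serves two purposes: both clocks are tails of real densities,
  and the function \<open>F\<close> of the overview is the tail of a complex function.\<close>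

definition tail :: "(real \<Rightarrow> 'a::{banach, second_countable_topology}) \<Rightarrow> real \<Rightarrow> 'a" where
  "tail f x = (LBINT u:{x<..}. f u)"

context
  fixes f :: "real \<Rightarrow> 'a::{banach, second_countable_topology}"
  assumes int: "\<And>c. c > 0 \<Longrightarrow> set_integrable lborel {c<..} f"
begin

lemma set_integrable_Ioc: "x > 0 \<Longrightarrow> set_integrable lborel {x<..y} f"
  by (rule set_integrable_subset[OF int]) auto

lemma tail_diff:
  assumes "0 < x" "x \<le> y"
  shows "tail f x - tail f y = (LBINT u:{x<..y}. f u)"
proof -
  have "{x<..} = {x<..y} \<union> {y<..}" using assms by auto
  moreover have "(LBINT u:{x<..y} \<union> {y<..}. f u) = (LBINT u:{x<..y}. f u) + (LBINT u:{y<..}. f u)"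
    by (rule set_integral_Un) (use assms int set_integrable_Ioc in auto)
  ultimately show ?thesis by (simp add: tail_def)
qed

lemma tail_continuous: "continuous_on {0<..} (tail f)"
  unfolding continuous_on_def
proof
  fix x :: real assume x: "x \<in> {0<..}"
  \<comment> \<open>Staying above \<open>x/2\<close> supplies one integrable majorant; the
    integrands converge at every point except \<open>x\<close>.\<close>
  have "(tail f \<longlongrightarrow> tail f x) (at x within {x/2<..})"
    unfolding tail_def set_lebesgue_integral_def
  proof (rule dominated_convergence_within)
    show "(\<lambda>u. indicator {x<..} u *\<^sub>R f u) \<in> borel_measurable lborel"
      using int[of x] x unfolding set_integrable_def by simp
    show "(\<lambda>u. indicator {t<..} u *\<^sub>R f u) \<in> borel_measurable lborel" if "t \<in> {x/2<..}" for t
      using int[of t] x that unfolding set_integrable_def by simp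
    show "integrable lborel (\<lambda>u. norm (indicator {x/2<..} u *\<^sub>R f u))"
      using int[of "x/2"] x unfolding set_integrable_def by (intro integrable_norm) simp
    show "AE u in lborel. ((\<lambda>t. indicator {t<..} u *\<^sub>R f u) \<longlongrightarrow> indicator {x<..} u *\<^sub>R f u) (at x within {x/2<..})"
      using AE_lborel_singleton[of x]
    proof eventually_elim
      case (elim u)
      have "\<forall>\<^sub>F t in nhds x. indicator {t<..} u = (indicator {x<..} u :: real)"
      proof (cases "u < x")
        case True
        from eventually_nhds_in_open[of "{u<..}" x] True show ?thesis by (auto elim!: eventually_mono simp: indicator_def)
      next
        case False
        with elim have "x < u" by simp
        with eventually_nhds_in_open[of "{..<u}" x] show ?thesis by (auto elim!: eventually_mono simp: indicator_def)
      qed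
      then have "\<forall>\<^sub>F t in at x within {x/2<..}. indicator {t<..} u *\<^sub>R f u = indicator {x<..} u *\<^sub>R f u"
        unfolding eventually_at_filter by (rule eventually_mono) simp
      then show ?case by (rule tendsto_eventually)
    qed
    show "AE u in lborel. norm (indicator {t<..} u *\<^sub>R f u) \<le> norm (indicator {x/2<..} u *\<^sub>R f u)" if "t \<in> {x/2<..}" for t
      using that by (intro AE_I2) (auto simp: indicator_def)
  qed
  then have "(tail f \<longlongrightarrow> tail f x) (at x)"
    using at_within_open[of x "{x/2<..}"] x by simp
  then show "(tail f \<longlongrightarrow> tail f x) (at x within {0<..})" by (rule tendsto_within_subset) simp
qed

lemma tail_tendsto_0: "(tail f \<longlongrightarrow> 0) at_top"
proof -
  \<comment> \<open>The cut-off at 1 gives an integrable majorant for every \<open>t\<close>; for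
    \<open>t \<ge> 1\<close> it changes nothing.\<close>
  have "((\<lambda>t. LBINT u. indicator {max 1 t<..} u *\<^sub>R f u) \<longlongrightarrow> (LBINT (u::real). (0 :: 'a))) at_top"
  proof (rule tendsto_at_topI_sequentially, rule integral_dominated_convergence)
    fix X :: "nat \<Rightarrow> real" assume X: "filterlim X at_top sequentially"
    show "(\<lambda>u. indicator {max 1 (X n)<..} u *\<^sub>R f u) \<in> borel_measurable lborel" for n
      using int[of "max 1 (X n)"] unfolding set_integrable_def by simp
    show "integrable lborel (\<lambda>u. norm (indicator {1<..} u *\<^sub>R f u))"
      using int[of 1] unfolding set_integrable_def by (intro integrable_norm) simp
    show "AE u in lborel. (\<lambda>n. indicator {max 1 (X n)<..} u *\<^sub>R f u) \<longlonglongrightarrow> 0"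
    proof (rule AE_I2)
      fix u
      have "\<forall>\<^sub>F n in sequentially. u \<le> X n" using X by (simp add: filterlim_at_top)
      then have "\<forall>\<^sub>F n in sequentially. indicator {max 1 (X n)<..} u *\<^sub>R f u = 0"
        by eventually_elim (simp add: indicator_def)
      then show "(\<lambda>n. indicator {max 1 (X n)<..} u *\<^sub>R f u) \<longlonglongrightarrow> 0" by (rule tendsto_eventually)
    qed
  qed (auto simp: indicator_def)
  note lim = this
  have "\<forall>\<^sub>F t in at_top. (LBINT u. indicator {max 1 t<..} u *\<^sub>R f u) = tail f t"
    using eventually_ge_at_top[of 1] by eventually_elim (simp add: tail_def set_lebesgue_integral_def max_def)
  from Lim_transform_eventually[OF lim this] show ?thesis by simp
qed

end

section \<open>An Abelian lemma\<close>

text \<open>Integration by parts against the tail of \<open>\<kappa>\<close>: extended by its limit,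
  that tail is continuous up to 0, so both the boundary term and the integral of
  \<open>q' u *\<^sub>R K u\<close> converge even if \<open>\<kappa>\<close> is only conditionally
  integrable.\<close>

lemma improper_integral_times_smooth:
  fixes \<kappa> :: "real \<Rightarrow> complex" and q q' :: "real \<Rightarrow> real"
  assumes \<kappa>: "continuous_on {0<..c} \<kappa>" and c: "c > 0"
    and q: "\<And>u. u \<in> {0..c} \<Longrightarrow> (q has_real_derivative q' u) (at u within {0..c})" and q': "continuous_on {0..c} q'"
    and lim: "((\<lambda>e. integral {e..c} \<kappa>) \<longlongrightarrow> K0) (at_right 0)"
  obtains Z where "((\<lambda>e. integral {e..c} (\<lambda>u. q u *\<^sub>R \<kappa> u)) \<longlongrightarrow> Z) (at_right 0)"
proof -
  define K where "K = (\<lambda>v. if v \<le> 0 then K0 else integral {v..c} \<kappa>)"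
  have qc: "continuous_on {0..c} q" using q by (intro DERIV_continuous_on)
  have Kd: "(K has_vector_derivative - \<kappa> v) (at v within {e..c})" if e: "0 < e" "v \<in> {e..c}" for e v
  proof -
    have \<kappa>e: "continuous_on {e..c} \<kappa>" using e by (intro continuous_on_subset[OF \<kappa>]) auto
    have der: "((\<lambda>u. integral {e..c} \<kappa> - integral {e..u} \<kappa>) has_vector_derivative 0 - \<kappa> v) (at v within {e..c})"
      by (intro has_vector_derivative_diff has_vector_derivative_const integral_has_vector_derivative[OF \<kappa>e e(2)])
    have eq: "K u = integral {e..c} \<kappa> - integral {e..u} \<kappa>" if "u \<in> {e..c}" for u
      using Henstock_Kurzweil_Integration.integral_combine[where a = e and c = u and b = c and f = \<kappa>] integrable_continuous_real[OF \<kappa>e] that e by (simp add: K_def algebra_simps)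
    show ?thesis
      using has_vector_derivative_transform[OF e(2) eq der] by simp
  qed
  have Kc: "continuous_on {0..c} K"
    unfolding continuous_on_def
  proof
    fix v assume v: "v \<in> {0..c}"
    show "(K \<longlongrightarrow> K v) (at v within {0..c})"
    proof (cases "v = 0")
      case True
      have "\<forall>\<^sub>F e in at_right 0. integral {e..c} \<kappa> = K e"
        using eventually_at_right_less[of 0] by eventually_elim (simp add: K_def)
      from Lim_transform_eventually[OF lim this] have "(K \<longlongrightarrow> K 0) (at_right 0)" by (simp add: K_def)
      then show ?thesis unfolding True at_within_Icc_at_right[OF c] .
    next
      case False
      with v have v0: "v > 0" by simp
      have "(K has_vector_derivative - \<kappa> v) (at v within {v/2..c})" using v v0 by (intro Kd) auto
      then have "(K \<longlongrightarrow> K v) (at v within {v/2..c})"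
        using has_vector_derivative_continuous[of K "- \<kappa> v" v "{v/2..c}"] by (simp add: continuous_within)
      moreover have "at v within {v/2..c} = at v within {0..c}"
        by (rule at_within_nhd[of v "{v/2<..}"]) (use v0 in auto)
      ultimately show ?thesis by simp
    qed
  qed
  have int: "(\<lambda>u. q' u *\<^sub>R K u) integrable_on {0..c}"
    by (intro integrable_continuous_real continuous_on_scaleR q' Kc)
  have parts: "integral {e..c} (\<lambda>u. q u *\<^sub>R \<kappa> u) = q e *\<^sub>R K e + integral {e..c} (\<lambda>u. q' u *\<^sub>R K u)"
    if e: "e \<in> {0<..c}" for e
  proof -
    have "((\<lambda>u. q u *\<^sub>R (- \<kappa> u) + q' u *\<^sub>R K u) has_integral q c *\<^sub>R K c - q e *\<^sub>R K e) {e..c}"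
    proof (rule fundamental_theorem_of_calculus)
      fix u assume u: "u \<in> {e..c}"
      have "(q has_real_derivative q' u) (at u within {e..c})"
        by (rule DERIV_subset[OF q]) (use u e in auto)
      then show "((\<lambda>u. q u *\<^sub>R K u) has_vector_derivative q u *\<^sub>R (- \<kappa> u) + q' u *\<^sub>R K u) (at u within {e..c})"
        by (intro has_vector_derivative_scaleR Kd) (use u e in auto)
    qed (use e in simp)
    moreover have "K c = 0" using c by (simp add: K_def)
    ultimately have 1: "((\<lambda>u. q' u *\<^sub>R K u - q u *\<^sub>R \<kappa> u) has_integral - (q e *\<^sub>R K e)) {e..c}"
      by (simp add: algebra_simps)
    have 2: "(\<lambda>u. q' u *\<^sub>R K u) integrable_on {e..c}"
      by (rule integrable_on_subinterval[OF int]) (use e in auto)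
    have "((\<lambda>u. q' u *\<^sub>R K u - (q' u *\<^sub>R K u - q u *\<^sub>R \<kappa> u)) has_integral
        integral {e..c} (\<lambda>u. q' u *\<^sub>R K u) - (- (q e *\<^sub>R K e))) {e..c}"
      by (rule has_integral_diff[OF integrable_integral[OF 2] 1])
    then show ?thesis by (simp add: integral_unique algebra_simps)
  qed
  have "continuous_on {0..c} (\<lambda>e. q e *\<^sub>R K e + integral {e..c} (\<lambda>u. q' u *\<^sub>R K u))"
    by (intro continuous_on_add continuous_on_scaleR qc Kc indefinite_integral_continuous_1'[OF int])
  then have "((\<lambda>e. q e *\<^sub>R K e + integral {e..c} (\<lambda>u. q' u *\<^sub>R K u)) \<longlongrightarrow>
      q 0 *\<^sub>R K 0 + integral {0..c} (\<lambda>u. q' u *\<^sub>R K u)) (at 0 within {0..c})"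
    using c unfolding continuous_on_def by simp
  then have 1: "((\<lambda>e. q e *\<^sub>R K e + integral {e..c} (\<lambda>u. q' u *\<^sub>R K u)) \<longlongrightarrow>
      q 0 *\<^sub>R K 0 + integral {0..c} (\<lambda>u. q' u *\<^sub>R K u)) (at_right 0)"
    unfolding at_within_Icc_at_right[OF c] .
  have 2: "\<forall>\<^sub>F e in at_right 0. q e *\<^sub>R K e + integral {e..c} (\<lambda>u. q' u *\<^sub>R K u) = integral {e..c} (\<lambda>u. q u *\<^sub>R \<kappa> u)"
    using eventually_at_right_real[OF c] by eventually_elim (simp add: parts)
  show ?thesis by (rule that[OF Lim_transform_eventually[OF 1 2]])
qed

text \<open>Connects the Lebesgue integrals of the clocks with the Henstock-Kurzweil integrals in
  which the integration by parts is done; the domains differ by the null set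
  \<open>{a}\<close>.\<close>

lemma integral_Ioc_eq_HK:
  fixes f :: "real \<Rightarrow> 'b::euclidean_space"
  assumes "continuous_on {a..b} f"
  shows "set_integrable lborel {a<..b} f" "(LBINT u:{a<..b}. f u) = integral {a..b} f"
proof -
  have "set_integrable lborel {a..b} f" by (rule borel_integrable_atLeastAtMost'[OF assms])
  then show int: "set_integrable lborel {a<..b} f" by (rule set_integrable_subset) auto
  have "(LBINT u:{a<..b}. f u) = integral {a<..b} f" by (rule set_borel_integral_eq_integral(2)[OF int])
  also have "\<dots> = integral {a..b} f"
  proof (rule integral_spike_set)
    show "negligible {x \<in> {a<..b} - {a..b}. f x \<noteq> 0}" by (rule negligible_subset[of "{}"]) auto
    show "negligible {x \<in> {a..b} - {a<..b}. f x \<noteq> 0}" by (rule negligible_subset[of "{a}"]) auto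
  qed
  finally show "(LBINT u:{a<..b}. f u) = integral {a..b} f" .
qed

text \<open>Meant for factors \<open>g\<close> such as the shifted gamma density, which is
  integrable but unbounded when its parameter is below 1.\<close>

lemma set_integrable_scaleR_continuous:
  fixes f :: "real \<Rightarrow> 'b::euclidean_space" and g :: "real \<Rightarrow> real"
  assumes g: "set_integrable lborel {a<..b} g" and f: "continuous_on {a..b} f"
  shows "set_integrable lborel {a<..b} (\<lambda>u. g u *\<^sub>R f u)"
proof -
  have "bounded (f ` {a..b})" by (intro compact_imp_bounded compact_continuous_image f) simp
  then obtain B where B: "\<And>u. u \<in> {a..b} \<Longrightarrow> norm (f u) \<le> B" unfolding bounded_iff by blast
  have meas: "(\<lambda>u. indicator {a<..b} u *\<^sub>R f u) \<in> borel_measurable lborel" "(\<lambda>u. indicator {a<..b} u *\<^sub>R g u) \<in> borel_measurable lborel"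
    using integral_Ioc_eq_HK(1)[OF f] g unfolding set_integrable_def by (auto dest: borel_measurable_integrable)
  have eq: "indicator {a<..b} u *\<^sub>R (g u *\<^sub>R f u) = (indicator {a<..b} u *\<^sub>R g u) *\<^sub>R (indicator {a<..b} u *\<^sub>R f u)" for u
    by (simp add: indicator_def)
  show ?thesis
    unfolding set_integrable_def
  proof (rule Bochner_Integration.integrable_bound)
    show "integrable lborel (\<lambda>u. B * norm (indicator {a<..b} u *\<^sub>R g u))"
      using g unfolding set_integrable_def by (intro integrable_mult_right integrable_norm)
    show "(\<lambda>u. indicator {a<..b} u *\<^sub>R (g u *\<^sub>R f u)) \<in> borel_measurable lborel"
      unfolding eq by (intro borel_measurable_scaleR meas)
    show "AE u in lborel. norm (indicator {a<..b} u *\<^sub>R (g u *\<^sub>R f u)) \<le> norm (B * norm (indicator {a<..b} u *\<^sub>R g u))"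
    proof (rule AE_I2)
      fix u
      show "norm (indicator {a<..b} u *\<^sub>R (g u *\<^sub>R f u)) \<le> norm (B * norm (indicator {a<..b} u *\<^sub>R g u))"
      proof (cases "u \<in> {a<..b}")
        case True
        then have "norm (f u) \<le> \<bar>B\<bar>" using B[of u] by auto
        then have "\<bar>g u\<bar> * norm (f u) \<le> \<bar>g u\<bar> * \<bar>B\<bar>" by (intro mult_left_mono) auto
        then show ?thesis using True by (simp add: abs_mult mult.commute)
      qed simp
    qed
  qed
qed

section \<open>The gamma density\<close>

text \<open>The value 0 for \<open>w \<le> 0\<close> confines the convolution integrals to
  \<open>u < t\<close>.\<close>

definition gamma_density :: "real \<Rightarrow> real \<Rightarrow> real" where
  "gamma_density c w = (if w > 0 then w powr (c - 1) * exp (- w) / Gamma c else 0)"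

lemma gamma_density_nonneg: "c > 0 \<Longrightarrow> gamma_density c w \<ge> 0"
  by (simp add: gamma_density_def Gamma_real_pos less_imp_le)

lemma measurable_gamma_density [measurable]: "gamma_density c \<in> borel_measurable borel"
  unfolding gamma_density_def[abs_def] by measurable

lemma gamma_density_integral:
  assumes c: "c > 0"
  shows "integrable lborel (gamma_density c)" "integral\<^sup>L lborel (gamma_density c) = 1"
proof -
  define f where "f = (\<lambda>t::real. indicator {0..} t * t powr (c - 1) / exp t)"
  have G: "Gamma c > 0" by (rule Gamma_real_pos[OF c])
  have m: "f \<in> borel_measurable lborel" unfolding f_def by measurable
  have "integrable lborel f \<and> integral\<^sup>L lborel f = Gamma c"
  proof (subst nn_integral_eq_integrable[symmetric])
    show "AE t in lborel. 0 \<le> f t" unfolding f_def by (intro AE_I2) simp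
    show "(\<integral>\<^sup>+ t. ennreal (f t) \<partial>lborel) = ennreal (Gamma c)"
      unfolding f_def using Gamma_conv_nn_integral_real[OF c] by simp
  qed (use m G in auto)
  moreover have "gamma_density c = (\<lambda>t. f t / Gamma c)"
    by (rule ext) (auto simp: gamma_density_def f_def exp_minus divide_inverse indicator_def)
  ultimately show "integrable lborel (gamma_density c)" "integral\<^sup>L lborel (gamma_density c) = 1"
    using G by simp_all
qed

lemma set_integrable_gamma_density_shift:
  assumes "c > 0"
  shows "set_integrable lborel {a<..b} (\<lambda>u. gamma_density c (t - u))"
proof -
  have "integrable lborel (\<lambda>u. gamma_density c (t - u))"
    using lborel_integrable_real_affine[OF gamma_density_integral(1)[OF assms], of "-1" t] by simp
  then show ?thesis unfolding set_integrable_def by (intro integrable_mult_indicator) auto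
qed

text \<open>Fubini with the interval integral carried out first: \<open>m\<close> then enters only
  through its integrals over shifted intervals, that is, through differences of its tail.\<close>

lemma convolution_integral:
  fixes p :: "real \<Rightarrow> real" and m :: "real \<Rightarrow> 'b::{banach, second_countable_topology}"
  assumes p: "integrable lborel p" and m: "integrable lborel m"
  shows "set_integrable lborel {a<..b} (\<lambda>t. LBINT u. p (t - u) *\<^sub>R m u)"
    and "(LBINT t:{a<..b}. (LBINT u. p (t - u) *\<^sub>R m u)) = (LBINT w. p w *\<^sub>R (LBINT v:{a - w<..b - w}. m v))"
proof -
  have [measurable]: "p \<in> borel_measurable borel" "m \<in> borel_measurable borel"
    using borel_measurable_integrable[OF p] borel_measurable_integrable[OF m] by simp_all
  define f0 where "f0 = (\<lambda>(w, t). p w *\<^sub>R m (t - w))"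
  have shift: "integrable lborel (\<lambda>t. m (t - w))" for w
    using lborel_integrable_real_affine[OF m, of 1 "- w"] by simp
  have norm_shift: "(LBINT t. norm (m (t - w))) = (LBINT t. norm (m t))" for w
    using lborel_integral_real_affine[of 1 "\<lambda>t. norm (m t)" "- w"] by simp
  have int0: "integrable (lborel \<Otimes>\<^sub>M lborel) f0"
  proof (rule lborel_pair.Fubini_integrable)
    show "f0 \<in> borel_measurable (lborel \<Otimes>\<^sub>M lborel)" unfolding f0_def by measurable
    have "(\<lambda>w. LBINT t. norm (f0 (w, t))) = (\<lambda>w. norm (p w) * (LBINT t. norm (m t)))"
      by (simp add: f0_def norm_shift)
    then show "integrable lborel (\<lambda>w. LBINT t. norm (f0 (w, t)))"
      using p by (simp only:) (intro integrable_mult_left integrable_norm)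
    show "AE w in lborel. integrable lborel (\<lambda>t. f0 (w, t))"
      unfolding f0_def using shift by (intro AE_I2) simp
  qed
  define f where "f = (\<lambda>w t. indicator {a<..b} t *\<^sub>R (p w *\<^sub>R m (t - w)))"
  have "integrable (lborel \<Otimes>\<^sub>M lborel) (\<lambda>x. indicator (UNIV \<times> {a<..b}) x *\<^sub>R f0 x)"
    by (rule integrable_mult_indicator[OF _ int0]) (auto intro!: pair_measureI)
  moreover have "(\<lambda>x. indicator (UNIV \<times> {a<..b}) x *\<^sub>R f0 x) = case_prod f"
    by (auto simp: f_def f0_def indicator_def fun_eq_iff)
  ultimately have int: "integrable (lborel \<Otimes>\<^sub>M lborel) (case_prod f)" by simp
  have inner: "(LBINT w. f w t) = indicator {a<..b} t *\<^sub>R (LBINT u. p (t - u) *\<^sub>R m u)" for t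
    unfolding f_def using lborel_integral_real_affine[of "-1" "\<lambda>w. p w *\<^sub>R m (t - w)" t]
    by (simp del: scaleR_scaleR)
  show "set_integrable lborel {a<..b} (\<lambda>t. LBINT u. p (t - u) *\<^sub>R m u)"
    using lborel_pair.integrable_snd[OF int] unfolding inner set_integrable_def .
  have outer: "(LBINT t. f w t) = p w *\<^sub>R (LBINT v:{a - w<..b - w}. m v)" for w
  proof -
    have "(LBINT t. f w t) = (LBINT t. p w *\<^sub>R (indicator {a<..b} t *\<^sub>R m (t - w)))"
      by (simp only: f_def scaleR_left_commute[of _ "p w"])
    also have "\<dots> = p w *\<^sub>R (LBINT t. indicator {a<..b} t *\<^sub>R m (t - w))" by (simp del: scaleR_scaleR)
    also have "(LBINT t. indicator {a<..b} t *\<^sub>R m (t - w)) = (LBINT v. indicator {a<..b} (w + v) *\<^sub>R m v)"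
      using lborel_integral_real_affine[of 1 "\<lambda>t. indicator {a<..b} t *\<^sub>R m (t - w)" w] by simp
    also have "\<dots> = (LBINT v:{a - w<..b - w}. m v)"
      unfolding set_lebesgue_integral_def
      by (intro Bochner_Integration.integral_cong refl) (auto simp: indicator_def)
    finally show ?thesis .
  qed
  show "(LBINT t:{a<..b}. (LBINT u. p (t - u) *\<^sub>R m u)) = (LBINT w. p w *\<^sub>R (LBINT v:{a - w<..b - w}. m v))"
    using lborel_pair.Fubini_integral[OF int] unfolding inner outer set_lebesgue_integral_def .
qed

section \<open>Conditionally convergent convolutions with the gamma density\<close>

lemma eventually_ends_0_infinity: "\<forall>\<^sub>F x in ends_0_infinity. 0 < fst x \<and> fst x < snd x"
proof -
  have "\<forall>\<^sub>F x in ends_0_infinity. fst x \<in> {0<..<1} \<and> snd x > 1"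
    unfolding eventually_prod_filter
    by (rule exI[of _ "\<lambda>a. a \<in> {0<..<1::real}"], rule exI[of _ "\<lambda>b. b > (1::real)"])
      (use eventually_at_right_real[of 0 1] eventually_gt_at_top[of 1] in simp)
  then show ?thesis by eventually_elim auto
qed

lemma filterlim_ends_0_infinity:
  "filterlim fst (at_right 0) ends_0_infinity" "filterlim snd at_top ends_0_infinity"
  by (rule filterlim_fst filterlim_snd)+

text \<open>The assumption \<open>lim\<close> gives \<open>h = p * f\<close> a meaning when
  \<open>f\<close> is not integrable at 0: the cut-off convolutions converge, locally uniformly in
  \<open>t\<close>.\<close>

context
  fixes c :: real and f h :: "real \<Rightarrow> complex"
  assumes c: "c > 0"
    and f: "continuous_on {0<..} f" "\<And>x. x > 0 \<Longrightarrow> set_integrable lborel {x<..} f"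
    and h: "continuous_on {0<..} h"
    and lim: "\<And>a b. 0 < a \<Longrightarrow> a \<le> b \<Longrightarrow>
      uniform_limit {a..b} (\<lambda>e t. LBINT u:{e<..t}. gamma_density c (t - u) *\<^sub>R f u) h (at_right 0)"
begin

text \<open>At \<open>t = 1\<close> the assumption \<open>lim\<close> says that
  \<open>gamma_density c (1 - u) *\<^sub>R f u\<close> is improperly integrable at 0. On
  \<open>[0, 1/2]\<close>, away from the singularity at \<open>u = 1\<close>, the reciprocal of the
  kernel is smooth, and \<open>improper_integral_times_smooth\<close> recovers
  \<open>f\<close>.\<close>

lemma tail_limit_at_0: obtains Z where "(tail f \<longlongrightarrow> Z) (at_right 0)"
proof -
  define \<kappa> where "\<kappa> = (\<lambda>u. gamma_density c (1 - u) *\<^sub>R f u)"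
  \<comment> \<open>The reciprocal of \<open>gamma_density c (1 - u)\<close> for
    \<open>u < 1\<close>; \<open>q'\<close> is its derivative.\<close>
  define q where "q = (\<lambda>u::real. Gamma c * (1 - u) powr (1 - c) * exp (1 - u))"
  define q' where "q' = (\<lambda>u::real. Gamma c * (- (1 - c) * (1 - u) powr (- c) * exp (1 - u) - (1 - u) powr (1 - c) * exp (1 - u)))"
  have G: "Gamma c > 0" by (rule Gamma_real_pos[OF c])
  have ev12: "\<forall>\<^sub>F e in at_right 0. e \<in> {0<..<1/2 :: real}" by (rule eventually_at_right_real) simp
  have fsub: "continuous_on {e..y} f" if "0 < e" for e y using that by (intro continuous_on_subset[OF f(1)]) auto
  have int: "set_integrable lborel {e<..y} \<kappa>" if "0 < e" for e y
    unfolding \<kappa>_def by (rule set_integrable_scaleR_continuous[OF set_integrable_gamma_density_shift[OF c] fsub[OF that]])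
  have \<kappa>c: "continuous_on {0<..1/2} \<kappa>"
  proof -
    have "continuous_on {0<..1/2} (\<lambda>u. ((1 - u) powr (c - 1) * exp (- (1 - u)) / Gamma c) *\<^sub>R f u)"
      by (intro continuous_intros continuous_on_subset[OF f(1)]) (use G in auto)
    then show ?thesis
      by (rule continuous_on_cong[THEN iffD1, rotated -1]) (auto simp: \<kappa>_def gamma_density_def)
  qed
  have "((\<lambda>e. LBINT u:{e<..1}. \<kappa> u) \<longlongrightarrow> h 1) (at_right 0)"
    unfolding \<kappa>_def using tendsto_uniform_limitI[OF lim[of 1 1], of 1] by simp
  then have "((\<lambda>e. (LBINT u:{e<..1}. \<kappa> u) - (LBINT u:{1/2<..1}. \<kappa> u)) \<longlongrightarrow> h 1 - (LBINT u:{1/2<..1}. \<kappa> u)) (at_right 0)"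
    by (intro tendsto_intros)
  moreover have "\<forall>\<^sub>F e in at_right 0. (LBINT u:{e<..1}. \<kappa> u) - (LBINT u:{1/2<..1}. \<kappa> u) = integral {e..1/2} \<kappa>"
    using ev12
  proof eventually_elim
    case (elim e)
    have "{e<..1} = {e<..1/2} \<union> {1/2<..1}" using elim by auto
    moreover have "(LBINT u:{e<..1/2} \<union> {1/2<..1}. \<kappa> u) = (LBINT u:{e<..1/2}. \<kappa> u) + (LBINT u:{1/2<..1}. \<kappa> u)"
      by (rule set_integral_Un) (use int elim in auto)
    moreover have "continuous_on {e..1/2} \<kappa>" using elim by (intro continuous_on_subset[OF \<kappa>c]) auto
    ultimately show ?case using integral_Ioc_eq_HK(2)[of e "1/2" \<kappa>] by simp
  qed
  ultimately have K: "((\<lambda>e. integral {e..1/2} \<kappa>) \<longlongrightarrow> h 1 - (LBINT u:{1/2<..1}. \<kappa> u)) (at_right 0)"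
    by (rule Lim_transform_eventually)
  have qd: "(q has_real_derivative q' u) (at u within {0..1/2})" if "u \<in> {0..1/2}" for u
    unfolding q_def q'_def using that
    by (auto intro!: derivative_eq_intros simp: algebra_simps)
  have q'c: "continuous_on {0..1/2} q'" unfolding q'_def by (intro continuous_intros) auto
  obtain Z where Z: "((\<lambda>e. integral {e..1/2} (\<lambda>u. q u *\<^sub>R \<kappa> u)) \<longlongrightarrow> Z) (at_right 0)"
    by (rule improper_integral_times_smooth[OF \<kappa>c _ qd q'c K]) auto
  have "\<forall>\<^sub>F e in at_right 0. integral {e..1/2} (\<lambda>u. q u *\<^sub>R \<kappa> u) + tail f (1/2) = tail f e"
    using ev12
  proof eventually_elim
    case (elim e)
    have "q u *\<^sub>R \<kappa> u = f u" if "u \<in> {e..1/2}" for u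
    proof -
      have "q u * gamma_density c (1 - u) = ((1 - u) powr (1 - c) * (1 - u) powr (c - 1)) * (exp (1 - u) * exp (- (1 - u)))"
        using that G by (simp add: q_def gamma_density_def)
      also have "(1 - u) powr (1 - c) * (1 - u) powr (c - 1) = 1" using that by (simp flip: powr_add)
      also have "exp (1 - u) * exp (- (1 - u)) = 1" by (rule exp_minus_inverse)
      finally show ?thesis by (simp add: \<kappa>_def)
    qed
    then have "integral {e..1/2} (\<lambda>u. q u *\<^sub>R \<kappa> u) = integral {e..1/2} f"
      by (rule Henstock_Kurzweil_Integration.integral_cong)
    also have "\<dots> = (LBINT u:{e<..1/2}. f u)" using integral_Ioc_eq_HK(2)[OF fsub, of e "1/2"] elim by simp
    also have "\<dots> = tail f e - tail f (1/2)" using tail_diff[OF f(2), of e "1/2"] elim by simp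
    finally show ?case by simp
  qed
  from Lim_transform_eventually[OF tendsto_add[OF Z tendsto_const] this] show ?thesis using that by blast
qed

theorem integral_limit_eq:
  obtains \<Lambda> where "((\<lambda>(a, b). LBINT t:{a<..b}. h t) \<longlongrightarrow> \<Lambda>) ends_0_infinity"
    "((\<lambda>(a, b). LBINT t:{a<..b}. f t) \<longlongrightarrow> \<Lambda>) ends_0_infinity"
proof -
  obtain T0 where T0: "(tail f \<longlongrightarrow> T0) (at_right 0)" using tail_limit_at_0 .
  note p = gamma_density_integral[OF c]
  let ?p = "gamma_density c"
  define T1 where "T1 = (\<lambda>x. if x \<le> 0 then T0 else tail f x)"
  have T1c: "continuous_on {0..} T1"
    unfolding continuous_on_def
  proof
    fix x :: real assume x: "x \<in> {0..}"
    show "(T1 \<longlongrightarrow> T1 x) (at x within {0..})"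
    proof (cases "x = 0")
      case True
      have "\<forall>\<^sub>F e in at_right 0. tail f e = T1 e"
        using eventually_at_right_less[of 0] by eventually_elim (simp add: T1_def)
      from Lim_transform_eventually[OF T0 this] show ?thesis
        unfolding True at_within_Ici_at_right by (simp add: T1_def)
    next
      case False
      with x have x0: "x > 0" by simp
      then have "(tail f \<longlongrightarrow> tail f x) (at x within {0<..})"
        using tail_continuous[OF f(2)] by (simp add: continuous_on_def)
      then have "(tail f \<longlongrightarrow> tail f x) (at x)"
        using at_within_open[of x "{0<..}"] x0 by simp
      moreover have "\<forall>\<^sub>F y in at x. tail f y = T1 y"
        using eventually_at_in_open'[of "{0<..}" x] x0 by (auto elim!: eventually_mono simp: T1_def)
      ultimately have "(T1 \<longlongrightarrow> tail f x) (at x)" by (rule Lim_transform_eventually)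
      then show ?thesis using x0 by (auto simp: T1_def intro: tendsto_within_subset)
    qed
  qed
  \<comment> \<open>The constant extension to the left of 0 makes \<open>T\<close> bounded and
    continuous on the whole line, and \<open>T (max x e)\<close> is the tail at \<open>x\<close> of
    \<open>f\<close> cut off below \<open>e\<close>.\<close>
  define T where "T = (\<lambda>x. T1 (max x 0))"
  have Tc: "continuous_on UNIV T"
    unfolding T_def by (rule continuous_on_compose2[OF T1c]) (auto intro!: continuous_intros)
  have T_pos: "T x = tail f x" if "x > 0" for x using that by (simp add: T_def T1_def)
  have T_neg: "T x = T0" if "x \<le> 0" for x using that by (simp add: T_def T1_def)
  have T_top: "(T \<longlongrightarrow> 0) at_top"
  proof (rule Lim_transform_eventually[OF tail_tendsto_0[OF f(2)]])
    show "\<forall>\<^sub>F x in at_top. tail f x = T x"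
      using eventually_gt_at_top[of 0] by eventually_elim (simp add: T_pos)
  qed
  obtain B where B: "\<And>x. norm (T x) \<le> B"
  proof -
    have "\<forall>\<^sub>F x in at_top. norm (T x) < 1" using tendstoD[OF T_top, of 1] by simp
    then obtain N where N: "\<And>x. x \<ge> N \<Longrightarrow> norm (T x) < 1" by (auto simp: eventually_at_top_linorder)
    have "bounded (T ` {0..N})"
      by (intro compact_imp_bounded compact_continuous_image continuous_on_subset[OF Tc]) auto
    then obtain C where C: "\<And>x. x \<in> {0..N} \<Longrightarrow> norm (T x) \<le> C" unfolding bounded_iff by blast
    have "norm (T x) \<le> max (norm T0) (max 1 C)" for x
    proof -
      consider "x \<le> 0" | "x \<in> {0..N}" | "x \<ge> N" by (cases "x \<le> 0"; cases "x \<ge> N") auto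
      then show ?thesis
      proof cases
        case 1 then show ?thesis by (simp add: T_neg)
      next
        case 2 then show ?thesis using C[of x] by simp
      next
        case 3 then show ?thesis using N[of x] by simp
      qed
    qed
    then show ?thesis using that by blast
  qed
  have Tm: "T \<in> borel_measurable borel" by (rule borel_measurable_continuous_onI[OF Tc])
  note [measurable] = Tm
  have Tcomp: "((\<lambda>t. T (g t)) \<longlongrightarrow> T y) G" if "(g \<longlongrightarrow> y) G" for g :: "real \<Rightarrow> real" and y G
  proof (rule isCont_tendsto_compose[OF _ that])
    show "isCont T y" using Tc by (simp add: continuous_on_eq_continuous_at)
  qed
  have ipB: "integrable lborel (\<lambda>w. ?p w * K)" for K by (rule integrable_mult_left[OF p(1)])
  have pT: "integrable lborel (\<lambda>w. ?p w *\<^sub>R T (g w))" if [measurable]: "g \<in> borel_measurable borel" for g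
  proof (rule Bochner_Integration.integrable_bound[OF ipB[of B]])
    show "(\<lambda>w. ?p w *\<^sub>R T (g w)) \<in> borel_measurable lborel" by measurable
    have "norm (?p w *\<^sub>R T (g w)) \<le> ?p w * B" for w
      using gamma_density_nonneg[OF c, of w] by (simp add: B mult_left_mono)
    then show "AE w in lborel. norm (?p w *\<^sub>R T (g w)) \<le> norm (?p w * B)"
      by (intro AE_I2) (simp add: order_trans[OF _ abs_ge_self])
  qed
  define C where "C = (\<lambda>x. LBINT w. ?p w *\<^sub>R T (x - w))"
  have hC: "(LBINT t:{a<..b}. h t) = C a - C b" if ab: "0 < a" "a < b" for a b
  proof -
    define H where "H = (\<lambda>e t. LBINT u:{e<..t}. ?p (t - u) *\<^sub>R f u)"
    have H: "set_integrable lborel {a<..b} (H e)"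
      "(LBINT t:{a<..b}. H e t) = (LBINT w. ?p w *\<^sub>R T (max (a - w) e) - ?p w *\<^sub>R T (max (b - w) e))"
      if e: "e > 0" for e
    proof -
      \<comment> \<open>The cut-off is absolutely integrable, so Fubini applies to it.\<close>
      define m where "m = (\<lambda>u. indicator {e<..} u *\<^sub>R f u)"
      have m: "integrable lborel m" using f(2)[OF e] by (simp add: m_def set_integrable_def)
      have inner: "(LBINT u. ?p (t - u) *\<^sub>R m u) = H e t" for t
        unfolding H_def set_lebesgue_integral_def m_def
        by (intro Bochner_Integration.integral_cong refl) (auto simp: indicator_def gamma_density_def)
      have "(LBINT v:{a - w<..b - w}. m v) = T (max (a - w) e) - T (max (b - w) e)" for w
      proof -
        have "(LBINT v:{a - w<..b - w}. m v) = (LBINT v:{max (a - w) e<..max (b - w) e}. f v)"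
          unfolding set_lebesgue_integral_def m_def
          by (intro Bochner_Integration.integral_cong refl) (auto simp: indicator_def)
        also have "\<dots> = tail f (max (a - w) e) - tail f (max (b - w) e)"
          using tail_diff[OF f(2), of "max (a - w) e" "max (b - w) e"] e ab by simp
        finally show ?thesis using e by (simp add: T_pos)
      qed
      then show "set_integrable lborel {a<..b} (H e)"
        "(LBINT t:{a<..b}. H e t) = (LBINT w. ?p w *\<^sub>R T (max (a - w) e) - ?p w *\<^sub>R T (max (b - w) e))"
        using convolution_integral[OF p(1) m, of a b] unfolding inner by (simp_all add: scaleR_diff_right)
    qed
    \<comment> \<open>Uniform convergence on \<open>[a,b]\<close> lets \<open>e\<close> tend to 0
      under the integral over a bounded interval.\<close>
    have lim1: "((\<lambda>e. LBINT t:{a<..b}. H e t) \<longlongrightarrow> (LBINT t:{a<..b}. h t)) (at_right 0)"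
    proof (rule tendstoI)
      fix r :: real assume r: "r > 0"
      define d where "d = (r / 2) / (b - a)"
      have "d * (b - a) = r / 2" unfolding d_def using ab by (intro nonzero_eq_divide_eq[THEN iffD1]) auto
      then have d: "d * (b - a) < r" "d > 0" using r ab by (linarith, simp add: d_def)
      have hint: "set_integrable lborel {a<..b} h"
        by (intro integral_Ioc_eq_HK continuous_on_subset[OF h]) (use ab in auto)
      have one: "set_integrable lborel {a<..b} (\<lambda>_. d)"
        using ab by (simp add: set_integrable_def integrable_real_indicator)
      have "\<forall>\<^sub>F e in at_right 0. \<forall>t\<in>{a..b}. dist (H e t) (h t) < d"
        unfolding H_def using uniform_limitD[OF lim[of a b]] ab d by simp
      then show "\<forall>\<^sub>F e in at_right 0. dist (LBINT t:{a<..b}. H e t) (LBINT t:{a<..b}. h t) < r"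
        using eventually_at_right_less[of 0]
      proof eventually_elim
        case (elim e)
        have "dist (LBINT t:{a<..b}. H e t) (LBINT t:{a<..b}. h t) = norm (LBINT t:{a<..b}. H e t - h t)"
          using H(1)[OF elim(2)] hint by (simp add: dist_norm set_integral_diff)
        also have "\<dots> \<le> (LBINT t:{a<..b}. norm (H e t - h t))"
          by (rule set_integral_norm_bound) (use H(1)[OF elim(2)] hint in \<open>rule set_integral_diff\<close>)
        also have "\<dots> \<le> (LBINT t:{a<..b}. d)"
        proof (rule set_integral_mono)
          show "set_integrable lborel {a<..b} (\<lambda>t. norm (H e t - h t))"
            by (intro set_integrable_norm set_integral_diff H(1)[OF elim(2)] hint)
          show "norm (H e t - h t) \<le> d" if "t \<in> {a<..b}" for t
            using bspec[OF elim(1), of t] that by (simp add: dist_norm)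
        qed (rule one)
        also have "\<dots> = d * (b - a)" using ab by (simp add: set_lebesgue_integral_def)
        also have "\<dots> < r" by (rule d(1))
        finally show ?case .
      qed
    qed
    have lim2: "((\<lambda>e. LBINT w. ?p w *\<^sub>R T (max (a - w) e) - ?p w *\<^sub>R T (max (b - w) e)) \<longlongrightarrow>
        (LBINT w. ?p w *\<^sub>R T (a - w) - ?p w *\<^sub>R T (b - w))) (at_right 0)"
    proof (rule dominated_convergence_within[OF _ _ ipB[of "B + B"]])
      show "(\<lambda>w. ?p w *\<^sub>R T (a - w) - ?p w *\<^sub>R T (b - w)) \<in> borel_measurable lborel" by measurable
      show "(\<lambda>w. ?p w *\<^sub>R T (max (a - w) e) - ?p w *\<^sub>R T (max (b - w) e)) \<in> borel_measurable lborel" for e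
        by measurable
      have tm: "((\<lambda>e. T (max y e)) \<longlongrightarrow> T y) (at_right 0)" for y :: real
      proof -
        have "((\<lambda>e. max y e) \<longlongrightarrow> max y 0) (at_right 0)" by (intro tendsto_intros)
        from Tcomp[OF this] show ?thesis by (simp add: T_def)
      qed
      show "AE w in lborel. ((\<lambda>e. ?p w *\<^sub>R T (max (a - w) e) - ?p w *\<^sub>R T (max (b - w) e)) \<longlongrightarrow>
          ?p w *\<^sub>R T (a - w) - ?p w *\<^sub>R T (b - w)) (at_right 0)"
        by (intro AE_I2 tendsto_intros tm)
      show "AE w in lborel. norm (?p w *\<^sub>R T (max (a - w) e) - ?p w *\<^sub>R T (max (b - w) e)) \<le> ?p w * (B + B)" for e
      proof (rule AE_I2)
        fix w
        have "norm (T (max (a - w) e) - T (max (b - w) e)) \<le> B + B"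
          by (rule order_trans[OF norm_triangle_ineq4]) (intro add_mono B)
        from mult_left_mono[OF this gamma_density_nonneg[OF c, of w]]
        show "norm (?p w *\<^sub>R T (max (a - w) e) - ?p w *\<^sub>R T (max (b - w) e)) \<le> ?p w * (B + B)"
          using gamma_density_nonneg[OF c, of w] by (simp flip: scaleR_diff_right)
      qed
    qed
    have ev: "\<forall>\<^sub>F e in at_right 0. (LBINT w. ?p w *\<^sub>R T (max (a - w) e) - ?p w *\<^sub>R T (max (b - w) e)) = (LBINT t:{a<..b}. H e t)"
      using eventually_at_right_less[of 0] by eventually_elim (simp add: H(2))
    have "(LBINT t:{a<..b}. h t) = (LBINT w. ?p w *\<^sub>R T (a - w) - ?p w *\<^sub>R T (b - w))"
      by (rule tendsto_unique[OF _ lim1 Lim_transform_eventually[OF lim2 ev]]) simp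
    also have "\<dots> = C a - C b" unfolding C_def by (rule Bochner_Integration.integral_diff) (intro pT, measurable)+
    finally show ?thesis .
  qed
  have bd: "AE w in lborel. norm (?p w *\<^sub>R T (x - w)) \<le> ?p w * B" for x
    using gamma_density_nonneg[OF c] by (intro AE_I2) (simp add: B mult_left_mono)
  have C0: "(C \<longlongrightarrow> T0) (at_right 0)"
  proof -
    have "(C \<longlongrightarrow> (LBINT w. ?p w *\<^sub>R T (0 - w))) (at_right 0)"
      unfolding C_def
    proof (rule dominated_convergence_within[OF _ _ ipB[of B]])
      show "AE w in lborel. ((\<lambda>t. ?p w *\<^sub>R T (t - w)) \<longlongrightarrow> ?p w *\<^sub>R T (0 - w)) (at_right 0)"
        by (intro AE_I2 tendsto_intros Tcomp)
    qed (use bd in measurable)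
    also have "(LBINT w. ?p w *\<^sub>R T (0 - w)) = (LBINT w. ?p w *\<^sub>R T0)"
      \<comment> \<open>The density vanishes for \<open>w \<le> 0\<close>; for \<open>w > 0\<close>
        the argument \<open>0 - w\<close> lies where \<open>T\<close> is constantly
        \<open>T0\<close>.\<close>
      by (intro Bochner_Integration.integral_cong refl) (auto simp: gamma_density_def T_neg)
    also have "\<dots> = T0" using p by simp
    finally show ?thesis .
  qed
  have Ctop: "(C \<longlongrightarrow> 0) at_top"
  proof (rule tendsto_at_topI_sequentially)
    fix X :: "nat \<Rightarrow> real" assume X: "filterlim X at_top sequentially"
    have "(\<lambda>n. C (X n)) \<longlonglongrightarrow> (LBINT (w::real). (0 :: complex))"
      unfolding C_def
    proof (rule integral_dominated_convergence[OF _ _ ipB[of B]])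
      show "AE w in lborel. (\<lambda>n. ?p w *\<^sub>R T (X n - w)) \<longlonglongrightarrow> 0"
      proof (rule AE_I2)
        fix w
        have "filterlim (\<lambda>n. X n - w) at_top sequentially"
          using filterlim_tendsto_add_at_top[OF tendsto_const X, of "- w"] by simp
        from tendsto_scaleR[OF tendsto_const filterlim_compose[OF T_top this]]
        show "(\<lambda>n. ?p w *\<^sub>R T (X n - w)) \<longlonglongrightarrow> 0" by simp
      qed
    qed (use bd in measurable)
    then show "(\<lambda>n. C (X n)) \<longlonglongrightarrow> 0" by simp
  qed
  note fl = filterlim_ends_0_infinity
  have "((\<lambda>x. C (fst x) - C (snd x)) \<longlongrightarrow> T0 - 0) ends_0_infinity"
    by (intro tendsto_diff filterlim_compose[OF C0 fl(1)] filterlim_compose[OF Ctop fl(2)])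
  moreover have "\<forall>\<^sub>F x in ends_0_infinity. C (fst x) - C (snd x) = (case x of (a, b) \<Rightarrow> LBINT t:{a<..b}. h t)"
    using eventually_ends_0_infinity by eventually_elim (simp add: case_prod_beta hC)
  ultimately have 1: "((\<lambda>(a, b). LBINT t:{a<..b}. h t) \<longlongrightarrow> T0 - 0) ends_0_infinity"
    by (rule Lim_transform_eventually)
  have "((\<lambda>x. tail f (fst x) - tail f (snd x)) \<longlongrightarrow> T0 - 0) ends_0_infinity"
    by (intro tendsto_diff filterlim_compose[OF T0 fl(1)] filterlim_compose[OF tail_tendsto_0[OF f(2)] fl(2)])
  moreover have "\<forall>\<^sub>F x in ends_0_infinity. tail f (fst x) - tail f (snd x) = (case x of (a, b) \<Rightarrow> LBINT t:{a<..b}. f t)"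
    using eventually_ends_0_infinity by eventually_elim (simp add: case_prod_beta tail_diff[OF f(2)])
  ultimately have 2: "((\<lambda>(a, b). LBINT t:{a<..b}. f t) \<longlongrightarrow> T0 - 0) ends_0_infinity"
    by (rule Lim_transform_eventually)
  show ?thesis by (rule that[OF 1 2])
qed

end

section \<open>The clocks\<close>

lemma tail_clock:
  fixes \<rho> :: "real \<Rightarrow> real"
  assumes int: "\<And>c. c > 0 \<Longrightarrow> set_integrable lborel {c<..} \<rho>" and nn: "\<And>u. u > 0 \<Longrightarrow> \<rho> u \<ge> 0" and a: "0 < a"
  shows "continuous_on {a..b} (tail \<rho>)" "antimono_on {a..b} (tail \<rho>)" "x > 0 \<Longrightarrow> tail \<rho> x \<ge> 0"
proof -
  show "continuous_on {a..b} (tail \<rho>)"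
    using a by (intro continuous_on_subset[OF tail_continuous[OF int]]) auto
  have nonneg: "(LBINT u:A. \<rho> u) \<ge> 0" if "A \<subseteq> {0<..}" for A
    unfolding set_lebesgue_integral_def
    using that nn by (intro Bochner_Integration.integral_nonneg) (auto simp: indicator_def)
  show "x > 0 \<Longrightarrow> tail \<rho> x \<ge> 0" unfolding tail_def by (intro nonneg) auto
  show "antimono_on {a..b} (tail \<rho>)"
  proof (rule monotone_onI)
    fix x y assume "x \<in> {a..b}" "y \<in> {a..b}" "x \<le> y"
    moreover have "(LBINT u:{x<..y}. \<rho> u) \<ge> 0" using \<open>x \<in> {a..b}\<close> a by (intro nonneg) auto
    ultimately show "tail \<rho> y \<le> tail \<rho> x" using tail_diff[OF int, of x y] a by simp
  qed
qed

text \<open>The functional \<open>u * l\<close> has the exponent \<open>g (u * v)\<close> in the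
  variable \<open>v\<close>, so one exponent describes the law of the integral along the whole
  ray.\<close>

lemma random_integral_map_tail_clock:
  fixes Y :: "'e measure \<Rightarrow> real \<Rightarrow> 'w \<Rightarrow> 'e::{banach, second_countable_topology}"
  assumes Y: "levy_process (\<Omega> \<nu>) (Y \<nu>)" and l: "bounded_linear l"
    and gc: "continuous_on {0..} g"
    and g: "\<And>u t. u \<ge> 0 \<Longrightarrow> t \<ge> 0 \<Longrightarrow>
      cf (distr (\<Omega> \<nu>) borel (Y \<nu> t)) (\<lambda>x. u * l x) = exp (complex_of_real t * g u)"
    and int: "\<And>c. c > 0 \<Longrightarrow> set_integrable lborel {c<..} \<rho>" and nn: "\<And>u. u > 0 \<Longrightarrow> \<rho> u \<ge> 0"
    and ab: "0 < a" "a < b"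
  shows "prob_space (random_integral_map \<Omega> Y (\<lambda>t. t) (tail \<rho>) a b \<nu>)"
    and "sets (random_integral_map \<Omega> Y (\<lambda>t. t) (tail \<rho>) a b \<nu>) = sets borel"
    and "u \<ge> 0 \<Longrightarrow> cf (random_integral_map \<Omega> Y (\<lambda>t. t) (tail \<rho>) a b \<nu>) (\<lambda>x. u * l x) =
      exp (LBINT t:{a<..b}. \<rho> t *\<^sub>R g (u * t))"
proof -
  interpret prob_space "\<Omega> \<nu>" by (rule levy_processD[OF Y])
  have *: "random_integral (\<lambda>t. t) (tail \<rho>) a b (Y \<nu>) \<in> borel_measurable (\<Omega> \<nu>) \<and>
     cf (distr (\<Omega> \<nu>) borel (random_integral (\<lambda>t. t) (tail \<rho>) a b (Y \<nu>))) (\<lambda>x. u * l x) =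
      exp (LBINT t:{a<..b}. \<rho> t *\<^sub>R g (u * t))" if u: "u \<ge> 0" for u
  proof -
    have cu: "continuous_on {0..} (\<lambda>v. g (u * v))"
      by (rule continuous_on_compose2[OF gc]) (use u in \<open>auto intro!: continuous_intros\<close>)
    have gu: "cf (distr (\<Omega> \<nu>) borel (Y \<nu> t)) (\<lambda>x. v * (u * l x)) = exp (complex_of_real t * g (u * v))"
      if "v \<ge> 0" "t \<ge> 0" for v t
      using g[of "u * v" t] that u by (simp add: mult_ac)
    have si: "set_integrable lborel {a<..b} \<rho>" by (rule set_integrable_Ioc[OF int ab(1)])
    have df: "tail \<rho> x - tail \<rho> y = (LBINT t:{x<..y}. \<rho> t)" if "a \<le> x" "x \<le> y" "y \<le> b" for x y
      by (rule tail_diff[OF int]) (use that ab in auto)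
    have r: "continuous_on {a..b} (tail \<rho>)" "antimono_on {a..b} (tail \<rho>)" "tail \<rho> b \<ge> 0"
      using tail_clock[OF int nn ab(1)] ab by auto
    show ?thesis
      using cf_random_integral[OF Y bounded_linear_const_mult[OF l] less_imp_le[OF ab(1)] ab(2) cu gu r si df] by blast
  qed
  from *[of 0] show "prob_space (random_integral_map \<Omega> Y (\<lambda>t. t) (tail \<rho>) a b \<nu>)"
    unfolding random_integral_map_def by (intro prob_space_distr) simp
  show "sets (random_integral_map \<Omega> Y (\<lambda>t. t) (tail \<rho>) a b \<nu>) = sets borel"
    by (simp add: random_integral_map_def)
  show "u \<ge> 0 \<Longrightarrow> cf (random_integral_map \<Omega> Y (\<lambda>t. t) (tail \<rho>) a b \<nu>) (\<lambda>x. u * l x) =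
      exp (LBINT t:{a<..b}. \<rho> t *\<^sub>R g (u * t))"
    using * by (simp add: random_integral_map_def)
qed

text \<open>One half of the exponential absorbs the power and the quadratic growth, the other half
  is the integrable majorant.\<close>

lemma set_integrable_powr_exp:
  fixes g :: "real \<Rightarrow> 'b::euclidean_space"
  assumes g: "continuous_on {0..} g" "\<And>u. u \<ge> 0 \<Longrightarrow> norm (g u) \<le> C * (1 + u\<^sup>2)" and c: "c > 0"
  shows "set_integrable lborel {c<..} (\<lambda>u. (u powr s * exp (- u)) *\<^sub>R g u)"
proof -
  \<comment> \<open>Continuous on compact intervals in \<open>(0,\<infinity>)\<close> and vanishing
    at infinity, hence bounded above on the half-line from \<open>c\<close>.\<close>
  define w where "w = (\<lambda>u::real. u powr s * exp (- u / 2) * (1 + u\<^sup>2))"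
  have wlim: "(w \<longlongrightarrow> 0) at_top" unfolding w_def by real_asymp
  have "\<forall>\<^sub>F u in at_top. \<bar>w u\<bar> < 1" using tendstoD[OF wlim, of 1] by simp
  then obtain N where N: "\<And>u. u \<ge> N \<Longrightarrow> \<bar>w u\<bar> < 1" by (auto simp: eventually_at_top_linorder)
  have "continuous_on {c..N} w" unfolding w_def by (intro continuous_intros) (use c in auto)
  then have "bounded (w ` {c..N})" by (intro compact_imp_bounded compact_continuous_image) auto
  then obtain D where D: "\<And>u. u \<in> {c..N} \<Longrightarrow> norm (w u) \<le> D" unfolding bounded_iff by blast
  define B where "B = max 1 D"
  have B: "w u \<le> B" if "u \<ge> c" for u
  proof (cases "u \<ge> N")
    case True
    then show ?thesis using N[of u] by (simp add: B_def)
  next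
    case False
    then show ?thesis using D[of u] that by (simp add: B_def)
  qed
  have C: "C \<ge> 0" using order_trans[OF norm_ge_zero g(2)[of 0]] by simp
  \<comment> \<open>For \<open>u > 0\<close> this is \<open>exp (- u / 2)\<close>, the remaining
    half of the exponential.\<close>
  have e: "integrable lborel (\<lambda>u. gamma_density 1 (u / 2))"
    using lborel_integrable_real_affine[OF gamma_density_integral(1)[of 1], of "1/2" 0] by simp
  show ?thesis
    unfolding set_integrable_def
  proof (rule Bochner_Integration.integrable_bound)
    show "integrable lborel (\<lambda>u. (C * B) * gamma_density 1 (u / 2))" by (rule integrable_mult_right[OF e])
    have "continuous_on {c<..} (\<lambda>u. (u powr s * exp (- u)) *\<^sub>R g u)"
      by (intro continuous_intros continuous_on_subset[OF g(1)]) (use c in auto)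
    then show "(\<lambda>u. indicator {c<..} u *\<^sub>R ((u powr s * exp (- u)) *\<^sub>R g u)) \<in> borel_measurable lborel"
      using borel_measurable_continuous_on_indicator[of "{c<..}"] by (simp del: scaleR_scaleR)
    show "AE u in lborel. norm (indicator {c<..} u *\<^sub>R ((u powr s * exp (- u)) *\<^sub>R g u))
        \<le> norm ((C * B) * gamma_density 1 (u / 2))"
    proof (rule AE_I2)
      fix u
      show "norm (indicator {c<..} u *\<^sub>R ((u powr s * exp (- u)) *\<^sub>R g u)) \<le> norm ((C * B) * gamma_density 1 (u / 2))"
      proof (cases "u > c")
        case True
        have ex: "exp (- u) = exp (- u / 2) * exp (- (u / 2))" by (simp flip: exp_add)
        have "norm ((u powr s * exp (- u)) *\<^sub>R g u) = u powr s * exp (- u) * norm (g u)" by simp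
        also have "\<dots> \<le> u powr s * exp (- u) * (C * (1 + u\<^sup>2))"
          using g(2)[of u] True c by (intro mult_left_mono) auto
        also have "\<dots> = C * w u * exp (- (u / 2))" unfolding ex w_def by simp
        also have "\<dots> \<le> C * B * exp (- (u / 2))"
          using B[of u] True C by (intro mult_right_mono mult_left_mono) auto
        also have "\<dots> = (C * B) * gamma_density 1 (u / 2)" using True c by (simp add: gamma_density_def)
        finally show ?thesis using True by simp
      qed simp
    qed
  qed
qed

section \<open>Densities of the two clocks and their convolution identity\<close>

definition gamma_clock_density :: "real \<Rightarrow> real \<Rightarrow> real" where
  "gamma_clock_density \<alpha> u = u powr (- \<alpha> - 1) * exp (- u)"

lemma gamma_clock_tail: "gamma_clock \<alpha> = tail (gamma_clock_density \<alpha>)"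
  by (simp add: fun_eq_iff gamma_clock_def tail_def gamma_clock_density_def)

lemma gamma_clock_density_integrable: "c > 0 \<Longrightarrow> set_integrable lborel {c<..} (gamma_clock_density \<alpha>)"
  using set_integrable_powr_exp[of "\<lambda>_. 1 :: real" 1 c "- \<alpha> - 1"]
  by (simp add: gamma_clock_density_def[abs_def])

text \<open>The factor \<open>exp (1 - s)\<close> cancels the one in \<^const>\<open>gamma_density\<close>.\<close>

definition beta_clock_density :: "real \<Rightarrow> real \<Rightarrow> real \<Rightarrow> real" where
  "beta_clock_density \<alpha> \<beta> s = gamma_density (\<alpha> - \<beta>) (1 - s) * (exp (1 - s) * s powr (- \<alpha> - 1))"

text \<open>The density vanishes from 1 on, so the integral over \<open>(s,1)\<close> is a tail over
  a half-line and the lemmas on tails apply.\<close>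

lemma beta_clock_tail: "beta_clock \<alpha> \<beta> = tail (beta_clock_density \<alpha> \<beta>)"
proof
  fix s
  have "beta_clock \<alpha> \<beta> s = (LBINT u:{s<..<1}. inverse (Gamma (\<alpha> - \<beta>)) * ((1 - u) powr (\<alpha> - \<beta> - 1) * u powr (- \<alpha> - 1)))"
    by (simp add: beta_clock_def)
  also have "\<dots> = tail (beta_clock_density \<alpha> \<beta>) s"
    unfolding tail_def set_lebesgue_integral_def
  proof (intro Bochner_Integration.integral_cong refl)
    fix u
    show "indicator {s<..<1} u *\<^sub>R (inverse (Gamma (\<alpha> - \<beta>)) * ((1 - u) powr (\<alpha> - \<beta> - 1) * u powr (- \<alpha> - 1))) =
      indicator {s<..} u *\<^sub>R beta_clock_density \<alpha> \<beta> u"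
    proof (cases "u < 1")
      case True
      have "exp (- (1 - u)) * exp (1 - u) = 1" by (simp flip: exp_add)
      then have "gamma_density (\<alpha> - \<beta>) (1 - u) * exp (1 - u) = inverse (Gamma (\<alpha> - \<beta>)) * (1 - u) powr (\<alpha> - \<beta> - 1)"
        using True by (simp add: gamma_density_def divide_inverse mult_ac)
      then have "beta_clock_density \<alpha> \<beta> u = inverse (Gamma (\<alpha> - \<beta>)) * ((1 - u) powr (\<alpha> - \<beta> - 1) * u powr (- \<alpha> - 1))"
        by (simp add: beta_clock_density_def flip: mult.assoc)
      then show ?thesis using True by (simp add: indicator_def)
    qed (simp add: beta_clock_density_def gamma_density_def)
  qed
  finally show "beta_clock \<alpha> \<beta> s = tail (beta_clock_density \<alpha> \<beta>) s" .
qed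

lemma beta_clock_density_nonneg: "\<beta> < \<alpha> \<Longrightarrow> beta_clock_density \<alpha> \<beta> s \<ge> 0"
  by (simp add: beta_clock_density_def gamma_density_nonneg)

lemma set_integrable_beta_clock_density:
  fixes g :: "real \<Rightarrow> 'b::euclidean_space"
  assumes ab: "\<beta> < \<alpha>" and g: "continuous_on {0..} g" and c: "c > 0" and t: "t \<ge> 0"
  shows "set_integrable lborel {c<..} (\<lambda>s. beta_clock_density \<alpha> \<beta> s *\<^sub>R g (t * s))"
proof -
  have "continuous_on {c..1} (\<lambda>s. (exp (1 - s) * s powr (- \<alpha> - 1)) *\<^sub>R g (t * s))"
    by (intro continuous_intros continuous_on_compose2[OF g]) (use c t in auto)
  from set_integrable_scaleR_continuous[OF set_integrable_gamma_density_shift this, of "\<alpha> - \<beta>" 1] ab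
  have "set_integrable lborel {c<..1} (\<lambda>s. beta_clock_density \<alpha> \<beta> s *\<^sub>R g (t * s))"
    by (simp add: beta_clock_density_def)
  moreover have "indicator {c<..1} s *\<^sub>R (beta_clock_density \<alpha> \<beta> s *\<^sub>R g (t * s)) =
      indicator {c<..} s *\<^sub>R (beta_clock_density \<alpha> \<beta> s *\<^sub>R g (t * s))" for s
    by (simp add: indicator_def beta_clock_density_def gamma_density_def)
  ultimately show ?thesis unfolding set_integrable_def by (simp only:)
qed

lemma beta_clock_density_integrable:
  "\<beta> < \<alpha> \<Longrightarrow> c > 0 \<Longrightarrow> set_integrable lborel {c<..} (beta_clock_density \<alpha> \<beta>)"
  using set_integrable_beta_clock_density[of \<beta> \<alpha> "\<lambda>_. 1 :: real" c 0] by simp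

text \<open>Substitution \<open>u = t * s\<close>. The powers of \<open>t\<close> combine to
  \<open>(\<alpha> - \<beta> - 1) + (- \<alpha> - 1) + 1 = - \<beta> - 1\<close>, and the
  exponentials of \<open>t - u\<close> and \<open>u\<close> multiply to \<open>exp (- t)\<close>,
  which no longer involves \<open>s\<close>.\<close>

lemma beta_clock_convolution:
  fixes g :: "real \<Rightarrow> 'b::euclidean_space"
  assumes t: "t > 0" and e: "0 \<le> e"
  shows "(LBINT u:{e<..t}. gamma_density (\<alpha> - \<beta>) (t - u) *\<^sub>R (gamma_clock_density \<alpha> u *\<^sub>R g u)) =
    gamma_clock_density \<beta> t *\<^sub>R (LBINT s:{e / t<..1}. beta_clock_density \<alpha> \<beta> s *\<^sub>R g (t * s))"
proof -
  have key: "t * (gamma_density (\<alpha> - \<beta>) (t - t * s) * gamma_clock_density \<alpha> (t * s)) =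
      gamma_clock_density \<beta> t * beta_clock_density \<alpha> \<beta> s" if s: "s > 0" for s
  proof (cases "s < 1")
    case True
    let ?c = "\<alpha> - \<beta>"
    have p: "t - t * s = t * (1 - s)" "t - t * s > 0" using t True by (simp_all add: algebra_simps)
    have e1: "exp (- (t * (1 - s))) * exp (- (t * s)) = exp (- t)" by (simp flip: exp_add add: algebra_simps)
    have e2: "exp (- (1 - s)) * exp (1 - s) = 1" by (simp flip: exp_add)
    have "t * (t powr (?c - 1) * t powr (- \<alpha> - 1)) = t powr 1 * (t powr (?c - 1) * t powr (- \<alpha> - 1))" using t by simp
    also have "\<dots> = t powr (- \<beta> - 1)" unfolding powr_add[symmetric] by (rule arg_cong[where f = "(powr) t"]) simp
    finally have tp: "t * (t powr (?c - 1) * t powr (- \<alpha> - 1)) = t powr (- \<beta> - 1)" .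
    have "t * (gamma_density ?c (t - t * s) * gamma_clock_density \<alpha> (t * s)) =
        (t * (t powr (?c - 1) * t powr (- \<alpha> - 1))) * ((1 - s) powr (?c - 1) * s powr (- \<alpha> - 1)) / Gamma ?c
          * (exp (- (t * (1 - s))) * exp (- (t * s)))"
      using p t s True by (simp add: gamma_density_def gamma_clock_density_def powr_mult mult_ac)
    also have "\<dots> = t powr (- \<beta> - 1) * exp (- t) * ((1 - s) powr (?c - 1) * s powr (- \<alpha> - 1)) / Gamma ?c
          * (exp (- (1 - s)) * exp (1 - s))"
      unfolding tp e1 e2 by simp
    also have "\<dots> = gamma_clock_density \<beta> t * beta_clock_density \<alpha> \<beta> s"
      using True by (simp add: gamma_clock_density_def beta_clock_density_def gamma_density_def mult_ac)
    finally show ?thesis .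
  next
    case False
    then have "t - t * s \<le> 0" using t by simp
    then show ?thesis using False by (simp add: gamma_density_def beta_clock_density_def)
  qed
  let ?F = "\<lambda>u. gamma_density (\<alpha> - \<beta>) (t - u) *\<^sub>R (gamma_clock_density \<alpha> u *\<^sub>R g u)"
  let ?H = "\<lambda>s. beta_clock_density \<alpha> \<beta> s *\<^sub>R g (t * s)"
  have "(LBINT u:{e<..t}. ?F u) = t *\<^sub>R (LBINT s. indicator {e<..t} (t * s) *\<^sub>R ?F (t * s))"
    unfolding set_lebesgue_integral_def
    using lborel_integral_real_affine[of t "\<lambda>u. indicator {e<..t} u *\<^sub>R ?F u" 0] t by simp
  also have "\<dots> = (LBINT s. t *\<^sub>R (indicator {e<..t} (t * s) *\<^sub>R ?F (t * s)))"
    by (rule integral_scaleR_right[symmetric])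
  also have "\<dots> = (LBINT s. gamma_clock_density \<beta> t *\<^sub>R (indicator {e / t<..1} s *\<^sub>R ?H s))"
  proof (intro Bochner_Integration.integral_cong refl)
    fix s
    have ind: "indicator {e<..t} (t * s) = (indicator {e / t<..1} s :: real)"
      using t by (simp add: indicator_def pos_divide_less_eq mult.commute)
    show "t *\<^sub>R (indicator {e<..t} (t * s) *\<^sub>R ?F (t * s)) =
        gamma_clock_density \<beta> t *\<^sub>R (indicator {e / t<..1} s *\<^sub>R ?H s)"
    proof (cases "s \<in> {e / t<..1}")
      case True
      then have "s > 0" using e t by (auto intro: order_le_less_trans[OF divide_nonneg_pos])
      from key[OF this] show ?thesis using True unfolding ind by simp
    qed (simp add: ind)
  qed
  also have "\<dots> = gamma_clock_density \<beta> t *\<^sub>R (LBINT s:{e / t<..1}. ?H s)"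
    unfolding set_lebesgue_integral_def by (rule integral_scaleR_right)
  finally show ?thesis .
qed

text \<open>Translates the two-sided limit over \<open>(a',b']\<close> into the one-sided cut-off of
  the convolution. The upper endpoint has to be moved to 1 first, and the lower endpoint becomes
  \<open>e / t\<close>.\<close>

lemma beta_clock_uniform_limit:
  fixes g G :: "real \<Rightarrow> complex"
  assumes \<alpha>\<beta>: "\<beta> < \<alpha>" and g: "continuous_on {0..} g" and ab: "0 < a" "a \<le> b"
    and lim: "uniform_limit {0..b} (\<lambda>(a', b') t. LBINT s:{a'<..b'}. beta_clock_density \<alpha> \<beta> s *\<^sub>R g (t * s)) G ends_0_1"
  shows "uniform_limit {a..b} (\<lambda>e t. LBINT u:{e<..t}. gamma_density (\<alpha> - \<beta>) (t - u) *\<^sub>R (gamma_clock_density \<alpha> u *\<^sub>R g u))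
    (\<lambda>t. gamma_clock_density \<beta> t *\<^sub>R G t) (at_right 0)"
proof (rule uniform_limitI)
  fix r :: real assume r: "r > 0"
  have "bounded (gamma_clock_density \<beta> ` {a..b})"
    unfolding gamma_clock_density_def[abs_def]
    by (intro compact_imp_bounded compact_continuous_image continuous_intros) (use ab in auto)
  then obtain W0 where W0: "\<And>t. t \<in> {a..b} \<Longrightarrow> norm (gamma_clock_density \<beta> t) \<le> W0" unfolding bounded_iff by blast
  define W where "W = max 1 W0"
  have W: "W > 0" "\<And>t. t \<in> {a..b} \<Longrightarrow> \<bar>gamma_clock_density \<beta> t\<bar> \<le> W"
    using W0 by (auto simp: W_def intro: order_trans[OF _ max.cobounded2])
  define d where "d = r / (2 * W)"
  have d: "d > 0" "W * d < r" using r W by (auto simp: d_def)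
  define J where "J = (\<lambda>a' b' t. LBINT s:{a'<..b'}. beta_clock_density \<alpha> \<beta> s *\<^sub>R g (t * s))"
  have "\<forall>\<^sub>F x in ends_0_1. \<forall>t\<in>{0..b}. dist (J (fst x) (snd x) t) (G t) < d"
    using uniform_limitD[OF lim d(1)] by (simp add: J_def case_prod_beta)
  then obtain P Q where P: "eventually P (at_right 0)" and Q: "eventually Q (at_left (1::real))"
    and PQ: "\<And>a' b' t. P a' \<Longrightarrow> Q b' \<Longrightarrow> t \<in> {0..b} \<Longrightarrow> dist (J a' b' t) (G t) < d"
    unfolding eventually_prod_filter by fastforce
  \<comment> \<open>Letting \<open>b'\<close> tend to 1 uses continuity of the tail at 1. The strict
    bound becomes \<open>\<le> d\<close>, which is harmless because \<open>W * d\<close> is strictly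
    below \<open>r\<close>.\<close>
  have J1: "dist (J a' 1 t) (G t) \<le> d" if a': "P a'" "0 < a'" "a' < 1" and t: "t \<in> {0..b}" for a' t
  proof -
    let ?f = "\<lambda>s. beta_clock_density \<alpha> \<beta> s *\<^sub>R g (t * s)"
    have int: "set_integrable lborel {c<..} ?f" if "c > 0" for c
      by (rule set_integrable_beta_clock_density[OF \<alpha>\<beta> g that]) (use t in simp)
    have Jt: "J a' b' t = tail ?f a' - tail ?f b'" if "a' \<le> b'" for b'
      unfolding J_def using tail_diff[of ?f, OF int a'(2) that] by simp
    have "(tail ?f \<longlongrightarrow> tail ?f 1) (at 1 within {0<..})"
      using tail_continuous[of ?f, OF int] by (simp add: continuous_on_def)
    then have "(tail ?f \<longlongrightarrow> tail ?f 1) (at 1)" using at_within_open[of 1 "{0::real<..}"] by simp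
    then have "(tail ?f \<longlongrightarrow> tail ?f 1) (at_left 1)" by (rule tendsto_within_subset) simp
    then have "((\<lambda>b'. tail ?f a' - tail ?f b') \<longlongrightarrow> J a' 1 t) (at_left 1)"
      unfolding Jt[OF less_imp_le[OF a'(3)]] by (intro tendsto_intros)
    moreover have "\<forall>\<^sub>F b' in at_left 1. tail ?f a' - tail ?f b' = J a' b' t"
      using eventually_at_left_real[OF a'(3)] by eventually_elim (simp add: Jt)
    ultimately have "((\<lambda>b'. J a' b' t) \<longlongrightarrow> J a' 1 t) (at_left 1)" by (rule Lim_transform_eventually)
    from tendsto_dist[OF this tendsto_const[of "G t"]]
    have lim: "((\<lambda>b'. dist (J a' b' t) (G t)) \<longlongrightarrow> dist (J a' 1 t) (G t)) (at_left 1)" .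
    have ev: "\<forall>\<^sub>F b' in at_left 1. dist (J a' b' t) (G t) \<le> d"
      using Q by eventually_elim (use PQ[OF a'(1) _ t] in \<open>simp add: less_imp_le\<close>)
    show ?thesis by (rule tendsto_upperbound[OF lim ev]) simp
  qed
  obtain \<delta> where \<delta>: "\<delta> > 0" "\<And>x. 0 < x \<Longrightarrow> x < \<delta> \<Longrightarrow> P x"
    using P unfolding eventually_at_right_field by auto
  define m where "m = min \<delta> 1"
  have m: "m > 0" "m \<le> \<delta>" "m \<le> 1" using \<delta> by (auto simp: m_def)
  \<comment> \<open>The bound \<open>m * a\<close> puts the endpoint \<open>e / t\<close> below
    \<open>m\<close> for all \<open>t \<ge> a\<close> at once, which gives uniformity in
    \<open>t\<close>.\<close>
  have "\<forall>\<^sub>F e in at_right 0. e \<in> {0<..<m * a}" by (rule eventually_at_right_real) (use m ab in simp)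
  then show "\<forall>\<^sub>F e in at_right 0. \<forall>t\<in>{a..b}.
      dist (LBINT u:{e<..t}. gamma_density (\<alpha> - \<beta>) (t - u) *\<^sub>R (gamma_clock_density \<alpha> u *\<^sub>R g u))
       (gamma_clock_density \<beta> t *\<^sub>R G t) < r"
  proof eventually_elim
    case (elim e)
    show ?case
    proof
      fix t assume t: "t \<in> {a..b}"
      have t0: "t > 0" using t ab by simp
      have e0: "0 \<le> e" using elim by simp
      have "m * a \<le> m * t" using t m by (intro mult_left_mono) auto
      then have "e < m * t" using elim by simp
      then have et: "0 < e / t" "e / t < m" using elim t0 by (simp_all add: pos_divide_less_eq)
      have near: "dist (J (e / t) 1 t) (G t) \<le> d"
      proof (rule J1)
        show "P (e / t)" using et m by (intro \<delta>(2)) linarith+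
        show "e / t < 1" using et m by linarith
        show "t \<in> {0..b}" using t ab by simp
      qed (rule et(1))
      have "dist (LBINT u:{e<..t}. gamma_density (\<alpha> - \<beta>) (t - u) *\<^sub>R (gamma_clock_density \<alpha> u *\<^sub>R g u))
          (gamma_clock_density \<beta> t *\<^sub>R G t) = \<bar>gamma_clock_density \<beta> t\<bar> * dist (J (e / t) 1 t) (G t)"
        unfolding beta_clock_convolution[OF t0 e0] J_def by (simp add: dist_norm flip: scaleR_diff_right)
      also have "\<dots> \<le> W * d" using W(1) W(2)[OF t] near by (intro mult_mono) auto
      also have "\<dots> < r" by (rule d(2))
      finally show "dist (LBINT u:{e<..t}. gamma_density (\<alpha> - \<beta>) (t - u) *\<^sub>R (gamma_clock_density \<alpha> u *\<^sub>R g u))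
          (gamma_clock_density \<beta> t *\<^sub>R G t) < r" .
    qed
  qed
qed

text \<open>Supplies the continuity in the ray parameter that \<open>weak_limit_log_uniform\<close>
  demands of the approximating exponents.\<close>

lemma continuous_integral_along_ray:
  fixes g :: "real \<Rightarrow> complex"
  assumes g: "continuous_on {0..} g" and \<rho>: "set_integrable lborel {a<..b} \<rho>" and a: "0 \<le> a" "a \<le> b" and T: "T \<ge> 0"
  shows "continuous_on {0..T} (\<lambda>t. LBINT s:{a<..b}. \<rho> s *\<^sub>R g (t * s))"
  unfolding continuous_on_def set_lebesgue_integral_def
proof
  fix t0 assume t0: "t0 \<in> {0..T}"
  have "bounded (g ` {0..T * b})"
    by (intro compact_imp_bounded compact_continuous_image continuous_on_subset[OF g]) auto
  then obtain B where B: "\<And>u. u \<in> {0..T * b} \<Longrightarrow> norm (g u) \<le> B" unfolding bounded_iff by blast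
  have gt: "continuous_on {a..b} (\<lambda>s. g (t * s))" if "t \<ge> 0" for t
    by (rule continuous_on_compose2[OF g]) (use that a in \<open>auto intro!: continuous_intros\<close>)
  have meas: "(\<lambda>s. indicator {a<..b} s *\<^sub>R \<rho> s *\<^sub>R g (t * s)) \<in> borel_measurable lborel" if "t \<in> {0..T}" for t
    using set_integrable_scaleR_continuous[OF \<rho> gt[of t]] that unfolding set_integrable_def by (simp del: scaleR_scaleR)
  show "((\<lambda>t. LBINT s. indicator {a<..b} s *\<^sub>R \<rho> s *\<^sub>R g (t * s)) \<longlongrightarrow>
      (LBINT s. indicator {a<..b} s *\<^sub>R \<rho> s *\<^sub>R g (t0 * s))) (at t0 within {0..T})"
  proof (rule dominated_convergence_within[OF meas[OF t0] meas])
    show "integrable lborel (\<lambda>s. norm (indicator {a<..b} s *\<^sub>R \<rho> s) * B)"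
      using \<rho> unfolding set_integrable_def by (intro integrable_mult_left integrable_norm)
    show "AE s in lborel. ((\<lambda>t. indicator {a<..b} s *\<^sub>R \<rho> s *\<^sub>R g (t * s)) \<longlongrightarrow>
        indicator {a<..b} s *\<^sub>R \<rho> s *\<^sub>R g (t0 * s)) (at t0 within {0..T})"
    proof (rule AE_I2)
      fix s
      show "((\<lambda>t. indicator {a<..b} s *\<^sub>R \<rho> s *\<^sub>R g (t * s)) \<longlongrightarrow>
        indicator {a<..b} s *\<^sub>R \<rho> s *\<^sub>R g (t0 * s)) (at t0 within {0..T})"
      proof (cases "s \<in> {a<..b}")
        case True
        have "continuous_on {0..T} (\<lambda>t. g (t * s))"
          by (rule continuous_on_compose2[OF g]) (use True a in \<open>auto intro!: continuous_intros\<close>)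
        then show ?thesis using t0 unfolding continuous_on_def by (intro tendsto_intros) blast
      qed simp
    qed
    show "AE s in lborel. norm (indicator {a<..b} s *\<^sub>R \<rho> s *\<^sub>R g (t * s)) \<le> norm (indicator {a<..b} s *\<^sub>R \<rho> s) * B"
      if t: "t \<in> {0..T}" for t
    proof (rule AE_I2)
      fix s
      show "norm (indicator {a<..b} s *\<^sub>R \<rho> s *\<^sub>R g (t * s)) \<le> norm (indicator {a<..b} s *\<^sub>R \<rho> s) * B"
      proof (cases "s \<in> {a<..b}")
        case True
        have "norm (g (t * s)) \<le> B" by (rule B) (use True t a in \<open>auto intro: mult_mono\<close>)
        then show ?thesis using True by (simp add: mult_left_mono)
      qed simp
    qed
  qed
qed

lemma eventually_ends_0_1: "\<forall>\<^sub>F x in ends_0_1. 0 < fst x \<and> fst x < snd x"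
proof -
  have "\<forall>\<^sub>F x in ends_0_1. fst x \<in> {0<..<1/2} \<and> snd x \<in> {1/2<..<1}"
    unfolding eventually_prod_filter
    by (rule exI[of _ "\<lambda>a. a \<in> {0<..<1/2::real}"], rule exI[of _ "\<lambda>b. b \<in> {1/2<..<1::real}"])
      (use eventually_at_right_real[of 0 "1/2"] eventually_at_left_real[of "1/2" 1] in simp)
  then show ?thesis by eventually_elim auto
qed

text \<open>Used for both sides of the identity: for \<open>\<nu>\<close> with
  \<open>\<alpha>\<close>, and for the image of the inner mapping with \<open>\<beta>\<close>. Equal
  limits of the exponent integrals then give equal characteristic functionals.\<close>

lemma weak_limit_gamma_clock_cf:
  fixes Y :: "'e measure \<Rightarrow> real \<Rightarrow> 'w \<Rightarrow> 'e::{banach, second_countable_topology}"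
  assumes Y: "levy_process (\<Omega> \<nu>) (Y \<nu>)" and l: "bounded_linear l" and gc: "continuous_on {0..} g"
    and g: "\<And>u t. u \<ge> 0 \<Longrightarrow> t \<ge> 0 \<Longrightarrow>
      cf (distr (\<Omega> \<nu>) borel (Y \<nu> t)) (\<lambda>x. u * l x) = exp (complex_of_real t * g u)"
    and wl: "weak_limit (\<lambda>(a, b). random_integral_map \<Omega> Y (\<lambda>t. t) (gamma_clock \<alpha>) a b \<nu>) \<sigma> ends_0_infinity"
    and lim: "((\<lambda>(a, b). LBINT t:{a<..b}. gamma_clock_density \<alpha> t *\<^sub>R g t) \<longlongrightarrow> \<Lambda>) ends_0_infinity"
  shows "cf \<sigma> l = exp \<Lambda>"
proof -
  let ?N = "\<lambda>(a, b). random_integral_map \<Omega> Y (\<lambda>t. t) (gamma_clock \<alpha>) a b \<nu>"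
  have nn: "gamma_clock_density \<alpha> u \<ge> 0" for u by (simp add: gamma_clock_density_def)
  note map = random_integral_map_tail_clock[where \<Omega> = \<Omega> and \<nu> = \<nu> and Y = Y and g = g and l = l
      and \<rho> = "gamma_clock_density \<alpha>", OF Y l gc g gamma_clock_density_integrable nn]
  have N: "\<forall>\<^sub>F x in ends_0_infinity. prob_space (?N x) \<and> sets (?N x) = sets borel"
    using eventually_ends_0_infinity
    by eventually_elim (simp add: case_prod_beta gamma_clock_tail map nn)
  have "((\<lambda>x. cf (?N x) l) \<longlongrightarrow> cf \<sigma> l) ends_0_infinity" by (rule weak_limit_cf[OF wl l N])
  moreover have "\<forall>\<^sub>F x in ends_0_infinity. exp (case x of (a, b) \<Rightarrow> LBINT t:{a<..b}. gamma_clock_density \<alpha> t *\<^sub>R g t) = cf (?N x) l"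
    using eventually_ends_0_infinity
  proof eventually_elim
    case (elim x)
    then show ?case using map(3)[of "fst x" "snd x" 1] nn by (simp add: case_prod_beta gamma_clock_tail)
  qed
  with tendsto_exp[OF lim] have "((\<lambda>x. cf (?N x) l) \<longlongrightarrow> exp \<Lambda>) ends_0_infinity"
    by (rule Lim_transform_eventually)
  ultimately show ?thesis by (rule tendsto_unique[rotated]) (simp add: prod_filter_eq_bot)
qed

theorem proposition1:
  fixes \<alpha> \<beta> :: real
    and \<nu> :: "'e::{banach, second_countable_topology} measure"
    and \<Omega> :: "'e measure \<Rightarrow> 'w measure"
    and Y :: "'e measure \<Rightarrow> real \<Rightarrow> 'w \<Rightarrow> 'e"
  assumes levy: "\<And>\<mu>. \<mu> \<in> infinitely_divisible \<Longrightarrow>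
                   levy_process (\<Omega> \<mu>) (Y \<mu>) \<and> distr (\<Omega> \<mu>) borel (Y \<mu> 1) = \<mu>"
    and "\<beta> < \<alpha>"
    and "\<nu> \<in> infinitely_divisible"
    and "\<nu> \<in> improper_map_dom \<Omega> Y (\<lambda>s. s) (beta_clock \<alpha> \<beta>) ends_0_1"
    and "improper_map \<Omega> Y (\<lambda>s. s) (beta_clock \<alpha> \<beta>) ends_0_1 \<nu>
           \<in> improper_map_dom \<Omega> Y (\<lambda>t. t) (gamma_clock \<beta>) ends_0_infinity"
    and "\<nu> \<in> improper_map_dom \<Omega> Y (\<lambda>t. t) (gamma_clock \<alpha>) ends_0_infinity"
  shows "improper_map \<Omega> Y (\<lambda>t. t) (gamma_clock \<beta>) ends_0_infinity
           (improper_map \<Omega> Y (\<lambda>s. s) (beta_clock \<alpha> \<beta>) ends_0_1 \<nu>)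
         = improper_map \<Omega> Y (\<lambda>t. t) (gamma_clock \<alpha>) ends_0_infinity \<nu>"
proof -
  define \<mu> where "\<mu> = improper_map \<Omega> Y (\<lambda>s. s) (beta_clock \<alpha> \<beta>) ends_0_1 \<nu>"
  \<comment> \<open>Membership in the domain of the outer mapping contains infinite divisibility,
    which provides the process of \<open>\<mu>\<close>.\<close>
  have \<mu>: "\<mu> \<in> infinitely_divisible" using assms(5) by (simp add: \<mu>_def improper_map_dom_def)
  have ne: "ends_0_1 \<noteq> bot" "ends_0_infinity \<noteq> bot" by (simp_all add: prod_filter_eq_bot)
  note wl\<mu> = improper_map_weak_limit[OF assms(4) ne(1), folded \<mu>_def]
  note wl1 = improper_map_weak_limit[OF assms(5) ne(2), folded \<mu>_def]
  note wl2 = improper_map_weak_limit[OF assms(6) ne(2)]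
  have Y: "levy_process (\<Omega> \<nu>) (Y \<nu>)" "levy_process (\<Omega> \<mu>) (Y \<mu>)"
    and Y1: "distr (\<Omega> \<mu>) borel (Y \<mu> 1) = \<mu>"
    using levy[OF assms(3)] levy[OF \<mu>] by auto
  let ?\<rho> = "beta_clock_density \<alpha> \<beta>"
  have "improper_map \<Omega> Y (\<lambda>t. t) (gamma_clock \<beta>) ends_0_infinity \<mu> =
      improper_map \<Omega> Y (\<lambda>t. t) (gamma_clock \<alpha>) ends_0_infinity \<nu>"
  proof (rule cf_unique[OF weak_limit_prob[OF wl1] weak_limit_prob[OF wl2]])
    fix l :: "'e \<Rightarrow> real" assume l: "bounded_linear l"
    obtain g where g: "continuous_on {0..} g" "g 0 = 0" "\<And>u t. u \<ge> 0 \<Longrightarrow> t \<ge> 0 \<Longrightarrow>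
        cf (distr (\<Omega> \<nu>) borel (Y \<nu> t)) (\<lambda>x. u * l x) = exp (complex_of_real t * g u)"
      using levy_exponent[OF Y(1) l] by blast
    obtain G where G: "continuous_on {0..} G" "G 0 = 0" "\<And>u t. u \<ge> 0 \<Longrightarrow> t \<ge> 0 \<Longrightarrow>
        cf (distr (\<Omega> \<mu>) borel (Y \<mu> t)) (\<lambda>x. u * l x) = exp (complex_of_real t * G u)"
      using levy_exponent[OF Y(2) l] by blast
    obtain C where C: "\<And>u. u \<ge> 0 \<Longrightarrow> norm (g u) \<le> C * (1 + u\<^sup>2)"
      using quadratic_growth_if_doubling[OF g(1) levy_exponent_doubling[OF Y(1) l g(3)]] by blast
    note map = random_integral_map_tail_clock[where \<Omega> = \<Omega> and \<nu> = \<nu> and Y = Y and g = g and l = l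
        and \<rho> = ?\<rho>, OF Y(1) l g(1,3) beta_clock_density_integrable[OF assms(2)]
        beta_clock_density_nonneg[OF assms(2)], folded beta_clock_tail]
    let ?N = "\<lambda>(a, b). random_integral_map \<Omega> Y (\<lambda>s. s) (beta_clock \<alpha> \<beta>) a b \<nu>"
    let ?J = "\<lambda>(a, b) t. LBINT s:{a<..b}. ?\<rho> s *\<^sub>R g (t * s)"
    \<comment> \<open>Identifies the exponent \<open>G\<close> of the process of
      \<open>\<mu>\<close>, which is obtained independently of \<open>g\<close>, as the limit of the
      exponents of the proper inner integrals.\<close>
    have unif: "uniform_limit {0..T} ?J G ends_0_1" if T: "T \<ge> 0" for T
    proof (rule weak_limit_log_uniform[OF wl\<mu> l])
      show "\<forall>\<^sub>F x in ends_0_1. prob_space (?N x) \<and> sets (?N x) = sets borel"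
        using eventually_ends_0_1 by eventually_elim (simp add: case_prod_beta map)
      show "\<forall>\<^sub>F x in ends_0_1. continuous_on {0..T} (?J x) \<and> ?J x 0 = 0 \<and>
          (\<forall>u\<in>{0..T}. cf (?N x) (\<lambda>y. u * l y) = exp (?J x u))"
        using eventually_ends_0_1
      proof eventually_elim
        case (elim x)
        have "set_integrable lborel {fst x<..snd x} ?\<rho>"
          using elim by (intro set_integrable_Ioc beta_clock_density_integrable assms) auto
        from continuous_integral_along_ray[OF g(1) this _ _ T] elim
        have "continuous_on {0..T} (?J x)" by (simp add: case_prod_beta)
        moreover have "?J x 0 = 0" by (simp add: case_prod_beta g(2) set_lebesgue_integral_def)
        ultimately show ?case using elim map(3)[of "fst x" "snd x"] by (simp add: case_prod_beta)
      qed
      show "continuous_on {0..T} G" by (rule continuous_on_subset[OF G(1)]) auto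
      show "cf \<mu> (\<lambda>x. u * l x) = exp (G u)" if "u \<in> {0..T}" for u
        \<comment> \<open>The law at time 1 is \<open>\<mu>\<close> itself, the weak limit of the
          inner integrals.\<close>
        using G(3)[of u 1] that Y1 by simp
    qed (rule G(2))
    define f where "f = (\<lambda>u. gamma_clock_density \<alpha> u *\<^sub>R g u)"
    define h where "h = (\<lambda>t. gamma_clock_density \<beta> t *\<^sub>R G t)"
    have dc: "continuous_on {0<..} (gamma_clock_density c)" for c
      unfolding gamma_clock_density_def[abs_def] by (intro continuous_intros) auto
    have fc: "continuous_on {0<..} f" "continuous_on {0<..} h"
      unfolding f_def h_def
      by (intro continuous_on_scaleR dc continuous_on_subset[OF g(1)] continuous_on_subset[OF G(1)]; auto)+
    have fi: "set_integrable lborel {x<..} f" if "x > 0" for x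
      unfolding f_def gamma_clock_density_def by (rule set_integrable_powr_exp[OF g(1) C that])
    have lim: "uniform_limit {a..b} (\<lambda>e t. LBINT u:{e<..t}. gamma_density (\<alpha> - \<beta>) (t - u) *\<^sub>R f u) h (at_right 0)"
      if "0 < a" "a \<le> b" for a b
      unfolding f_def h_def by (rule beta_clock_uniform_limit[OF assms(2) g(1) that unif]) (use that in simp)
    have pos: "\<alpha> - \<beta> > 0" using assms(2) by simp
    obtain \<Lambda> where \<Lambda>: "((\<lambda>(a, b). LBINT t:{a<..b}. h t) \<longlongrightarrow> \<Lambda>) ends_0_infinity"
      "((\<lambda>(a, b). LBINT t:{a<..b}. f t) \<longlongrightarrow> \<Lambda>) ends_0_infinity"
      by (rule integral_limit_eq[OF pos fc(1) fi fc(2) lim])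
    show "cf (improper_map \<Omega> Y (\<lambda>t. t) (gamma_clock \<beta>) ends_0_infinity \<mu>) l =
        cf (improper_map \<Omega> Y (\<lambda>t. t) (gamma_clock \<alpha>) ends_0_infinity \<nu>) l"
      using weak_limit_gamma_clock_cf[OF Y(2) l G(1,3) wl1 \<Lambda>(1)[unfolded h_def]]
        weak_limit_gamma_clock_cf[OF Y(1) l g(1,3) wl2 \<Lambda>(2)[unfolded f_def]] by simp
  qed
  then show ?thesis by (simp add: \<mu>_def)
qed

end
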